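(* Let $H$ be a special co-ET0L group and let $K$ be a finitely generated virtually free group. Then the (standard) restricted wreath product $H\wr K$, with top group $K$, is a special co-ET0L group.
   Context: **Wreath product.** The standard restricted wreath product $H\wr K$ is the semidirect product $\big(\bigoplus_{k\in K}H\big)\rtimes K$, where $K$ permutes the direct summands of the base group by its regular action on itself. **Check stack pushdown automata (cspda).** A cspda $M$ over a finite input alphabet $A$ is a non-deterministic finite-state automaton (with a finite set of states, a single initial state, and a subset of accepting states) with a one-way input tape, a check stack with finite alphabet $\Delta$ and a pushdown stack with finite alphabet $\Gamma$. A computation has two stages. - First stage (initialisation): starting from the initial state, $M$ non-deterministically pushes symbols onto the check stack under the control of its finite-state control. It does not read input and does not use the pushdown stack. (So the possible check stack contents form a regular language.) - Second stage: the check stack is never altered. $M$ may read letters from the input tape and push symbols onto, or pop symbols from, the pushdown stack. The read-write head is always at the top of the pushdown stack and at the corresponding height on the check stack (it moves up by one on both when a symbol is pushed and down by one when a symbol is popped). Each transition depends on the current state, the top pushdown symbol, the check stack symbol at the same height, and, if it is a reading transition, the next input letter, which is consumed. It changes the state and may push or pop. $M$ accepts $w\in A^*$ if some computation enters an accepting state at some stage after reading all of $w$; $L(M)$ is the set of accepted words. A configuration consists of the state and the contents of the two stacks. **Special cspda.** $M$ is special if (P1)–(P7) hold. - (P1) Each state is either reading (all its out-transitions read an input letter) or non-reading (none of its out-transitions reads an input letter). - (P2) The operation of $M$ throughout the second stage is deterministic. - (P3) $\Delta$ and $\Gamma$ both contain a bottom-of-stack symbol $\mathfrak b$ and a padding symbol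 $\mathsf p$, and $\Delta$ contains a top-of-stack symbol $\mathfrak t$. After initialisation the check stack has $\mathfrak b$ at the bottom and $\mathfrak t$ at the top. The first transition of the second stage writes $\mathfrak b$ at the bottom of the pushdown stack, after which $M$ moves into a reading state. The symbol $\mathfrak b$ occurs only at the bottoms of the two stacks, $\mathfrak t$ occurs only at the top of the check stack, $\mathfrak b$ is never popped, and when $\mathfrak t$ is seen on the check stack no symbol can be pushed (so the head never moves above the top of the check stack). - (P4) No computation contains an infinitely long sequence of non-reading transitions in the second stage. - (P5) All accepting states are reading states. - (P6) For every entry configuration $C$ and all $u,v\in A^*$ with $v\notin L(M)$, either $C^{uv}=C^u$ or $C^{uv}$ fails. - (P7) The accepting states are exactly the reading states that are not entry states. Terminology used here: a configuration is reading (accepting) if its state is reading (accepting). An entry configuration is one arising immediately after the first transition of the second stage (the one writing $\mathfrak b$ on the pushdown stack), and its state is an entry state. A failing configuration is a non-accepting reading configuration from which no accepting configuration can be reached. For a reading configuration $C$ and $w\in A^*$, $C^w$ is the configuration of $M$, run in the second stage from $C$ on input $w$, as it enters its first reading state after reading all of $w$ (so $C^{\epsilon}=C$ for the empty word $\epsilon$). $C^w$ fails if a failing configuration is entered in this process, or if the machine gets stuck before reaching such a reading state. **Special co-ET0L groups.** A language accepted by a special cspda is a special ET0L language. For a group $G$ with finite inverse-closed generating set $A$, $\mathsf{coWP}(G,A)=\{w\in A^*: w\neq_G 1\}$. A finitely generated group $G$ is a special co-ET0L group if, for some finite inverse-closed generating set $A$ of $G$, some special cspda with input alphabet $A$ (and,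 by convention, $A\subseteq\Delta$, $A\subseteq\Gamma$) accepts $\mathsf{coWP}(G,A)$. *)

theory Defs
  imports "HOL-Algebra.Product_Groups"
begin

section \<open>Check stack pushdown automata\<close>

datatype 's stack_move = Keep | Push 's | Pop

text \<open>
  A first-stage transition \<open>(q, s, q')\<close> pushes \<open>s\<close> onto the check stack.
  A second-stage transition \<open>(q, x, v, m, q')\<close> reads the letter \<open>a\<close> if \<open>x = Some a\<close> and reads
  nothing if \<open>x = None\<close>; \<open>v\<close> is what the head sees: \<open>Some (g, d)\<close> for the pushdown symbol \<open>g\<close>
  and the check stack symbol \<open>d\<close> at the height of the head, \<open>None\<close> for an empty pushdown stack.

  The component \<open>reading\<close> is only constrained for special automata. It is a component because a
  state without out-transitions satisfies the requirements of both kinds of state.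
\<close>

record ('q, 'a, 's) cspda =
  states :: "'q set"
  initial :: 'q
  accepting :: "'q set"
  reading :: "'q set"
  input_alphabet :: "'a set"
  check_alphabet :: "'s set"
  pushdown_alphabet :: "'s set"
  init_transitions :: "('q \<times> 's \<times> 'q) set"
  transitions :: "('q \<times> 'a option \<times> ('s \<times> 's) option \<times> 's stack_move \<times> 'q) set"

definition cspda :: "('q, 'a, 's) cspda \<Rightarrow> bool" where
  "cspda M \<longleftrightarrow>
     finite (states M) \<and> finite (input_alphabet M) \<and>
     finite (check_alphabet M) \<and> finite (pushdown_alphabet M) \<and>
     initial M \<in> states M \<and> accepting M \<subseteq> states M \<and> reading M \<subseteq> states M \<and>
     init_transitions M \<subseteq> states M \<times> check_alphabet M \<times> states M \<and>
     (\<forall>(q, x, v, m, q') \<in> transitions M.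
        q \<in> states M \<and> q' \<in> states M \<and>
        set_option x \<subseteq> input_alphabet M \<and>
        set_option v \<subseteq> pushdown_alphabet M \<times> check_alphabet M \<and>
        set_stack_move m \<subseteq> pushdown_alphabet M)"

text \<open>
  A configuration is a triple of the state, the check stack and the pushdown stack. The check stack
  is listed from bottom to top, the pushdown stack from top to bottom; hence the check stack symbol
  at the height of the head is the entry at index \<open>length ps - 1\<close>.
\<close>

type_synonym ('q, 's) config = "'q \<times> 's list \<times> 's list"

abbreviation state_of :: "('q, 's) config \<Rightarrow> 'q" where
  "state_of \<equiv> fst"

inductive initialises :: "('q, 'a, 's) cspda \<Rightarrow> 'q \<Rightarrow> 's list \<Rightarrow> bool" for M where
  start: "initialises M (initial M) []"
| push: "initialises M q ds \<Longrightarrow> (q, s, q') \<in> init_transitions M \<Longrightarrow> initialises M q' (ds @ [s])"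

fun head_view :: "'s list \<Rightarrow> 's list \<Rightarrow> ('s \<times> 's) option" where
  "head_view ds [] = None"
| "head_view ds (g # ps) = Some (g, ds ! length ps)"

text \<open>The premise \<open>length ps < length ds\<close> keeps the head within the check stack.\<close>

inductive step ::
  "('q, 'a, 's) cspda \<Rightarrow> ('q, 's) config \<Rightarrow> 'a option \<Rightarrow> ('q, 's) config \<Rightarrow> bool" for M where
  keep: "(q, x, head_view ds ps, Keep, q') \<in> transitions M \<Longrightarrow>
           step M (q, ds, ps) x (q', ds, ps)"
| push: "(q, x, head_view ds ps, Push g, q') \<in> transitions M \<Longrightarrow> length ps < length ds \<Longrightarrow>
           step M (q, ds, ps) x (q', ds, g # ps)"
| pop: "(q, x, head_view ds (g # ps), Pop, q') \<in> transitions M \<Longrightarrow>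
           step M (q, ds, g # ps) x (q', ds, ps)"

inductive run ::
  "('q, 'a, 's) cspda \<Rightarrow> ('q, 's) config \<Rightarrow> 'a list \<Rightarrow> ('q, 's) config \<Rightarrow> bool" for M where
  refl: "run M c [] c"
| silent: "step M c None c' \<Longrightarrow> run M c' w c'' \<Longrightarrow> run M c w c''"
| letter: "step M c (Some a) c' \<Longrightarrow> run M c' w c'' \<Longrightarrow> run M c (a # w) c''"

definition second_stage_reachable :: "('q, 'a, 's) cspda \<Rightarrow> 'a list \<Rightarrow> ('q, 's) config \<Rightarrow> bool" where
  "second_stage_reachable M w c \<longleftrightarrow> (\<exists>q ds. initialises M q ds \<and> run M (q, ds, []) w c)"

definition language :: "('q, 'a, 's) cspda \<Rightarrow> 'a list set" where
  "language M = {w \<in> lists (input_alphabet M).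
     \<exists>c. second_stage_reachable M w c \<and> state_of c \<in> accepting M}"


section \<open>Special automata\<close>

text \<open>
  Any finite stack alphabet embeds into this type; the constructor \<open>Letter\<close> realises the
  inclusion of the input alphabet in the stack alphabets.
\<close>

datatype 'a stack_symbol = Bottom | Padding | Top | Letter 'a | Aux nat

definition entry_config :: "('q, 'a, 's) cspda \<Rightarrow> ('q, 's) config \<Rightarrow> bool" where
  "entry_config M c \<longleftrightarrow> (\<exists>q ds x. initialises M q ds \<and> step M (q, ds, []) x c)"

definition entry_states :: "('q, 'a, 's) cspda \<Rightarrow> 'q set" where
  "entry_states M = {state_of c | c. entry_config M c}"

definition failing :: "('q, 'a, 's) cspda \<Rightarrow> ('q, 's) config \<Rightarrow> bool" where
  "failing M c \<longleftrightarrow>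
     state_of c \<in> reading M - accepting M \<and>
     \<not> (\<exists>w c'. run M c w c' \<and> state_of c' \<in> accepting M)"

inductive first_reading ::
  "('q, 'a, 's) cspda \<Rightarrow> ('q, 's) config \<Rightarrow> ('q, 's) config \<Rightarrow> bool" for M where
  here: "state_of c \<in> reading M \<Longrightarrow> first_reading M c c"
| later: "state_of c \<notin> reading M \<Longrightarrow> step M c None c' \<Longrightarrow> first_reading M c' c'' \<Longrightarrow>
            first_reading M c c''"

text \<open>
  \<open>config_after M C w D\<close> means \<open>C\<^sup>w = D\<close>; it is a relation because \<open>C\<^sup>w\<close> need not exist.
\<close>

definition config_after ::
  "('q, 'a, 's) cspda \<Rightarrow> ('q, 's) config \<Rightarrow> 'a list \<Rightarrow> ('q, 's) config \<Rightarrow> bool" where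
  "config_after M C w D \<longleftrightarrow>
     (if w = [] then D = C
      else \<exists>c c'. run M C (butlast w) c \<and> step M c (Some (last w)) c' \<and> first_reading M c' D)"

definition stuck :: "('q, 'a, 's) cspda \<Rightarrow> ('q, 's) config \<Rightarrow> 'a list \<Rightarrow> bool" where
  "stuck M c v \<longleftrightarrow>
     \<not> (\<exists>c'. step M c None c') \<and> (v = [] \<or> \<not> (\<exists>c'. step M c (Some (hd v)) c'))"

text \<open>
  Here \<open>v\<close> is the part of \<open>w\<close> still to be read at \<open>c\<close>. A reading configuration with no input left
  is the end of the process and not a place where the automaton is stuck.
\<close>

definition config_after_fails ::
  "('q, 'a, 's) cspda \<Rightarrow> ('q, 's) config \<Rightarrow> 'a list \<Rightarrow> bool" where
  "config_after_fails M C w \<longleftrightarrow>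
     (\<exists>u v c. w = u @ v \<and> run M C u c \<and>
        (failing M c \<or> stuck M c v \<and> \<not> (v = [] \<and> state_of c \<in> reading M)))"

definition reading_dichotomy :: "('q, 'a, 's) cspda \<Rightarrow> bool" where
  "reading_dichotomy M \<longleftrightarrow>
     (\<forall>(q, s, q') \<in> init_transitions M. q \<notin> reading M) \<and>
     (\<forall>(q, x, v, m, q') \<in> transitions M. q \<in> reading M \<longleftrightarrow> x \<noteq> None)"

definition deterministic :: "('q, 'a, 's) cspda \<Rightarrow> bool" where
  "deterministic M \<longleftrightarrow>
     (\<forall>q v x m p x' m' p'.
        (q, x, v, m, p) \<in> transitions M \<longrightarrow> (q, x', v, m', p') \<in> transitions M \<longrightarrow>
        x = x' \<or> x = None \<or> x' = None \<longrightarrow> (x, m, p) = (x', m', p'))"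

text \<open>
  Initialisation ends when the first second-stage transition is made, so the condition on the
  complete check stack is imposed on those \<open>ds\<close> from which such a transition is possible. That
  transition reads no input, since the word \<open>w\<close> is still to be read in full at an entry
  configuration.
\<close>

definition stack_discipline :: "('q, 'a, 'a stack_symbol) cspda \<Rightarrow> bool" where
  "stack_discipline M \<longleftrightarrow>
     {Bottom, Padding, Top} \<subseteq> check_alphabet M \<and> {Bottom, Padding} \<subseteq> pushdown_alphabet M \<and>
     (\<forall>q ds. initialises M q ds \<longrightarrow> Bottom \<notin> set (tl ds) \<and> Top \<notin> set (butlast ds)) \<and>
     (\<forall>q ds x c. initialises M q ds \<longrightarrow> step M (q, ds, []) x c \<longrightarrow>
        ds \<noteq> [] \<and> hd ds = Bottom \<and> last ds = Top \<and>
        x = None \<and> (\<exists>q' \<in> reading M. c = (q', ds, [Bottom]))) \<and>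
     (\<forall>q x g d m q'. (q, x, Some (g, d), m, q') \<in> transitions M \<longrightarrow>
        m \<noteq> Push Bottom \<and> m \<noteq> Push Top \<and>
        (g = Bottom \<longrightarrow> m \<noteq> Pop) \<and>
        (d = Top \<longrightarrow> (\<forall>s. m \<noteq> Push s)))"

definition no_infinite_silent_run :: "('q, 'a, 's) cspda \<Rightarrow> bool" where
  "no_infinite_silent_run M \<longleftrightarrow>
     \<not> (\<exists>w f. second_stage_reachable M w (f 0) \<and> (\<forall>i::nat. step M (f i) None (f (Suc i))))"

definition stable_under_rejected :: "('q, 'a, 's) cspda \<Rightarrow> bool" where
  "stable_under_rejected M \<longleftrightarrow>
     (\<forall>C. \<forall>u \<in> lists (input_alphabet M). \<forall>v \<in> lists (input_alphabet M).
        entry_config M C \<longrightarrow> v \<notin> language M \<longrightarrow>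
        (\<exists>D. config_after M C (u @ v) D \<and> config_after M C u D) \<or>
        config_after_fails M C (u @ v))"

definition special_cspda :: "('q, 'a, 'a stack_symbol) cspda \<Rightarrow> bool" where
  "special_cspda M \<longleftrightarrow>
     cspda M \<and>
     reading_dichotomy M \<and>
     deterministic M \<and>
     stack_discipline M \<and>
     no_infinite_silent_run M \<and>
     accepting M \<subseteq> reading M \<and>
     stable_under_rejected M \<and>
     accepting M = reading M - entry_states M"


section \<open>Groups\<close>

definition word_value :: "('g, 'm) monoid_scheme \<Rightarrow> 'g list \<Rightarrow> 'g" where
  "word_value G w = foldr (\<otimes>\<^bsub>G\<^esub>) w \<one>\<^bsub>G\<^esub>"

definition coWP :: "('g, 'm) monoid_scheme \<Rightarrow> 'g set \<Rightarrow> 'g list set" where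
  "coWP G A = {w \<in> lists A. word_value G w \<noteq> \<one>\<^bsub>G\<^esub>}"

text \<open>As automata have finitely many states, states of type \<open>nat\<close> suffice.\<close>

definition special_co_ET0L_group :: "('g, 'm) monoid_scheme \<Rightarrow> bool" where
  "special_co_ET0L_group G \<longleftrightarrow>
     group G \<and>
     (\<exists>A \<subseteq> carrier G. finite A \<and> (\<forall>a \<in> A. inv\<^bsub>G\<^esub> a \<in> A) \<and> generate G A = carrier G \<and>
        (\<exists>M :: (nat, 'g, 'g stack_symbol) cspda.
           special_cspda M \<and> input_alphabet M = A \<and>
           Letter ` A \<subseteq> check_alphabet M \<and> Letter ` A \<subseteq> pushdown_alphabet M \<and>
           language M = coWP G A))"

definition finitely_generated_group :: "('g, 'm) monoid_scheme \<Rightarrow> bool" where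
  "finitely_generated_group G \<longleftrightarrow>
     group G \<and> (\<exists>S \<subseteq> carrier G. finite S \<and> generate G S = carrier G)"

text \<open>\<open>(x, True)\<close> stands for the generator \<open>x\<close> and \<open>(x, False)\<close> for its inverse.\<close>

definition reduced :: "('g \<times> bool) list \<Rightarrow> bool" where
  "reduced w \<longleftrightarrow> successively (\<lambda>(x, s) (y, t). \<not> (x = y \<and> s \<noteq> t)) w"

definition signed_word_value :: "('g, 'm) monoid_scheme \<Rightarrow> ('g \<times> bool) list \<Rightarrow> 'g" where
  "signed_word_value G w = word_value G (map (\<lambda>(x, s). if s then x else inv\<^bsub>G\<^esub> x) w)"

definition free_group :: "('g, 'm) monoid_scheme \<Rightarrow> bool" where
  "free_group G \<longleftrightarrow>
     group G \<and>
     (\<exists>X \<subseteq> carrier G. generate G X = carrier G \<and>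
        (\<forall>w \<in> lists (X \<times> UNIV). w \<noteq> [] \<longrightarrow> reduced w \<longrightarrow> signed_word_value G w \<noteq> \<one>\<^bsub>G\<^esub>))"

definition virtually_free_group :: "('g, 'm) monoid_scheme \<Rightarrow> bool" where
  "virtually_free_group G \<longleftrightarrow>
     group G \<and>
     (\<exists>F. subgroup F G \<and> finite (rcosets\<^bsub>G\<^esub> F) \<and> free_group (G\<lparr>carrier := F\<rparr>))"

text \<open>
  An element \<open>k\<close> of the top group moves the direct summand at \<open>y\<close> to the one at \<open>k \<otimes> y\<close>,
  that is, the function \<open>g\<close> is sent to \<open>\<lambda>x. g (inv k \<otimes> x)\<close>.
\<close>

definition wreath_product ::
  "('h, 'm) monoid_scheme \<Rightarrow> ('k, 'n) monoid_scheme \<Rightarrow> (('k \<Rightarrow> 'h) \<times> 'k) monoid" where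
  "wreath_product H K =
     (let B = sum_group (carrier K) (\<lambda>_. H) in
      \<lparr>carrier = carrier B \<times> carrier K,
       monoid.mult = (\<lambda>(f, k) (g, l).
         (f \<otimes>\<^bsub>B\<^esub> (\<lambda>x \<in> carrier K. g (inv\<^bsub>K\<^esub> k \<otimes>\<^bsub>K\<^esub> x)), k \<otimes>\<^bsub>K\<^esub> l)),
       one = (\<one>\<^bsub>B\<^esub>, \<one>\<^bsub>K\<^esub>)\<rparr>)"

end

theory Submission
  imports Defs "HOL-Library.Sublist" "HOL-Library.Countable_Set"
begin

text \<open>
  Let \<open>N\<close> be a special automaton for \<open>H\<close> and let \<open>K\<close> be a finite extension of a free group \<open>F\<close>. An
  element of the wreath product is nontrivial iff its top component is nontrivial or its component
  at some \<open>k\<close> in \<open>K\<close> is, and the component of a word at \<open>k\<close> is the product of the letters from \<open>H\<close>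
  read while the position in \<open>K\<close> is \<open>k\<close>. A position is a reduced word of \<open>F\<close> together with one of
  finitely many coset representatives, so it fits into a pushdown stack and a state. The
  initialisation guesses which of the two reasons applies. In the first case the automaton tracks
  the position and accepts while it is nontrivial. In the second case it guesses \<open>k\<close>, writes the
  reduced word of \<open>k\<close> and then a check stack of \<open>N\<close>, and feeds the letters from \<open>H\<close> to \<open>N\<close> whenever
  the position is \<open>k\<close>; the pushdown stack of \<open>N\<close> is kept above the word of \<open>k\<close>, and excursions from
  \<open>k\<close> are pushed above that. Enough padding leaves room for every excursion, and an overflow is a
  failure. Trivial words restore the position and are rejected by \<open>N\<close>, whence (P6). For (P7) the
  automaton can also be initialised in the states where \<open>N\<close> does not accept although it has left its
  entry configuration; it is stuck there.
\<close>

section \<open>Runs between reading configurations\<close>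

text \<open>Condition (P6) compares whole configurations, stack contents included, so a trivial word
  must restore not only the position but every symbol on the pushdown stack. This obstacle shapes
  the design: a mark \<open>On\<close> or \<open>Off\<close> depends only on the letters up to it,
  on the target and on whether the stack of \<open>N\<close> is open, and that stack is closed as
  soon as \<open>N\<close> is back in its entry configuration. Otherwise a visit to \<open>k\<close>
  without effect would leave a trace. Condition (P7) makes every non-accepting reading state an
  entry state. Such states carry a coset representative, so with a target the automaton may be
  entered at any representative and not only at the identity. This does no harm: a trivial word
  fixes every position, and by left translation its components are trivial from every starting
  position. Overflow and blocking of \<open>N\<close> both end in a non-reading configuration
  without successor. For (P6) this is a failure, for (P4) it ends the silent run, and for the
  language one amount of padding that suits the given word is enough.\<close>

declare split_paired_Ex [simp del] split_paired_All [simp del]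

definition halted :: "('q, 'a, 's) cspda \<Rightarrow> ('q, 's) config \<Rightarrow> bool" where
  "halted M c \<longleftrightarrow> state_of c \<notin> reading M \<and> (\<nexists>c'. step M c None c')"

text \<open>Acceptance and (P6) look only at reading configurations, so the silent steps after a
  letter are counted as part of reading it. The whole analysis is carried out in these
  units.\<close>

definition macro_step :: "('q, 'a, 's) cspda \<Rightarrow> ('q, 's) config \<Rightarrow> 'a \<Rightarrow> ('q, 's) config \<Rightarrow> bool" where
  "macro_step M c a d \<longleftrightarrow> (\<exists>c'. step M c (Some a) c' \<and> first_reading M c' d)"

text \<open>The condition holds vacuously if no step on \<open>a\<close> exists, so it covers both
  ways of getting stuck on a letter: at once, or after some silent steps.\<close>

definition dead :: "('q, 'a, 's) cspda \<Rightarrow> ('q, 's) config \<Rightarrow> 'a \<Rightarrow> bool" where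
  "dead M c a \<longleftrightarrow> (\<forall>c'. step M c (Some a) c' \<longrightarrow> (\<exists>d. run M c' [] d \<and> halted M d))"

inductive macro_steps ::
  "('q, 'a, 's) cspda \<Rightarrow> ('q, 's) config \<Rightarrow> 'a list \<Rightarrow> ('q, 's) config \<Rightarrow> bool" for M where
  refl: "macro_steps M c [] c"
| cons: "macro_step M c a d \<Longrightarrow> macro_steps M d w e \<Longrightarrow> macro_steps M c (a # w) e"

inductive_simps macro_steps_Nil: "macro_steps M c [] d"
inductive_simps macro_steps_Cons: "macro_steps M c (a # w) d"

lemma macro_steps_append:
  "macro_steps M c (u @ v) d \<longleftrightarrow> (\<exists>e. macro_steps M c u e \<and> macro_steps M e v d)"
  by (induction u arbitrary: c) (auto simp: macro_steps_Nil macro_steps_Cons)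

lemma macro_steps_snoc:
  "macro_steps M c (u @ [a]) d \<longleftrightarrow> (\<exists>e. macro_steps M c u e \<and> macro_step M e a d)"
  by (auto simp: macro_steps_append macro_steps_Nil macro_steps_Cons)

lemma run_append: "run M c u d \<Longrightarrow> run M d v e \<Longrightarrow> run M c (u @ v) e"
  by (induction rule: run.induct) (auto intro: run.intros)

lemma run_silent_trans: "run M c [] d \<Longrightarrow> run M d w e \<Longrightarrow> run M c w e"
  using run_append[of M c "[]"] by simp

lemma first_reading_run: "first_reading M c d \<Longrightarrow> run M c [] d"
  by (induction rule: first_reading.induct) (auto intro: run.intros)

lemma first_reading_reading: "first_reading M c d \<Longrightarrow> state_of d \<in> reading M"
  by (induction rule: first_reading.induct) auto

lemma first_reading_of_reading: "first_reading M c d \<Longrightarrow> state_of c \<in> reading M \<Longrightarrow> d = c"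
  by (auto elim: first_reading.cases)

lemma macro_steps_run: "macro_steps M c w d \<Longrightarrow> run M c w d"
proof (induction rule: macro_steps.induct)
  case (cons c a d w e)
  then obtain c' where "step M c (Some a) c'" "first_reading M c' d"
    by (auto simp: macro_step_def)
  with cons show ?case
    using run.letter run_silent_trans[OF first_reading_run] by metis
qed (rule run.refl)

lemma macro_steps_reading:
  "macro_steps M c w d \<Longrightarrow> state_of c \<in> reading M \<Longrightarrow> state_of d \<in> reading M"
  by (induction rule: macro_steps.induct) (auto simp: macro_step_def dest: first_reading_reading)

locale det_cspda =
  fixes M :: "('q, 'a, 's) cspda"
  assumes dichotomy: "reading_dichotomy M" and determinism: "deterministic M"
begin

lemma step_transition:
  assumes "step M c x c'"
  obtains m where "(state_of c, x, head_view (fst (snd c)) (snd (snd c)), m, state_of c') \<in> transitions M"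
  using assms by (cases rule: step.cases) auto

lemma step_reading_iff:
  assumes "step M c x c'"
  shows "state_of c \<in> reading M \<longleftrightarrow> x \<noteq> None"
proof -
  obtain m where "(state_of c, x, head_view (fst (snd c)) (snd (snd c)), m, state_of c') \<in> transitions M"
    using step_transition[OF assms] .
  then show ?thesis using dichotomy unfolding reading_dichotomy_def by auto
qed

text \<open>\<open>deterministic\<close> speaks of transitions; the move and the new state, together
  with the old stacks, fix the new configuration. The disjunctive premise also excludes a silent
  step beside a reading one.\<close>

lemma step_unique:
  assumes "step M c x c1" "step M c x' c2" "x = x' \<or> x = None \<or> x' = None"
  shows "x = x' \<and> c1 = c2"
proof -
  have *: "(x, m, p) = (x', m', p')"
    if "(q, x, v, m, p) \<in> transitions M" "(q, x', v, m', p') \<in> transitions M" for q v m p m' p'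
    using determinism that assms(3) unfolding deterministic_def by blast
  show ?thesis
    using assms(1)
  proof (cases rule: step.cases)
    case 1: (keep q ds ps q')
    show ?thesis using assms(2) 1 by (cases rule: step.cases) (auto dest!: *)
  next
    case 1: (push q ds ps g q')
    show ?thesis using assms(2) 1 by (cases rule: step.cases) (auto dest!: *)
  next
    case 1: (pop q ds g ps q')
    show ?thesis using assms(2) 1 by (cases rule: step.cases) (auto dest!: *)
  qed
qed

lemma first_reading_unique: "first_reading M c d \<Longrightarrow> first_reading M c e \<Longrightarrow> d = e"
proof (induction rule: first_reading.induct)
  case (here c)
  then show ?case using first_reading_of_reading by metis
next
  case (later c c' c'')
  from later.prems show ?case
  proof (cases rule: first_reading.cases)
    case here
    then show ?thesis using later.hyps(1) by simp
  next
    case (later c1)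
    have "c1 = c'" using step_unique[OF later(2) \<open>step M c None c'\<close>] by simp
    then show ?thesis using later(3) \<open>first_reading M c' e \<Longrightarrow> c'' = e\<close> by simp
  qed
qed

lemma macro_step_unique: "macro_step M c a d \<Longrightarrow> macro_step M c a e \<Longrightarrow> d = e"
  unfolding macro_step_def using step_unique first_reading_unique by blast

lemma macro_steps_unique: "macro_steps M c w d \<Longrightarrow> macro_steps M c w e \<Longrightarrow> d = e"
proof (induction arbitrary: e rule: macro_steps.induct)
  case (refl c)
  then show ?case by (simp add: macro_steps_Nil)
next
  case (cons c a d w e)
  then show ?case unfolding macro_steps_Cons using macro_step_unique by blast
qed

text \<open>By determinism the silent steps from a configuration form a single path, and this path
  ends at the reading configuration, where no silent step is possible.\<close>

lemma first_reading_not_halted: "first_reading M c d \<Longrightarrow> run M c [] e \<Longrightarrow> \<not> halted M e"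
proof (induction rule: first_reading.induct)
  case (here c)
  from here.prems have "e = c"
    by (cases rule: run.cases) (use here step_reading_iff in auto)
  with here show ?case by (simp add: halted_def)
next
  case (later c c' c'')
  from later.prems consider "e = c" | d where "step M c None d" "run M d [] e"
    by (cases rule: run.cases) auto
  then show ?case
  proof cases
    case 1
    then show ?thesis using later by (auto simp: halted_def)
  next
    case 2
    have "d = c'" using step_unique[OF 2(1) later.hyps(2)] by simp
    then show ?thesis using 2 later.IH by simp
  qed
qed

lemma dead_not_macro_step: "dead M c a \<Longrightarrow> \<not> macro_step M c a d"
  unfolding dead_def macro_step_def using first_reading_not_halted by blast

text \<open>A run need not start in a reading state, for example directly after initialisation. The
  silent steps before the first letter are split off; the rest regroups into macro steps, since
  letters are read only in reading states.\<close>

lemma run_to_reading: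
  "run M c w d \<Longrightarrow> state_of d \<in> reading M \<Longrightarrow> \<exists>e. first_reading M c e \<and> macro_steps M e w d"
proof (induction rule: run.induct)
  case (refl c)
  then show ?case by (auto intro: macro_steps.refl first_reading.here)
next
  case (silent c c' w c'')
  then show ?case using step_reading_iff by (blast intro: first_reading.later)
next
  case (letter c a c' w c'')
  then obtain e where e: "first_reading M c' e" "macro_steps M e w c''" by blast
  have "macro_step M c a e" using e(1) letter.hyps(1) unfolding macro_step_def by blast
  then have "macro_steps M c (a # w) c''" using e(2) by (rule macro_steps.cons)
  moreover have "first_reading M c c"
    using step_reading_iff[OF letter.hyps(1)] by (simp add: first_reading.here)
  ultimately show ?case by blast
qed

lemma run_first_reading: "run M c [] d \<Longrightarrow> first_reading M d e \<Longrightarrow> first_reading M c e"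
proof (induction c "[] :: 'a list" d rule: run.induct)
  case (silent c c' d)
  then show ?case using step_reading_iff[of c None c'] first_reading.later by simp
qed

lemma deadI: "step M c (Some a) c' \<Longrightarrow> run M c' [] d \<Longrightarrow> halted M d \<Longrightarrow> dead M c a"
  unfolding dead_def using step_unique by blast

lemma run_reading_iff:
  assumes "state_of c \<in> reading M" "state_of d \<in> reading M"
  shows "run M c w d \<longleftrightarrow> macro_steps M c w d"
  using run_to_reading[of c w d] assms first_reading_of_reading macro_steps_run by blast

text \<open>Complements \<open>run_to_reading\<close>: a run that stops between reading states has
  left its last reading configuration by one letter. For a stuck configuration this recovers the
  letter on which the automaton is \<open>dead\<close>.\<close>

lemma run_to_nonreading:
  "run M c w d \<Longrightarrow> state_of d \<notin> reading M \<Longrightarrow>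
     w = [] \<and> state_of c \<notin> reading M \<or>
     (\<exists>e u a c0 c'. w = u @ [a] \<and> first_reading M c e \<and> macro_steps M e u c0 \<and>
        step M c0 (Some a) c' \<and> run M c' [] d)"
proof (induction rule: run.induct)
  case (silent c c' w c'')
  have nr: "state_of c \<notin> reading M" using step_reading_iff silent.hyps(1) by blast
  show ?case using silent.IH[OF silent.prems]
  proof (elim disjE exE conjE)
    fix e u a c0 c1
    assume *: "w = u @ [a]" "first_reading M c' e" "macro_steps M e u c0"
      "step M c0 (Some a) c1" "run M c1 [] c''"
    have "first_reading M c e" using nr silent.hyps(1) *(2) by (rule first_reading.later)
    then show ?thesis using * by blast
  qed (use nr in blast)
next
  case (letter c a c' w c'')
  have rc: "state_of c \<in> reading M" using step_reading_iff letter.hyps(1) by blast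
  show ?case using letter.IH[OF letter.prems]
  proof (elim disjE exE conjE)
    assume "w = []" "state_of c' \<notin> reading M"
    then show ?thesis using rc letter.hyps
      by (intro disjI2 exI[of _ c] exI[of _ "[]"] exI[of _ a] exI[of _ c] exI[of _ c'])
         (auto intro: first_reading.here macro_steps.refl)
  next
    fix e u b c0 c1
    assume *: "w = u @ [b]" "first_reading M c' e" "macro_steps M e u c0"
      "step M c0 (Some b) c1" "run M c1 [] c''"
    have "macro_step M c a e"
      using *(2) letter.hyps(1) unfolding macro_step_def by blast
    then have "macro_steps M c (a # u) c0" using *(3) by (rule macro_steps.cons)
    then show ?thesis using rc *
      by (intro disjI2 exI[of _ c] exI[of _ "a # u"] exI[of _ b] exI[of _ c0] exI[of _ c1])
         (auto intro: first_reading.here)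
  qed
qed simp

text \<open>The run over \<open>butlast w\<close> may a priori stop anywhere, but the next step
  reads a letter, so by (P1) it stops in a reading state.\<close>

lemma config_after_iff:
  assumes "state_of C \<in> reading M"
  shows "config_after M C w D \<longleftrightarrow> macro_steps M C w D"
proof (cases w rule: rev_cases)
  case Nil
  then show ?thesis by (auto simp: config_after_def macro_steps_Nil)
next
  case (snoc u a)
  have "config_after M C w D \<longleftrightarrow> (\<exists>c. run M C u c \<and> macro_step M c a D)"
    by (auto simp: snoc config_after_def macro_step_def)
  also have "\<dots> \<longleftrightarrow> (\<exists>c. macro_steps M C u c \<and> macro_step M c a D)"
  proof -
    have "macro_step M c a D \<Longrightarrow> state_of c \<in> reading M" for c
      unfolding macro_step_def using step_reading_iff by blast
    then show ?thesis using run_reading_iff assms by blast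
  qed
  finally show ?thesis by (simp add: snoc macro_steps_snoc)
qed

lemma config_after_fails_if_failing:
  "macro_steps M C u c \<Longrightarrow> failing M c \<Longrightarrow> config_after_fails M C (u @ v)"
  unfolding config_after_fails_def using macro_steps_run by blast

lemma config_after_fails_if_dead:
  assumes "state_of C \<in> reading M" "macro_steps M C u c" "dead M c a"
  shows "config_after_fails M C (u @ a # v)"
proof (cases "\<exists>c'. step M c (Some a) c'")
  case True
  then obtain c' d where d: "step M c (Some a) c'" "run M c' [] d" "halted M d"
    using assms unfolding dead_def by blast
  then have "run M C (u @ [a]) d"
    using run_append[OF macro_steps_run[OF assms(2)] run.letter] by simp
  moreover have "stuck M d v"
    using d(3) step_reading_iff by (fastforce simp: stuck_def halted_def)
  ultimately show ?thesis using d(3) unfolding config_after_fails_def halted_def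
    by (intro exI[of _ "u @ [a]"] exI[of _ v] exI[of _ d]) auto
next
  case False
  have "state_of c \<in> reading M" using macro_steps_reading assms by blast
  then have "stuck M c (a # v)" using False step_reading_iff by (fastforce simp: stuck_def)
  then show ?thesis unfolding config_after_fails_def using macro_steps_run[OF assms(2)] by blast
qed

text \<open>Failure is defined through arbitrary configurations on the way. A stuck configuration
  between two reading states is charged to the last reading configuration before it and to the
  letter read there.\<close>

lemma config_after_failsE:
  assumes "config_after_fails M C w" "state_of C \<in> reading M"
  obtains (failing) u v c where "w = u @ v" "macro_steps M C u c" "failing M c"
  | (dead) u a v c where "w = u @ a # v" "macro_steps M C u c" "dead M c a"
proof -
  obtain u v c where w: "w = u @ v" and r: "run M C u c"
    and *: "failing M c \<or> stuck M c v \<and> \<not> (v = [] \<and> state_of c \<in> reading M)"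
    using assms(1) unfolding config_after_fails_def by blast
  show ?thesis
  proof (cases "state_of c \<in> reading M")
    case True
    then have ms: "macro_steps M C u c" using r run_reading_iff assms(2) by blast
    show ?thesis
    proof (cases "failing M c")
      case True
      then show ?thesis using failing w ms by blast
    next
      case False
      with * True obtain a v' where v: "v = a # v'" and st: "stuck M c v" by (cases v) auto
      then have "dead M c a" by (auto simp: stuck_def dead_def)
      then show ?thesis using dead w ms v by blast
    qed
  next
    case False
    then have st: "stuck M c v" using * by (auto simp: failing_def)
    then have h: "halted M c" using False by (auto simp: stuck_def halted_def)
    from run_to_nonreading[OF r False] assms(2)
    obtain e u' a c0 c' where e: "u = u' @ [a]" "first_reading M C e" "macro_steps M e u' c0"
      "step M c0 (Some a) c'" "run M c' [] c" by blast
    have "e = C" using first_reading_of_reading e(2) assms(2) by blast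
    moreover have "dead M c0 a" unfolding dead_def using e(4,5) h step_unique by blast
    ultimately show ?thesis using dead[of u' a v c0] e(1,3) w by simp
  qed
qed

lemma no_silent_sequence_to_reading:
  "first_reading M (f 0) d \<Longrightarrow> \<forall>i::nat. step M (f i) None (f (Suc i)) \<Longrightarrow> False"
proof (induction "f 0" d arbitrary: f rule: first_reading.induct)
  case here
  then show ?case using step_reading_iff[of "f 0" None "f (Suc 0)"] by simp
next
  case (later c' c'')
  have "f (Suc 0) = c'"
    using step_unique[of "f 0" None "f (Suc 0)" None c'] later.hyps(2) later.prems by simp
  then show ?case using later.hyps(4)[of "\<lambda>i. f (Suc i)"] later.prems by simp
qed

lemma no_silent_sequence_to_halted:
  "run M (f 0) [] d \<Longrightarrow> halted M d \<Longrightarrow> \<forall>i::nat. step M (f i) None (f (Suc i)) \<Longrightarrow> False"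
proof (induction "f 0" "[] :: 'a list" d arbitrary: f rule: run.induct)
  case refl
  then show ?case by (auto simp: halted_def)
next
  case (silent c' c'')
  have "f (Suc 0) = c'"
    using step_unique[of "f 0" None "f (Suc 0)" None c'] silent.hyps(1) silent.prems by simp
  then show ?case using silent.hyps(3)[of "\<lambda>i. f (Suc i)"] silent.prems by simp
qed

text \<open>Reduces (P4) to a condition on single letters. The invariant \<open>good\<close> says
  that the silent path from a configuration ends, in \<open>S\<close> or in a halted configuration;
  every step preserves it, and by determinism such a path has no infinite continuation.\<close>

lemma no_infinite_silent_runI:
  assumes closed: "\<And>c a. c \<in> S \<Longrightarrow> state_of c \<in> reading M \<Longrightarrow> (\<exists>d\<in>S. macro_step M c a d) \<or> dead M c a"
    and init: "\<And>q ds. initialises M q ds \<Longrightarrow>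
        (\<exists>d\<in>S. first_reading M (q, ds, []) d) \<or> (\<exists>d. run M (q, ds, []) [] d \<and> halted M d)"
  shows "no_infinite_silent_run M"
proof -
  define good where "good c \<longleftrightarrow> (\<exists>d\<in>S. first_reading M c d) \<or> (\<exists>d. run M c [] d \<and> halted M d)" for c
  have silent: "good c'" if g: "good c" and s: "step M c None c'" for c c'
  proof -
    have nr: "state_of c \<notin> reading M" using s step_reading_iff by blast
    have same: "c1 = c'" if "step M c None c1" for c1 using step_unique that s by blast
    from g[unfolded good_def] show ?thesis
    proof
      assume "\<exists>d\<in>S. first_reading M c d"
      then obtain d where d: "d \<in> S" "first_reading M c d" by blast
      from d(2) have "first_reading M c' d"
        by (cases rule: first_reading.cases) (use nr same in auto)
      then show ?thesis using d(1) unfolding good_def by blast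
    next
      assume "\<exists>d. run M c [] d \<and> halted M d"
      then obtain d where d: "run M c [] d" "halted M d" by blast
      from d(1) have "run M c' [] d"
        by (cases rule: run.cases) (use d(2) s same in \<open>auto simp: halted_def\<close>)
      then show ?thesis using d(2) unfolding good_def by blast
    qed
  qed
  have letter: "good c'" if g: "good c" and s: "step M c (Some a) c'" for c a c'
  proof -
    have r: "state_of c \<in> reading M" using s step_reading_iff by blast
    have same: "c1 = c'" if "step M c (Some a) c1" for c1 using step_unique that s by blast
    from g[unfolded good_def] show ?thesis
    proof
      assume "\<exists>d\<in>S. first_reading M c d"
      then have "c \<in> S" using first_reading_of_reading[OF _ r] by metis
      from closed[OF this r, of a] show ?thesis
      proof
        assume "\<exists>d\<in>S. macro_step M c a d"
        then show ?thesis unfolding macro_step_def good_def using same by metis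
      next
        assume "dead M c a"
        then show ?thesis unfolding dead_def good_def using s by blast
      qed
    next
      assume "\<exists>d. run M c [] d \<and> halted M d"
      then obtain d where d: "run M c [] d" "halted M d" by blast
      have "d = c" using d(1) by (cases rule: run.cases) (use r step_reading_iff in auto)
      then show ?thesis using d r by (simp add: halted_def)
    qed
  qed
  have run: "run M c w d \<Longrightarrow> good c \<Longrightarrow> good d" for c w d
  proof (induction rule: run.induct)
    case (silent c c' w c'')
    then show ?case using \<open>\<And>c c'. good c \<Longrightarrow> step M c None c' \<Longrightarrow> good c'\<close> by metis
  next
    case (letter c a c' w c'')
    then show ?case using \<open>\<And>c c' a. good c \<Longrightarrow> step M c (Some a) c' \<Longrightarrow> good c'\<close> by metis
  qed
  show ?thesis
    unfolding no_infinite_silent_run_def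
  proof (intro notI, elim exE conjE)
    fix w and f :: "nat \<Rightarrow> _"
    assume r: "second_stage_reachable M w (f 0)" and inf: "\<forall>i. step M (f i) None (f (Suc i))"
    then obtain q ds where "initialises M q ds" "run M (q, ds, []) w (f 0)"
      by (auto simp: second_stage_reachable_def)
    then have "good (f 0)" using init run unfolding good_def by metis
    then show False unfolding good_def
      using no_silent_sequence_to_reading[OF _ inf] no_silent_sequence_to_halted[OF _ _ inf] by metis
  qed
qed

text \<open>This is how (P4) is used for \<open>N\<close>: a silent path that meets neither a
  reading nor a halted configuration would be infinite.\<close>

lemma macro_step_or_dead:
  assumes "no_infinite_silent_run M" "second_stage_reachable M w c"
  shows "(\<exists>d. macro_step M c a d) \<or> dead M c a"
proof (rule ccontr)
  assume neg: "\<not> ?thesis"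
  then obtain c0 where c0: "step M c (Some a) c0" and nh: "\<nexists>d. run M c0 [] d \<and> halted M d"
    unfolding dead_def by blast
  have nf: "\<nexists>d. first_reading M c0 d" using neg c0 unfolding macro_step_def by blast
  define P where "P d \<longleftrightarrow> run M c0 [] d \<and> (\<nexists>e. first_reading M d e)" for d
  \<comment> \<open>A configuration satisfying \<open>P\<close> is non-reading and has a silent
    successor satisfying \<open>P\<close>, so dependent choice builds an infinite silent run that
    starts at \<open>c0\<close>.\<close>
  have "\<exists>f. \<forall>i::nat. (P (f i) \<and> (i = 0 \<longrightarrow> f i = c0)) \<and> step M (f i) None (f (Suc i))"
  proof (rule dependent_nat_choice[where P = "\<lambda>i x. P x \<and> (i = 0 \<longrightarrow> x = c0)"
        and Q = "\<lambda>i x y. step M x None y"])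
    show "\<exists>x. P x \<and> ((0::nat) = 0 \<longrightarrow> x = c0)"
      using nf by (auto simp: P_def intro: run.refl)
  next
    fix x and n :: nat
    assume "P x \<and> (n = 0 \<longrightarrow> x = c0)"
    then have x: "run M c0 [] x" "\<nexists>e. first_reading M x e" by (auto simp: P_def)
    then have nr: "state_of x \<notin> reading M" using first_reading.here by metis
    then obtain y where y: "step M x None y" using x(1) nh unfolding halted_def by blast
    have "run M c0 [] y" using x(1) y by (meson run.silent run.refl run_silent_trans)
    moreover have "\<nexists>e. first_reading M y e" using x(2) nr y first_reading.later by blast
    ultimately show "\<exists>y. (P y \<and> (Suc n = 0 \<longrightarrow> y = c0)) \<and> step M x None y"
      using y by (auto simp: P_def)
  qed
  then obtain f where f: "f (0::nat) = c0" "\<And>i. step M (f i) None (f (Suc i))" by blast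
  have "second_stage_reachable M (w @ [a]) c0"
    using assms(2) c0 unfolding second_stage_reachable_def
    by (meson run.letter run.refl run_append)
  then show False using assms(1) f unfolding no_infinite_silent_run_def by metis
qed

end

section \<open>Normal forms in virtually free groups\<close>

definition letter_inv :: "'k \<times> bool \<Rightarrow> 'k \<times> bool" where
  "letter_inv y = (fst y, \<not> snd y)"

lemma letter_inv_letter_inv [simp]: "letter_inv (letter_inv y) = y"
  by (simp add: letter_inv_def)

lemma letter_inv_neq [simp]: "y \<noteq> letter_inv y"
  by (simp add: letter_inv_def prod_eq_iff)

lemma letter_inv_mem_iff [simp]: "letter_inv y \<in> X \<times> UNIV \<longleftrightarrow> y \<in> X \<times> UNIV"
  by (simp add: letter_inv_def mem_Times_iff)

lemma reduced_iff: "reduced w \<longleftrightarrow> successively (\<lambda>y z. z \<noteq> letter_inv y) w"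
  unfolding reduced_def by (rule successively_cong) (auto simp: letter_inv_def)

lemma reduced_Nil [simp]: "reduced []"
  by (simp add: reduced_iff)

lemma reduced_Cons: "reduced (y # r) \<longleftrightarrow> reduced r \<and> (r = [] \<or> hd r \<noteq> letter_inv y)"
  by (auto simp: reduced_iff successively_Cons)

lemma reduced_rev [simp]: "reduced (rev w) \<longleftrightarrow> reduced w"
  unfolding reduced_iff successively_rev by (rule successively_cong) auto

lemma reduced_snoc: "reduced (w @ [y]) \<longleftrightarrow> reduced w \<and> (w = [] \<or> y \<noteq> letter_inv (last w))"
  by (auto simp: reduced_iff successively_append_iff)

text \<open>Reduced words are kept as stacks, with the last letter first.\<close>

definition add_letter :: "'k \<times> bool \<Rightarrow> ('k \<times> bool) list \<Rightarrow> ('k \<times> bool) list" where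
  "add_letter y r = (if r \<noteq> [] \<and> hd r = letter_inv y then tl r else y # r)"

lemma reduced_add_letter: "reduced r \<Longrightarrow> reduced (add_letter y r)"
  by (cases r) (auto simp: add_letter_def reduced_Cons)

lemma set_add_letter: "set (add_letter y r) \<subseteq> insert y (set r)"
  by (cases r) (auto simp: add_letter_def)

lemma length_add_letter: "length (add_letter y r) \<le> Suc (length r)"
  by (cases r) (auto simp: add_letter_def)

text \<open>Reducedness matters when \<open>r\<close> begins with \<open>y\<close>: the letter
  exposed by the cancellation is then not \<open>letter_inv y\<close>, so \<open>y\<close> is pushed
  back.\<close>

lemma add_letter_inv: "reduced r \<Longrightarrow> add_letter y (add_letter (letter_inv y) r) = r"
  by (cases r) (auto simp: add_letter_def reduced_Cons)

lemma reduced_fold: "reduced r \<Longrightarrow> reduced (fold add_letter ys r)"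
  by (induction ys arbitrary: r) (auto simp: reduced_add_letter)

lemma set_fold: "set r \<subseteq> A \<Longrightarrow> set ys \<subseteq> A \<Longrightarrow> set (fold add_letter ys r) \<subseteq> A"
proof (induction ys arbitrary: r)
  case (Cons y ys)
  have "set (add_letter y r) \<subseteq> A" using set_add_letter[of y r] Cons.prems by auto
  then show ?case using Cons by simp
qed simp

lemma fold_rev_reduced: "reduced r \<Longrightarrow> fold add_letter (rev r) [] = r"
  by (induction r) (auto simp: add_letter_def reduced_Cons)

text \<open>The inner fold appends the inverse of the word stored in \<open>r'\<close>, which starts
  with the inverse of its topmost letter; the outer fold appends the word itself in reading
  order.\<close>

lemma fold_rev_cancel:
  "reduced r \<Longrightarrow> fold add_letter (rev r') (fold add_letter (map letter_inv r') r) = r"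
  by (induction r' arbitrary: r) (auto simp: add_letter_inv reduced_add_letter)

context group
begin

definition letter_value :: "'a \<times> bool \<Rightarrow> 'a" where
  "letter_value y = (if snd y then fst y else inv (fst y))"

text \<open>The head is the last letter of the word and therefore the right factor; the value of a
  word \<open>w\<close> in reading order is \<open>stack_value (rev w)\<close>.\<close>

fun stack_value :: "('a \<times> bool) list \<Rightarrow> 'a" where
  "stack_value [] = \<one>"
| "stack_value (y # r) = stack_value r \<otimes> letter_value y"

lemma letter_value_closed: "y \<in> carrier G \<times> UNIV \<Longrightarrow> letter_value y \<in> carrier G"
  by (auto simp: letter_value_def)

lemma letter_value_inv: "y \<in> carrier G \<times> UNIV \<Longrightarrow> letter_value (letter_inv y) = inv (letter_value y)"
  by (auto simp: letter_value_def letter_inv_def)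

lemma stack_value_closed [simp]: "set r \<subseteq> carrier G \<times> UNIV \<Longrightarrow> stack_value r \<in> carrier G"
  by (induction r) (auto simp: letter_value_closed simp del: mem_Sigma_iff)

lemma stack_value_append:
  "set r \<subseteq> carrier G \<times> UNIV \<Longrightarrow> set r' \<subseteq> carrier G \<times> UNIV \<Longrightarrow>
     stack_value (r' @ r) = stack_value r \<otimes> stack_value r'"
  by (induction r') (auto simp: letter_value_closed m_assoc simp del: mem_Sigma_iff)

lemma stack_value_add_letter:
  assumes "set r \<subseteq> carrier G \<times> UNIV" "y \<in> carrier G \<times> UNIV"
  shows "stack_value (add_letter y r) = stack_value r \<otimes> letter_value y"
proof (cases "r \<noteq> [] \<and> hd r = letter_inv y")
  case True
  then obtain r' where r: "r = letter_inv y # r'" by (cases r) auto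
  then have "stack_value r \<otimes> letter_value y = stack_value r' \<otimes> (inv (letter_value y) \<otimes> letter_value y)"
    using assms by (simp add: letter_value_inv letter_value_closed m_assoc)
  then show ?thesis
    using assms r by (simp add: add_letter_def letter_value_closed l_inv)
qed (auto simp: add_letter_def)

lemma stack_value_fold:
  "set r \<subseteq> carrier G \<times> UNIV \<Longrightarrow> set ys \<subseteq> carrier G \<times> UNIV \<Longrightarrow>
     stack_value (fold add_letter ys r) = stack_value r \<otimes> stack_value (rev ys)"
proof (induction ys arbitrary: r)
  case (Cons y ys)
  then have "set (add_letter y r) \<subseteq> carrier G \<times> UNIV"
    using set_add_letter[of y r] by auto
  then show ?case
    using Cons by (simp add: stack_value_add_letter stack_value_append letter_value_closed m_assoc)
qed simp

lemma stack_value_map_inv: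
  "set r \<subseteq> carrier G \<times> UNIV \<Longrightarrow> stack_value (rev (map letter_inv r)) = inv (stack_value r)"
proof (induction r)
  case (Cons y r)
  have "set (map letter_inv r) \<subseteq> carrier G \<times> UNIV"
    using Cons.prems by (auto simp: letter_inv_def)
  then show ?case
    using Cons by (simp add: stack_value_append letter_value_closed letter_value_inv inv_mult_group)
qed simp

lemma signed_word_value_eq:
  "set w \<subseteq> carrier G \<times> UNIV \<Longrightarrow> signed_word_value G w = stack_value (rev w)"
  by (induction w)
     (auto simp: signed_word_value_def word_value_def stack_value_append letter_value_def split: prod.split)

end

text \<open>What the automaton has to know about \<open>K\<close>. The free subgroup is present only
  through words over \<open>X\<close>; \<open>T\<close> represents its right cosets. Right
  multiplication by a generator \<open>s\<close> appends \<open>out t s\<close> to the free word and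
  replaces \<open>t\<close> by \<open>next_rep t s\<close>. The reversal in \<open>rewrite\<close>
  arises because \<open>out t s\<close> lists letters in the order in which they are pushed.\<close>

locale virtually_free = group K for K :: "('k, 'n) monoid_scheme" (structure) +
  fixes X T S :: "'k set" and out :: "'k \<Rightarrow> 'k \<Rightarrow> ('k \<times> bool) list" and next_rep :: "'k \<Rightarrow> 'k \<Rightarrow> 'k"
  assumes finite_X: "finite X" and X_closed: "X \<subseteq> carrier K"
    and free: "set r \<subseteq> X \<times> UNIV \<Longrightarrow> r \<noteq> [] \<Longrightarrow> reduced r \<Longrightarrow> stack_value r \<noteq> \<one>"
    and finite_T: "finite T" and T_closed: "T \<subseteq> carrier K" and one_T: "\<one> \<in> T"
    and transversal: "set r \<subseteq> X \<times> UNIV \<Longrightarrow> set r' \<subseteq> X \<times> UNIV \<Longrightarrow> t \<in> T \<Longrightarrow> t' \<in> T \<Longrightarrow>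
          stack_value r \<otimes> t = stack_value r' \<otimes> t' \<Longrightarrow> t = t'"
    and finite_S: "finite S" and S_closed: "S \<subseteq> carrier K"
    and S_inv: "s \<in> S \<Longrightarrow> inv s \<in> S" and S_generates: "generate K S = carrier K"
    and out: "t \<in> T \<Longrightarrow> s \<in> S \<Longrightarrow> set (out t s) \<subseteq> X \<times> UNIV"
    and next_rep: "t \<in> T \<Longrightarrow> s \<in> S \<Longrightarrow> next_rep t s \<in> T"
    and rewrite: "t \<in> T \<Longrightarrow> s \<in> S \<Longrightarrow> t \<otimes> s = stack_value (rev (out t s)) \<otimes> next_rep t s"
begin

definition red :: "('k \<times> bool) list \<Rightarrow> bool" where
  "red r \<longleftrightarrow> reduced r \<and> set r \<subseteq> X \<times> UNIV"

lemma red_Nil [simp]: "red []"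
  by (simp add: red_def)

lemma red_closed: "set r \<subseteq> X \<times> UNIV \<Longrightarrow> set r \<subseteq> carrier K \<times> UNIV"
  using X_closed by auto

lemma stack_value_red [simp]: "red r \<Longrightarrow> stack_value r \<in> carrier K"
  by (simp add: red_def red_closed)

lemma red_fold: "red r \<Longrightarrow> set ys \<subseteq> X \<times> UNIV \<Longrightarrow> red (fold add_letter ys r)"
  by (simp add: red_def reduced_fold set_fold)

lemma T_mem_closed [simp]: "t \<in> T \<Longrightarrow> t \<in> carrier K"
  using T_closed by auto

lemma S_mem_closed [simp]: "s \<in> S \<Longrightarrow> s \<in> carrier K"
  using S_closed by auto

lemma map_inv_closed: "set r \<subseteq> X \<times> UNIV \<Longrightarrow> set (map letter_inv r) \<subseteq> X \<times> UNIV"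
  by (auto simp: letter_inv_def)

text \<open>The reduced stack \<open>d\<close> represents the quotient of the two values, so
  freeness makes it empty. Multiplying back by the word of \<open>r'\<close> then gives
  \<open>r\<close> on the one hand and \<open>r'\<close> on the other.\<close>

lemma stack_value_inj:
  assumes "red r" "red r'" "stack_value r = stack_value r'"
  shows "r = r'"
proof -
  define d where "d = fold add_letter (map letter_inv r') r"
  have cl: "set r \<subseteq> carrier K \<times> UNIV" "set r' \<subseteq> carrier K \<times> UNIV"
    "set (map letter_inv r') \<subseteq> carrier K \<times> UNIV"
    using assms red_closed map_inv_closed unfolding red_def by blast+
  have "stack_value d = \<one>"
    using cl assms(3) by (simp add: d_def stack_value_fold stack_value_map_inv del: set_map)
  moreover have "red d"
    unfolding d_def using red_fold[OF assms(1) map_inv_closed[of r']] assms(2) unfolding red_def by blast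
  ultimately have "d = []" using free unfolding red_def by blast
  then have "fold add_letter (rev r') [] = r"
    using fold_rev_cancel[of r r'] assms(1) by (simp add: d_def red_def)
  then show ?thesis using fold_rev_reduced[of r'] assms(2) by (simp add: red_def)
qed

lemma normal_form_unique:
  assumes "red r" "red r'" "t \<in> T" "t' \<in> T" "stack_value r \<otimes> t = stack_value r' \<otimes> t'"
  shows "r = r' \<and> t = t'"
proof -
  have "t = t'" using transversal[of r r' t t'] assms by (simp add: red_def)
  moreover from this have "stack_value r = stack_value r'" using assms by simp
  ultimately show ?thesis using stack_value_inj assms by blast
qed

lemma normal_form_step:
  assumes "red r" "t \<in> T" "s \<in> S"
  shows "stack_value r \<otimes> t \<otimes> s = stack_value (fold add_letter (out t s) r) \<otimes> next_rep t s"
proof -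
  have cl: "set r \<subseteq> carrier K \<times> UNIV" "set (out t s) \<subseteq> carrier K \<times> UNIV"
    using assms out red_closed unfolding red_def by blast+
  then show ?thesis
    using assms rewrite[of t s] next_rep[of t s] by (simp add: stack_value_fold m_assoc)
qed

lemma normal_form_exists:
  assumes "p \<in> carrier K"
  shows "\<exists>r t. red r \<and> t \<in> T \<and> p = stack_value r \<otimes> t"
proof -
  have step: "\<exists>r t. red r \<and> t \<in> T \<and> p \<otimes> s = stack_value r \<otimes> t"
    if "\<exists>r t. red r \<and> t \<in> T \<and> p = stack_value r \<otimes> t" "s \<in> S" for p s
  proof -
    from that(1) obtain r t where r: "red r" "t \<in> T" "p = stack_value r \<otimes> t" by blast
    show ?thesis
      using normal_form_step[OF r(1,2) that(2)] red_fold[OF r(1) out[OF r(2) that(2)]]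
        next_rep[OF r(2) that(2)] r(3) by blast
  qed
  \<comment> \<open>The rules describe right multiplication, so the induction shows that every right
    factor \<open>q\<close> preserves the existence of a normal form; in this form the case of a
    product is a composition.\<close>
  have "\<forall>p. (\<exists>r t. red r \<and> t \<in> T \<and> p = stack_value r \<otimes> t) \<longrightarrow>
      (\<exists>r t. red r \<and> t \<in> T \<and> p \<otimes> q = stack_value r \<otimes> t)" if "q \<in> generate K S" for q
    using that
  proof (induction rule: generate.induct)
    case one
    have "p \<otimes> \<one> = p" if "red r" "t \<in> T" "p = stack_value r \<otimes> t" for p r t using that by simp
    then show ?case by metis
  next
    case (incl h)
    then show ?case using step by blast
  next
    case (inv h)
    then show ?case using step S_inv by blast
  next
    case (eng h1 h2)
    have h: "h1 \<in> carrier K" "h2 \<in> carrier K" using eng.hyps S_generates by auto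
    show ?case
    proof (intro allI impI)
      fix p assume p: "\<exists>r t. red r \<and> t \<in> T \<and> p = stack_value r \<otimes> t"
      then have "p \<in> carrier K" by auto
      then have "p \<otimes> (h1 \<otimes> h2) = p \<otimes> h1 \<otimes> h2" using h by (simp add: m_assoc)
      then show "\<exists>r t. red r \<and> t \<in> T \<and> p \<otimes> (h1 \<otimes> h2) = stack_value r \<otimes> t"
        using eng.IH p by simp
    qed
  qed
  moreover have "\<exists>r t. red r \<and> t \<in> T \<and> \<one> = stack_value r \<otimes> t"
    using one_T by (intro exI[of _ "[]"] exI[of _ \<one>]) auto
  ultimately have "\<exists>r t. red r \<and> t \<in> T \<and> \<one> \<otimes> p = stack_value r \<otimes> t"
    using assms S_generates by blast
  then show ?thesis using assms by simp
qed

definition word_of :: "'k \<Rightarrow> ('k \<times> bool) list" where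
  "word_of p = (SOME r. red r \<and> (\<exists>t \<in> T. p = stack_value r \<otimes> t))"

definition rep_of :: "'k \<Rightarrow> 'k" where
  "rep_of p = (SOME t. t \<in> T \<and> p = stack_value (word_of p) \<otimes> t)"

lemma normal_form:
  assumes "p \<in> carrier K"
  shows red_word_of: "red (word_of p)" and rep_of_T: "rep_of p \<in> T"
    and normal_form_eq: "p = stack_value (word_of p) \<otimes> rep_of p"
proof -
  have *: "red (word_of p) \<and> (\<exists>t \<in> T. p = stack_value (word_of p) \<otimes> t)"
    unfolding word_of_def by (rule someI_ex) (use normal_form_exists[OF assms] in blast)
  then have "rep_of p \<in> T \<and> p = stack_value (word_of p) \<otimes> rep_of p"
    unfolding rep_of_def by (intro someI_ex[of "\<lambda>t. t \<in> T \<and> p = stack_value (word_of p) \<otimes> t"]) blast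
  with * show "red (word_of p)" "rep_of p \<in> T" "p = stack_value (word_of p) \<otimes> rep_of p"
    by blast+
qed

lemma normal_form_eqI:
  assumes "red r" "t \<in> T"
  shows "word_of (stack_value r \<otimes> t) = r" "rep_of (stack_value r \<otimes> t) = t"
proof -
  have p: "stack_value r \<otimes> t \<in> carrier K" using assms by simp
  show "word_of (stack_value r \<otimes> t) = r" "rep_of (stack_value r \<otimes> t) = t"
    using normal_form_unique[OF _ assms(1) _ assms(2)] normal_form[OF p] by metis+
qed

lemma normal_form_inj:
  "p \<in> carrier K \<Longrightarrow> q \<in> carrier K \<Longrightarrow> word_of p = word_of q \<Longrightarrow> rep_of p = rep_of q \<Longrightarrow> p = q"
  using normal_form_eq by metis

lemma word_of_T: "t \<in> T \<Longrightarrow> word_of t = []" and rep_of_T_eq: "t \<in> T \<Longrightarrow> rep_of t = t"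
  using normal_form_eqI[of "[]" t] by simp_all

lemma normal_form_mult:
  assumes "p \<in> carrier K" "s \<in> S"
  shows "word_of (p \<otimes> s) = fold add_letter (out (rep_of p) s) (word_of p)"
    and "rep_of (p \<otimes> s) = next_rep (rep_of p) s"
proof -
  let ?r = "word_of p" and ?t = "rep_of p"
  have "p \<otimes> s = stack_value (fold add_letter (out ?t s) ?r) \<otimes> next_rep ?t s"
    using normal_form_step[OF red_word_of rep_of_T assms(2)] normal_form_eq assms(1) by metis
  then show "word_of (p \<otimes> s) = fold add_letter (out ?t s) ?r" "rep_of (p \<otimes> s) = next_rep ?t s"
    using normal_form_eqI red_fold[OF red_word_of out] next_rep rep_of_T assms by metis+
qed

text \<open>Left multiplication by an element of the free part changes the free word only. Hence an
  excursion from the target can be stored as the word of the relative position while the state keeps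
  the representative of the absolute one.\<close>

lemma relative_normal_form:
  assumes "red r0" "p \<in> carrier K"
  shows "rep_of (inv (stack_value r0) \<otimes> p) = rep_of p"
    and "word_of (inv (stack_value r0) \<otimes> p) = [] \<longleftrightarrow> word_of p = r0"
proof -
  let ?r = "word_of p" and ?t = "rep_of p" and ?v = "stack_value r0"
  \<comment> \<open>The reduced form of the inverse of \<open>r0\<close> followed by the word of
    \<open>p\<close>.\<close>
  define d where "d = fold add_letter (rev ?r) (fold add_letter (map letter_inv r0) [])"
  have cl: "set r0 \<subseteq> X \<times> UNIV" "set (map letter_inv r0) \<subseteq> X \<times> UNIV" "set (rev ?r) \<subseteq> X \<times> UNIV"
    using assms red_word_of map_inv_closed unfolding red_def by auto
  have red: "red (fold add_letter (map letter_inv r0) [])" "red d"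
    unfolding d_def using red_fold cl red_Nil by metis+
  have "stack_value d = inv ?v \<otimes> stack_value ?r"
    using red(1) cl[THEN red_closed]
    by (simp add: d_def stack_value_fold stack_value_map_inv red_def red_closed del: set_map set_rev)
  moreover have "inv ?v \<otimes> p = inv ?v \<otimes> stack_value ?r \<otimes> ?t"
    using normal_form_eq[OF assms(2)] normal_form(1,2)[OF assms(2)] assms
    by (metis T_mem_closed inv_closed m_assoc stack_value_red)
  ultimately have eq: "inv ?v \<otimes> p = stack_value d \<otimes> ?t" by simp
  show "rep_of (inv ?v \<otimes> p) = ?t"
    unfolding eq using normal_form_eqI red(2) rep_of_T assms by blast
  have d: "word_of (inv ?v \<otimes> p) = d"
    unfolding eq using normal_form_eqI red(2) rep_of_T assms by blast
  have "d = [] \<longleftrightarrow> stack_value ?r = ?v"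
    using \<open>stack_value d = _\<close> stack_value_inj[OF red(2) red_Nil] assms red_word_of
    by (metis inv_closed inv_equality inv_inv l_inv stack_value.simps(1) stack_value_red)
  then show "word_of (inv ?v \<otimes> p) = [] \<longleftrightarrow> ?r = r0"
    using d stack_value_inj[OF red_word_of assms(1)] assms(2) by auto
qed

end

section \<open>The automaton for the wreath product\<close>

text \<open>
  On the pushdown stack, \<open>On y\<close> and \<open>Off y\<close> are letters of the current position that do and do not
  belong to an initial segment of the word of the target \<open>k\<close>. On the check stack, \<open>Next n\<close> announces
  the letter of that word at the next height; as the bottom symbol cannot do so, the first letter
  \<open>n0\<close> is part of a target \<open>(s0, t0, n0)\<close>, next to the entry state \<open>s0\<close> of \<open>N\<close> and the coset
  representative \<open>t0\<close> of \<open>k\<close>. The target \<open>None\<close> stands for the guess that the top component is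
  nontrivial.
\<close>

datatype ('h, 'k) wsym =
  SBot | SPad | STop | On "'k \<times> bool" | Off "'k \<times> bool" | Next "('k \<times> bool) option" | Inner "'h stack_symbol"

type_synonym 'k target = "nat \<times> 'k \<times> ('k \<times> bool) option"

text \<open>The number is a state of \<open>N\<close>, kept in the control while excursions cover
  the stack of \<open>N\<close>. \<open>Guess\<close> remembers the letter announced last, so that
  the guessed word stays reduced. The list in \<open>Writing\<close> holds the letters still to be
  processed, as one transition moves by at most one symbol. The Boolean in \<open>Reading\<close>
  serves the guess about the top component: it records that the pushdown stack is down to its
  bottom, because acceptance depends on the state alone.\<close>

datatype ('h, 'k) wstate =
  Start
| Guess "'k target" "'k \<times> bool"
| Inner_init "'k target" nat
| Pad "'k target option"
| Ready "'k target option" nat 'k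
| Reading "'k target option" nat 'k bool
| Writing "'k target option" nat 'k "('k \<times> bool) list"
| Feed "'k target" nat 'h
| Inner_run "'k target" nat

definition first_letter :: "'k target option \<Rightarrow> ('k \<times> bool) option" where
  "first_letter m = (case m of None \<Rightarrow> None | Some (s0, t0, n0) \<Rightarrow> n0)"

text \<open>Above an \<open>Off\<close> letter the check stack is not consulted: once the position
  has left the word of the target, agreement at a single height means nothing.\<close>

definition on_path :: "'k target option \<Rightarrow> ('h, 'k) wsym \<Rightarrow> ('h, 'k) wsym \<Rightarrow> 'k \<times> bool \<Rightarrow> bool" where
  "on_path m g d y \<longleftrightarrow> g = SBot \<and> first_letter m = Some y \<or> g \<in> range On \<and> d = Next (Some y)"

definition letter_move ::
  "'k target option \<Rightarrow> ('h, 'k) wsym \<Rightarrow> ('h, 'k) wsym \<Rightarrow> 'k \<times> bool \<Rightarrow> ('h, 'k) wsym stack_move" where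
  "letter_move m g d y =
     (if g = On (letter_inv y) \<or> g = Off (letter_inv y) then Pop
      else if on_path m g d y then Push (On y) else Push (Off y))"

text \<open>The three alternatives: the word of the target is empty and nothing lies on the bottom
  symbol; the whole word has been matched; the stack of \<open>N\<close> is open with no excursion
  above it. Representatives are not on the stack and are compared separately.\<close>

definition at_target :: "'k target \<Rightarrow> 'k \<Rightarrow> ('h, 'k) wsym \<Rightarrow> ('h, 'k) wsym \<Rightarrow> bool" where
  "at_target \<kappa> t g d \<longleftrightarrow> t = fst (snd \<kappa>) \<and>
     (g = SBot \<and> d = SBot \<and> snd (snd \<kappa>) = None \<or> g \<in> range On \<and> d = Next None \<or> g \<in> range Inner)"

text \<open>During a simulation, a bare pushdown bottom means that \<open>N\<close> is in its entry
  configuration, whose state is \<open>s0\<close>. Entries in any other state violate this and are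
  caught here at the first letter.\<close>

definition live :: "'k target option \<Rightarrow> nat \<Rightarrow> ('h, 'k) wsym \<Rightarrow> bool" where
  "live m q g \<longleftrightarrow> (case m of None \<Rightarrow> True | Some (s0, t0, n0) \<Rightarrow> g = SBot \<longrightarrow> q = s0)"

locale wreath_automaton = virtually_free K X T S out next_rep + group_H: group H
  for K :: "('k, 'n) monoid_scheme" (structure) and X T S out next_rep
    and H :: "('h, 'm) monoid_scheme" +
  fixes A :: "'h set" and N :: "(nat, 'h, 'h stack_symbol) cspda"
    and B :: "'a set" and decode :: "'a \<Rightarrow> 'h + 'k"
  assumes A_closed: "A \<subseteq> carrier H" and special_N: "special_cspda N"
    and input_N: "input_alphabet N = A" and language_N: "language N = coWP H A"
    and finite_B: "finite B" and decode: "a \<in> B \<Longrightarrow> decode a \<in> A <+> S"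
begin

text \<open>Condition (P7) for \<open>N\<close> makes \<open>reading N - accepting N\<close> the set
  of its entry states.\<close>

abbreviation "targets \<equiv> (reading N - accepting N) \<times> T \<times> insert None (Some ` (X \<times> (UNIV :: bool set)))"

abbreviation ok_mode :: "'k target option \<Rightarrow> bool" where
  "ok_mode m \<equiv> set_option m \<subseteq> targets"

definition max_out :: nat where
  "max_out = Max (insert 0 ((\<lambda>(t, s). length (out t s)) ` (T \<times> S)))"

text \<open>Cuts the states down to a finite set; the number \<open>0\<close> is a dummy when there
  is no target. With a target, \<open>Ready\<close> admits every entry state of \<open>N\<close> and
  every representative, as (P7) will demand. Without one it admits only the identity, since every
  reading state other than the one for the identity and an empty stack accepts.\<close>

fun ok_state :: "('h, 'k) wstate \<Rightarrow> bool" where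
  "ok_state Start = True"
| "ok_state (Guess \<kappa> y) = (\<kappa> \<in> targets \<and> y \<in> X \<times> UNIV)"
| "ok_state (Inner_init \<kappa> q) = (\<kappa> \<in> targets \<and> q \<in> states N)"
| "ok_state (Pad m) = ok_mode m"
| "ok_state (Ready m q t) =
     (ok_mode m \<and> t \<in> T \<and> (if m = None then q = 0 \<and> t = \<one> else q \<in> reading N - accepting N))"
| "ok_state (Reading m q t b) =
     (ok_mode m \<and> t \<in> T \<and> (if m = None then q = 0 else q \<in> reading N \<and> \<not> b))"
| "ok_state (Writing m q t ys) =
     (ok_mode m \<and> t \<in> T \<and> (if m = None then q = 0 else q \<in> reading N) \<and>
      set ys \<subseteq> X \<times> UNIV \<and> length ys \<le> max_out)"
| "ok_state (Feed \<kappa> q h) = (\<kappa> \<in> targets \<and> q \<in> reading N \<and> h \<in> A)"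
| "ok_state (Inner_run \<kappa> q) = (\<kappa> \<in> targets \<and> q \<in> states N)"

fun ok_sym :: "('h, 'k) wsym \<Rightarrow> bool" where
  "ok_sym (On y) = (y \<in> X \<times> UNIV)"
| "ok_sym (Off y) = (y \<in> X \<times> UNIV)"
| "ok_sym (Next n) = (set_option n \<subseteq> X \<times> UNIV)"
| "ok_sym (Inner s) = (s \<in> check_alphabet N \<union> pushdown_alphabet N)"
| "ok_sym _ = True"

definition path_state :: "'k target \<Rightarrow> ('k \<times> bool) option \<Rightarrow> ('h, 'k) wstate" where
  "path_state \<kappa> n = (case n of None \<Rightarrow> Inner_init \<kappa> (initial N) | Some y \<Rightarrow> Guess \<kappa> y)"

text \<open>The side condition of the third rule keeps the guessed word reduced. In the fifth rule
  the first second-stage transition of \<open>N\<close> is checked instead of simulated: padding may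
  begin only where that transition leads to the guessed entry state. The last rule leaves
  \<open>q\<close> and \<open>t\<close> open; \<open>ok_state\<close> restricts them in the
  definition of \<open>M\<close>.\<close>

inductive init_tr :: "('h, 'k) wstate \<Rightarrow> ('h, 'k) wsym \<Rightarrow> ('h, 'k) wstate \<Rightarrow> bool" where
  "init_tr Start SBot (Pad None)"
| "init_tr Start SBot (path_state (s0, t0, n0) n0)"
| "n \<noteq> Some (letter_inv y) \<Longrightarrow> init_tr (Guess \<kappa> y) (Next n) (path_state \<kappa> n)"
| "(q, s, q') \<in> init_transitions N \<Longrightarrow> init_tr (Inner_init \<kappa> q) (Inner s) (Inner_init \<kappa> q')"
| "(q, Top, q') \<in> init_transitions N \<Longrightarrow> (q', None, None, Push Bottom, fst \<kappa>) \<in> transitions N \<Longrightarrow>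
     init_tr (Inner_init \<kappa> q) (Inner Top) (Pad (Some \<kappa>))"
| "init_tr (Pad m) SPad (Pad m)"
| "init_tr (Pad m) STop (Ready m q t)"

text \<open>A letter of \<open>H\<close> is stored in \<open>Feed\<close> first, because the bottom
  of the stack of \<open>N\<close> may have to be pushed before \<open>N\<close> can see it; the
  reading transitions of \<open>N\<close> thereby become silent. In \<open>inner_done\<close> the
  representative is taken from the target, as \<open>N\<close> is fed only there. At
  \<open>STop\<close> only a pop is possible, so an overflow leaves \<open>Writing\<close> without a
  transition.\<close>

inductive tr :: "('h, 'k) wstate \<Rightarrow> 'a option \<Rightarrow> (('h, 'k) wsym \<times> ('h, 'k) wsym) option \<Rightarrow>
    ('h, 'k) wsym stack_move \<Rightarrow> ('h, 'k) wstate \<Rightarrow> bool" where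
  enter: "tr (Ready m q t) None None (Push SBot) (Reading m q t (m = None))"
| top_letter: "decode a = Inr s \<Longrightarrow> live m q g \<Longrightarrow>
    tr (Reading m q t b) (Some a) (Some (g, d)) Keep (Writing m q (next_rep t s) (out t s))"
| skip: "decode a = Inl h \<Longrightarrow> live m q g \<Longrightarrow> (\<And>\<kappa>. m = Some \<kappa> \<Longrightarrow> \<not> at_target \<kappa> t g d) \<Longrightarrow>
    tr (Reading m q t b) (Some a) (Some (g, d)) Keep (Reading m q t b)"
| open_inner: "decode a = Inl h \<Longrightarrow> live (Some \<kappa>) q g \<Longrightarrow> at_target \<kappa> t g d \<Longrightarrow> g \<notin> range Inner \<Longrightarrow>
    tr (Reading (Some \<kappa>) q t b) (Some a) (Some (g, d)) (Push (Inner Bottom)) (Feed \<kappa> q h)"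
| feed: "decode a = Inl h \<Longrightarrow> live (Some \<kappa>) q (Inner g) \<Longrightarrow> at_target \<kappa> t (Inner g) d \<Longrightarrow>
    tr (Reading (Some \<kappa>) q t b) (Some a) (Some (Inner g, d)) Keep (Feed \<kappa> q h)"
| inner_letter: "(q, Some h, Some (g, d), mv, q') \<in> transitions N \<Longrightarrow>
    tr (Feed \<kappa> q h) None (Some (Inner g, Inner d)) (map_stack_move Inner mv) (Inner_run \<kappa> q')"
| inner_silent: "(q, None, Some (g, d), mv, q') \<in> transitions N \<Longrightarrow>
    tr (Inner_run \<kappa> q) None (Some (Inner g, Inner d)) (map_stack_move Inner mv) (Inner_run \<kappa> q')"
| inner_done: "q \<in> reading N \<Longrightarrow>
    tr (Inner_run \<kappa> q) None (Some (Inner g, d)) (if q = fst \<kappa> \<and> g = Bottom then Pop else Keep)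
      (Reading (Some \<kappa>) q (fst (snd \<kappa>)) False)"
| write_pop: "d = STop \<Longrightarrow> letter_move m g d y = Pop \<Longrightarrow>
    tr (Writing m q t (y # ys)) None (Some (g, d)) (letter_move m g d y) (Writing m q t ys)"
| write_any: "d \<noteq> STop \<Longrightarrow>
    tr (Writing m q t (y # ys)) None (Some (g, d)) (letter_move m g d y) (Writing m q t ys)"
| written: "tr (Writing m q t []) None (Some (g, d)) Keep (Reading m q t (m = None \<and> g = SBot))"

inductive_simps tr_Start: "tr Start x v m q'"
inductive_simps tr_Guess: "tr (Guess \<kappa> y) x v m q'"
inductive_simps tr_Inner_init: "tr (Inner_init \<kappa> q) x v m q'"
inductive_simps tr_Pad: "tr (Pad mo) x v m q'"
inductive_simps tr_Ready: "tr (Ready mo q t) x v m q'"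
inductive_simps tr_Reading: "tr (Reading mo q t b) x v m q'"
inductive_simps tr_Writing_Nil: "tr (Writing mo q t []) x v m q'"
inductive_simps tr_Writing_Cons: "tr (Writing mo q t (y # ys)) x v m q'"
inductive_simps tr_Feed: "tr (Feed \<kappa> q h) x v m q'"
inductive_simps tr_Inner_run: "tr (Inner_run \<kappa> q) x v m q'"

lemmas tr_simps = tr_Start tr_Guess tr_Inner_init tr_Pad tr_Ready tr_Reading tr_Writing_Nil
  tr_Writing_Cons tr_Feed tr_Inner_run

definition M :: "(('h, 'k) wstate, 'a, ('h, 'k) wsym) cspda" where
  "M = \<lparr>states = Collect ok_state, initial = Start,
     accepting = {Reading m q t b | m q t b. ok_state (Reading m q t b) \<and>
       (if m = None then \<not> (t = \<one> \<and> b) else q \<in> accepting N)},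
     reading = {Reading m q t b | m q t b. ok_state (Reading m q t b)},
     input_alphabet = B, check_alphabet = Collect ok_sym, pushdown_alphabet = Collect ok_sym,
     init_transitions = {(q, s, q'). init_tr q s q' \<and> ok_state q \<and> ok_sym s \<and> ok_state q'},
     transitions = {(q, x, v, m, q'). tr q x v m q' \<and> ok_state q \<and> ok_state q' \<and> set_option x \<subseteq> B \<and>
       set_option v \<subseteq> Collect ok_sym \<times> Collect ok_sym \<and> set_stack_move m \<subseteq> Collect ok_sym}\<rparr>"

lemma M_sel [simp]:
  "states M = Collect ok_state" "initial M = Start" "input_alphabet M = B"
  "check_alphabet M = Collect ok_sym" "pushdown_alphabet M = Collect ok_sym"
  by (simp_all add: M_def)

lemma M_init_iff: "(q, s, q') \<in> init_transitions M \<longleftrightarrow> init_tr q s q' \<and> ok_state q \<and> ok_sym s \<and> ok_state q'"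
  by (simp add: M_def)

lemma M_transition_iff: "(q, x, v, m, q') \<in> transitions M \<longleftrightarrow> tr q x v m q' \<and> ok_state q \<and> ok_state q' \<and>
    set_option x \<subseteq> B \<and> set_option v \<subseteq> Collect ok_sym \<times> Collect ok_sym \<and> set_stack_move m \<subseteq> Collect ok_sym"
  by (simp add: M_def)

lemma reading_M_iff [simp]:
  "Reading m q t b \<in> reading M \<longleftrightarrow> ok_state (Reading m q t b)"
  "Start \<notin> reading M" "Guess \<kappa> y \<notin> reading M" "Inner_init \<kappa> q \<notin> reading M" "Pad m \<notin> reading M"
  "Ready m q t \<notin> reading M" "Writing m q t ys \<notin> reading M" "Feed \<kappa> q h \<notin> reading M"
  "Inner_run \<kappa> q \<notin> reading M"
  by (auto simp: M_def)

lemma accepting_M_iff: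
  "Reading m q t b \<in> accepting M \<longleftrightarrow>
     ok_state (Reading m q t b) \<and> (if m = None then \<not> (t = \<one> \<and> b) else q \<in> accepting N)"
  by (simp add: M_def)

lemma accepting_reading_M: "accepting M \<subseteq> reading M"
  by (auto simp: M_def)

lemma cspda_N: "cspda N" and dichotomy_N: "reading_dichotomy N" and deterministic_N: "deterministic N"
  and discipline_N: "stack_discipline N" and no_infinite_N: "no_infinite_silent_run N"
  and accepting_reading_N: "accepting N \<subseteq> reading N" and stable_N: "stable_under_rejected N"
  and accepting_N: "accepting N = reading N - entry_states N"
  using special_N unfolding special_cspda_def by blast+

sublocale N: det_cspda N
  by unfold_locales (rule dichotomy_N deterministic_N)+

lemma N_transition:
  assumes "(q, x, v, m, q') \<in> transitions N"
  shows "q \<in> states N" "q' \<in> states N" "set_option x \<subseteq> A"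
    "set_option v \<subseteq> pushdown_alphabet N \<times> check_alphabet N" "set_stack_move m \<subseteq> pushdown_alphabet N"
    "q \<in> reading N \<longleftrightarrow> x \<noteq> None"
proof -
  have "\<forall>(q, x, v, m, q') \<in> transitions N. q \<in> states N \<and> q' \<in> states N \<and> set_option x \<subseteq> A \<and>
      set_option v \<subseteq> pushdown_alphabet N \<times> check_alphabet N \<and> set_stack_move m \<subseteq> pushdown_alphabet N"
    using cspda_N input_N unfolding cspda_def by blast
  from bspec[OF this assms] show "q \<in> states N" "q' \<in> states N" "set_option x \<subseteq> A"
    "set_option v \<subseteq> pushdown_alphabet N \<times> check_alphabet N" "set_stack_move m \<subseteq> pushdown_alphabet N"
    by auto
  have "\<forall>(q, x, v, m, q') \<in> transitions N. q \<in> reading N \<longleftrightarrow> x \<noteq> None"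
    using dichotomy_N unfolding reading_dichotomy_def by blast
  from bspec[OF this assms] show "q \<in> reading N \<longleftrightarrow> x \<noteq> None" by simp
qed

lemma N_init:
  assumes "(q, s, q') \<in> init_transitions N"
  shows "q \<in> states N" "q' \<in> states N" "s \<in> check_alphabet N"
  using assms cspda_N unfolding cspda_def by blast+

lemma reading_states_N: "reading N \<subseteq> states N" "initial N \<in> states N"
  using cspda_N unfolding cspda_def by auto

lemma N_alphabets:
  "Bottom \<in> check_alphabet N" "Top \<in> check_alphabet N" "Bottom \<in> pushdown_alphabet N"
  using discipline_N unfolding stack_discipline_def by auto

lemma N_move:
  assumes "(q, x, Some (g, d), m, q') \<in> transitions N"
  shows "m \<noteq> Push Bottom" "g = Bottom \<Longrightarrow> m \<noteq> Pop"
  using assms discipline_N unfolding stack_discipline_def by blast+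

lemma reading_dichotomy_M: "reading_dichotomy M"
proof -
  have "q \<notin> reading M" if "init_tr q s q'" for q s q'
    using that by (cases rule: init_tr.cases) auto
  moreover have "q \<in> reading M \<longleftrightarrow> x \<noteq> None" if "tr q x v m q'" "ok_state q" for q x v m q'
    using that by (cases rule: tr.cases) auto
  ultimately show ?thesis unfolding reading_dichotomy_def by (auto simp: M_init_iff M_transition_iff)
qed

text \<open>Competing rules exclude each other through \<open>at_target\<close>, the kind of the top
  symbol, or the check symbol. The one exception is the pair \<open>inner_silent\<close> and
  \<open>inner_done\<close>, which (P1) for \<open>N\<close> separates; two instances of a rule that
  copies a transition agree because \<open>N\<close> is deterministic.\<close>

lemma deterministic_M: "deterministic M"
proof -
  have N: "x = x' \<and> m = m' \<and> p = p'"
    if "(q, x, v, m, p) \<in> transitions N" "(q, x', v, m', p') \<in> transitions N"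
      "x = x' \<or> x = None \<or> x' = None" for q x v m p x' m' p'
    using deterministic_N that unfolding deterministic_def by blast
  have N2: "(q, None, v, m, p) \<notin> transitions N" if "q \<in> reading N" for q v m p
    using N_transition(6) that by blast
  have "x = x' \<and> m = m' \<and> p = p'"
    if "tr q x v m p" "tr q x' v m' p'" "x = x' \<or> x = None \<or> x' = None" for q x v m p x' m' p'
    using that(1)
  proof (cases rule: tr.cases)
    case (inner_letter q h g d mv q' \<kappa>)
    from that(2) obtain mv' q'' where *: "x' = None" "m' = map_stack_move Inner mv'" "p' = Inner_run \<kappa> q''"
      "(q, Some h, Some (g, d), mv', q'') \<in> transitions N"
      unfolding inner_letter tr_Feed by auto
    show ?thesis using N[OF inner_letter(6) *(4)] * inner_letter by simp
  next
    case (inner_silent q g d mv q' \<kappa>)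
    have "q \<notin> reading N" using N2 inner_silent(6) by blast
    with that(2) obtain mv' q'' where *: "x' = None" "m' = map_stack_move Inner mv'" "p' = Inner_run \<kappa> q''"
      "(q, None, Some (g, d), mv', q'') \<in> transitions N"
      unfolding inner_silent tr_Inner_run by auto
    show ?thesis using N[OF inner_silent(6) *(4)] * inner_silent by simp
  next
    case (inner_done q \<kappa> g d)
    then show ?thesis using that(2) N2 unfolding inner_done tr_Inner_run by auto
  qed (use that(2,3) N2 in \<open>auto simp: tr_simps\<close>)
  then show ?thesis unfolding deterministic_def M_transition_iff by blast
qed

sublocale M: det_cspda M
  by unfold_locales (rule reading_dichotomy_M deterministic_M)+

lemma finite_targets: "finite targets"
proof -
  have "finite (reading N)" using cspda_N unfolding cspda_def by (meson finite_subset)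
  then show ?thesis using finite_T finite_X
    by (intro finite_cartesian_product finite.insertI finite_imageI finite_Diff) auto
qed

lemma finite_ok_state: "finite (Collect ok_state)"
proof -
  let ?modes = "insert None (Some ` targets)"
  let ?ns = "insert 0 (states N)"
  let ?words = "{ys. set ys \<subseteq> X \<times> (UNIV :: bool set) \<and> length ys \<le> max_out}"
  have fin: "finite targets" "finite ?modes" "finite (states N)" "finite ?words" "finite A"
    "finite (X \<times> (UNIV :: bool set))"
    using finite_targets cspda_N input_N finite_X
  proof -
    show "finite targets" by (rule finite_targets)
    then show "finite ?modes" by blast
    show "finite (states N)" "finite A" using cspda_N input_N by (auto simp: cspda_def)
    show ls: "finite (X \<times> (UNIV :: bool set))" using finite_X finite_UNIV by (rule finite_cartesian_product)
    then show "finite ?words" by (rule finite_lists_length_le)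
  qed
  have "q \<in> insert Start (case_prod Guess ` (targets \<times> (X \<times> UNIV)) \<union> case_prod Inner_init ` (targets \<times> ?ns) \<union>
      Pad ` ?modes \<union> (\<lambda>(m, q, t). Ready m q t) ` (?modes \<times> ?ns \<times> T) \<union>
      (\<lambda>(m, q, t, b). Reading m q t b) ` (?modes \<times> ?ns \<times> T \<times> UNIV) \<union>
      (\<lambda>(m, q, t, ys). Writing m q t ys) ` (?modes \<times> ?ns \<times> T \<times> ?words) \<union>
      (\<lambda>(\<kappa>, q, h). Feed \<kappa> q h) ` (targets \<times> ?ns \<times> A) \<union> case_prod Inner_run ` (targets \<times> ?ns))"
    (is "q \<in> ?Q") if "ok_state q" for q
  proof -
    have "q \<in> states N" if "q \<in> reading N" for q using that reading_states_N by blast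
    moreover have "m \<in> ?modes" if "ok_mode m" for m using that by (cases m) auto
    ultimately show ?thesis using that
      by (cases q) (auto simp: image_iff Bex_def split_paired_Ex split_paired_All simp del: mem_Times_iff mem_Sigma_iff split: if_splits)
  qed
  then have "Collect ok_state \<subseteq> ?Q" by blast
  moreover have "finite ?Q"
    by (simp only: finite_insert finite_Un finite_imageI finite_cartesian_product fin finite_T finite_X finite_code simp_thms)
  ultimately show ?thesis by (rule finite_subset)
qed

lemma finite_ok_sym: "finite (Collect ok_sym)"
proof -
  let ?ls = "X \<times> (UNIV :: bool set)"
  have fin: "finite ?ls" "finite (check_alphabet N \<union> pushdown_alphabet N)"
    using finite_cartesian_product[OF finite_X finite_UNIV] cspda_N unfolding cspda_def by blast+
  have "s \<in> {SBot, SPad, STop} \<union> On ` ?ls \<union> Off ` ?ls \<union> Next ` insert None (Some ` ?ls) \<union>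
      Inner ` (check_alphabet N \<union> pushdown_alphabet N)" if "ok_sym s" for s
    using that
  proof (cases s)
    case (Next n)
    then show ?thesis using that by (cases n) auto
  qed (use that in auto)
  then show ?thesis 
    by (rule finite_subset[OF subsetI], unfold mem_Collect_eq)
       (assumption, intro finite.insertI finite_UnI finite_imageI fin finite.emptyI)
qed

lemma cspda_M: "cspda M"
  unfolding cspda_def using finite_ok_state finite_ok_sym finite_B
  by (auto simp: M_init_iff M_transition_iff) (auto simp: M_def)

end

lemma step_check_stack: "step M c x c' \<Longrightarrow> fst (snd c') = fst (snd c)"
  by (auto elim: step.cases)

section \<open>Check stacks produced by the initialisation, and the entry configurations\<close>

context wreath_automaton
begin

definition path :: "('k \<times> bool) list \<Rightarrow> ('h, 'k) wsym list" where
  "path w = (if w = [] then [] else map (\<lambda>y. Next (Some y)) (tl w) @ [Next None])"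

definition first :: "('k \<times> bool) list \<Rightarrow> ('k \<times> bool) option" where
  "first w = (if w = [] then None else Some (hd w))"

lemma length_path [simp]: "length (path w) = length w"
  by (cases w) (auto simp: path_def)

lemma path_nth:
  "i < length w \<Longrightarrow> path w ! i = Next (if Suc i < length w then Some (w ! Suc i) else None)"
  by (cases w) (auto simp: path_def nth_append)

definition check_prefix :: "'k target option \<Rightarrow> ('h, 'k) wsym list \<Rightarrow> bool" where
  "check_prefix m ds = (case m of None \<Rightarrow> ds = [SBot] | Some (s0, t0, n0) \<Rightarrow>
     (\<exists>w ds'. reduced w \<and> set w \<subseteq> X \<times> UNIV \<and> n0 = first w \<and> entry_config N (s0, ds', [Bottom]) \<and>
        ds = SBot # path w @ map Inner ds'))"

lemma initialises_alphabet: "initialises N q ds \<Longrightarrow> q \<in> states N \<and> set ds \<subseteq> check_alphabet N"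
  by (induction rule: initialises.induct) (auto dest: N_init simp: reading_states_N)

text \<open>In state \<open>Guess\<close> the letter \<open>y\<close> has been announced, but the
  check symbol at its own height is still to be pushed. Hence \<open>ds\<close> contains the
  announcements up to \<open>y\<close> and nothing beside \<open>y\<close>.\<close>

fun init_inv :: "('h, 'k) wstate \<Rightarrow> ('h, 'k) wsym list \<Rightarrow> bool" where
  "init_inv Start ds = (ds = [])"
| "init_inv (Guess (s0, t0, n0) y) ds = (\<exists>w. reduced (w @ [y]) \<and> set w \<subseteq> X \<times> UNIV \<and>
     n0 = Some (hd (w @ [y])) \<and> ds = SBot # map (\<lambda>y. Next (Some y)) (tl (w @ [y])))"
| "init_inv (Inner_init (s0, t0, n0) q) ds = (\<exists>w ds'. reduced w \<and> set w \<subseteq> X \<times> UNIV \<and> n0 = first w \<and>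
     initialises N q ds' \<and> ds = SBot # path w @ map Inner ds')"
| "init_inv (Pad m) ds = (\<exists>ds0 n. check_prefix m ds0 \<and> ds = ds0 @ replicate n SPad)"
| "init_inv (Ready m q t) ds = (\<exists>ds0 n. check_prefix m ds0 \<and> ds = ds0 @ replicate n SPad @ [STop])"
| "init_inv _ ds = False"

lemma init_inv_path_state:
  assumes "reduced w" "set w \<subseteq> X \<times> UNIV" "n0 = first (w @ (case n of None \<Rightarrow> [] | Some y \<Rightarrow> [y]))"
    "w = [] \<longrightarrow> ds = [SBot]" "w \<noteq> [] \<longrightarrow> ds = SBot # map (\<lambda>y. Next (Some y)) (tl w) @ [Next n]"
    "n \<noteq> None \<longrightarrow> reduced (w @ [the n])"
  shows "init_inv (path_state (s0, t0, n0) n) ds"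
proof (cases n)
  case None
  have "\<exists>w ds'. reduced w \<and> set w \<subseteq> X \<times> UNIV \<and> n0 = first w \<and>
      initialises N (initial N) ds' \<and> ds = SBot # path w @ map Inner ds'"
    using assms initialises.start[of N] None
    by (intro exI[of _ w] exI[of _ "[]"]) (auto simp: path_def)
  then show ?thesis using None by (simp add: path_state_def)
next
  case (Some y)
  then show ?thesis using assms
    by (cases w) (auto simp: path_state_def first_def intro!: exI[of _ w])
qed

lemma init_inv_push:
  assumes "init_inv q ds" "init_tr q s q'" "ok_state q" "ok_state q'"
  shows "init_inv q' (ds @ [s])"
  using assms(2)
proof (cases rule: init_tr.cases)
  case 1
  then show ?thesis using assms by (auto simp: check_prefix_def intro!: exI[of _ "[SBot]"] exI[of _ "0::nat"])
next
  case (2 s0 t0 n0)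
  then show ?thesis using assms
    by (auto intro!: init_inv_path_state[of "[]"] simp: first_def reduced_Cons split: option.splits)
next
  case (3 n y \<kappa>)
  obtain s0 t0 n0 where k: "\<kappa> = (s0, t0, n0)" by (cases \<kappa>) auto
  with assms 3 obtain w where w: "reduced (w @ [y])" "set w \<subseteq> X \<times> UNIV"
    "n0 = Some (hd (w @ [y]))" "ds = SBot # map (\<lambda>y. Next (Some y)) (tl (w @ [y]))" by auto
  have "reduced ((w @ [y]) @ [the n])" if "n \<noteq> None"
    unfolding reduced_snoc[of "w @ [y]"] using that 3(4) w(1) by (auto simp del: append_assoc)
  then show ?thesis unfolding 3 k using w assms(3) 3
    by (intro init_inv_path_state[of "w @ [y]"]) (auto simp: first_def hd_append)
next
  case (4 q1 s1 q1' \<kappa>)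
  obtain s0 t0 n0 where k: "\<kappa> = (s0, t0, n0)" by (cases \<kappa>) auto
  with assms 4 obtain w ds' where w: "reduced w" "set w \<subseteq> X \<times> UNIV" "n0 = first w"
    "initialises N q1 ds'" "ds = SBot # path w @ map Inner ds'" by auto
  show ?thesis unfolding 4 k using w initialises.push[OF w(4) 4(4)]
    by (auto intro!: exI[of _ w] exI[of _ "ds' @ [s1]"])
next
  case (5 q1 q1' \<kappa>)
  obtain s0 t0 n0 where k: "\<kappa> = (s0, t0, n0)" by (cases \<kappa>) auto
  with assms 5 obtain w ds' where w: "reduced w" "set w \<subseteq> X \<times> UNIV" "n0 = first w"
    "initialises N q1 ds'" "ds = SBot # path w @ map Inner ds'" by auto
  have "initialises N q1' (ds' @ [Top])" using initialises.push[OF w(4) 5(4)] .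
  moreover have "step N (q1', ds' @ [Top], []) None (s0, ds' @ [Top], [Bottom])"
    using 5(5) k by (intro step.push) auto
  ultimately have "entry_config N (s0, ds' @ [Top], [Bottom])" unfolding entry_config_def by blast
  then show ?thesis unfolding 5 k using w
    by (auto simp: check_prefix_def intro!: exI[of _ "ds @ [Inner Top]"] exI[of _ "0::nat"]
        exI[of _ w] exI[of _ "ds' @ [Top]"])
next
  case (6 m)
  then obtain ds0 n where "check_prefix m ds0" "ds = ds0 @ replicate n SPad" using assms by auto
  then show ?thesis unfolding 6
    by (auto intro!: exI[of _ ds0] exI[of _ "Suc n"] simp: replicate_append_same)
next
  case (7 m q1 t)
  then show ?thesis using assms by auto
qed

lemma initialises_M_inv: "initialises M q ds \<Longrightarrow> ok_state q \<and> init_inv q ds \<and> set ds \<subseteq> Collect ok_sym"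
  by (induction rule: initialises.induct) (auto simp: M_init_iff init_inv_push)

text \<open>Condition (P7) and the acceptance of nontrivial words call for particular check stacks.
  The computation retraces the guesses: the letters of the word, the initialisation of
  \<open>N\<close>, and the padding.\<close>

lemma initialises_Ready:
  assumes "check_prefix m ds0" "ok_state (Ready m q t)"
  shows "initialises M (Ready m q t) (ds0 @ replicate n SPad @ [STop])"
proof -
  have m: "ok_mode m" using assms(2) by simp
  have "initialises M (Pad m) ds0"
  proof (cases m)
    case None
    have "initialises M (Pad None) ([] @ [SBot])"
      by (rule initialises.push[where q = Start])
         (auto simp: M_init_iff intro: init_tr.intros initialises.start[of M, simplified])
    then show ?thesis using None assms(1) by (simp add: check_prefix_def)
  next
    case (Some \<kappa>)
    obtain s0 t0 n0 where k: "\<kappa> = (s0, t0, n0)" by (cases \<kappa>) auto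
    then obtain w ds' where w: "reduced w" "set w \<subseteq> X \<times> UNIV" "n0 = first w"
      "entry_config N (s0, ds', [Bottom])" "ds0 = SBot # path w @ map Inner ds'"
      using assms(1) Some by (auto simp: check_prefix_def)
    from w(4) obtain q1 d x where "initialises N q1 d" "step N (q1, d, []) x (s0, ds', [Bottom])"
      unfolding entry_config_def by blast
    then have q1: "initialises N q1 ds'" "step N (q1, ds', []) x (s0, ds', [Bottom])"
      using step_check_stack by fastforce+
    have x: "x = None" "ds' \<noteq> []" "last ds' = Top"
      using q1 discipline_N unfolding stack_discipline_def by blast+
    \<comment> \<open>The entry transition of \<open>N\<close>, which the rule leading to
      \<open>Pad\<close> checks in advance.\<close>
    have tr: "(q1, None, None, Push Bottom, s0) \<in> transitions N"
      using q1(2) x by (auto elim: step.cases)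
    have k_ok: "\<kappa> \<in> targets" using m Some by simp
    have "ok_state (path_state \<kappa> n0)"
      using k_ok k reading_states_N by (cases n0) (auto simp: path_state_def)
    then have "initialises M (path_state \<kappa> n0) ([] @ [SBot])"
      using init_tr.intros(2)[of s0 t0 n0] k initialises.start[of M]
      by (intro initialises.push[where q = Start]) (auto simp: M_init_iff)
    then have first_step: "initialises M (path_state \<kappa> n0) [SBot]" by simp
    \<comment> \<open>When the letters of \<open>u\<close> and one more have been announced, the
      state holds this last letter, the head of \<open>v\<close>. The induction lengthens
      \<open>u\<close> at its right end.\<close>
    have path: "initialises M (path_state \<kappa> (first v)) (SBot # map (\<lambda>y. Next (Some y)) (tl (u @ take 1 v)))"
      if "w = u @ v" "v \<noteq> []" for u v
      using that
    proof (induction u arbitrary: v rule: rev_induct)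
      case Nil
      then obtain y where "n0 = Some y" "first v = Some y" using w(3) by (auto simp: first_def)
      then show ?case using first_step by (cases v) auto
    next
      case (snoc y u)
      then obtain z v' where v: "v = z # v'" by (cases v) auto
      have "initialises M (path_state \<kappa> (first (y # v))) (SBot # map (\<lambda>y. Next (Some y)) (tl (u @ take 1 (y # v))))"
        using snoc.prems by (intro snoc.IH) auto
      moreover have "reduced (y # z # v')"
        using w(1) snoc.prems v by (auto simp: reduced_iff successively_append_iff)
      then have "init_tr (Guess \<kappa> y) (Next (Some z)) (path_state \<kappa> (Some z))"
        by (intro init_tr.intros) (auto simp: reduced_Cons)
      ultimately have "initialises M (path_state \<kappa> (Some z))
          ((SBot # map (\<lambda>y. Next (Some y)) (tl (u @ [y]))) @ [Next (Some z)])"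
        using k_ok w(2) snoc.prems v
        by (intro initialises.push[where q = "Guess \<kappa> y"]) (auto simp: M_init_iff path_state_def first_def)
      then show ?case using v by (cases u) (auto simp: first_def)
    qed
    have start: "initialises M (Inner_init \<kappa> (initial N)) (SBot # path w)"
    proof (cases w rule: rev_cases)
      case Nil
      then show ?thesis using first_step w(3) by (simp add: path_state_def path_def first_def)
    next
      case (snoc u y)
      have "initialises M (Guess \<kappa> y) (SBot # map (\<lambda>y. Next (Some y)) (tl (u @ [y])))"
        using path[of u "[y]"] snoc by (simp add: first_def path_state_def)
      moreover have "init_tr (Guess \<kappa> y) (Next None) (Inner_init \<kappa> (initial N))"
        using init_tr.intros(3)[of None y \<kappa>] by (simp add: path_state_def)
      ultimately have "initialises M (Inner_init \<kappa> (initial N))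
          ((SBot # map (\<lambda>y. Next (Some y)) (tl (u @ [y]))) @ [Next None])"
        using k_ok w(2) snoc reading_states_N
        by (intro initialises.push[where q = "Guess \<kappa> y"]) (auto simp: M_init_iff)
      then show ?thesis using snoc by (simp add: path_def)
    qed
    have inner: "initialises M (Inner_init \<kappa> q2) (SBot # path w @ map Inner d)" if "initialises N q2 d" for q2 d
      using that
    proof (induction rule: initialises.induct)
      case start
      then show ?case using \<open>initialises M (Inner_init \<kappa> (initial N)) (SBot # path w)\<close> by simp
    next
      case (push q2 d s q3)
      have "initialises M (Inner_init \<kappa> q3) ((SBot # path w @ map Inner d) @ [Inner s])"
        using push k_ok N_init[OF push.hyps(2)]
        by (intro initialises.push[where q = "Inner_init \<kappa> q2"])
           (auto simp: M_init_iff intro: init_tr.intros)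
      then show ?case by simp
    qed
    \<comment> \<open>The final \<open>Top\<close> is split off, since the step that pushes it leads
      to \<open>Pad\<close> and takes the place of the last initialisation step of
      \<open>N\<close>.\<close>
    from q1(1) x(2,3) obtain d q2 where d: "ds' = d @ [Top]" "initialises N q2 d" "(q2, Top, q1) \<in> init_transitions N"
      by (cases rule: initialises.cases) auto
    have "initialises M (Pad (Some \<kappa>)) ((SBot # path w @ map Inner d) @ [Inner Top])"
      using inner[OF d(2)] d(3) tr k k_ok N_init[OF d(3)] N_alphabets
      by (intro initialises.push[where q = "Inner_init \<kappa> q2"])
         (auto simp: M_init_iff intro: init_tr.intros)
    then show ?thesis using w(5) d(1) Some by simp
  qed
  then have "initialises M (Pad m) (ds0 @ replicate n SPad)" for n
  proof (induction n)
    case (Suc n)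
    have "initialises M (Pad m) ((ds0 @ replicate n SPad) @ [SPad])"
      using Suc m by (intro initialises.push[where q = "Pad m"]) (auto simp: M_init_iff intro: init_tr.intros)
    then show ?case by (simp add: replicate_append_same)
  qed simp
  then have "initialises M (Ready m q t) ((ds0 @ replicate n SPad) @ [STop])"
    using m assms(2)
    by (intro initialises.push[where q = "Pad m"]) (auto simp: M_init_iff intro: init_tr.intros)
  then show ?thesis by simp
qed

lemma check_prefix_set:
  assumes "check_prefix m ds"
  shows "ds \<noteq> []" "hd ds = SBot" "SBot \<notin> set (tl ds)" "STop \<notin> set ds"
  using assms by (auto simp: check_prefix_def path_def split: option.splits if_splits)

lemma initialises_M_symbols:
  assumes "initialises M q ds"
  shows "SBot \<notin> set (tl ds) \<and> STop \<notin> set (butlast ds)"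
proof -
  have q: "ok_state q" "init_inv q ds" using initialises_M_inv[OF assms] by auto
  show ?thesis
  proof (cases q)
    case (Guess \<kappa> y)
    then show ?thesis using q by (cases \<kappa>) (auto dest: in_set_butlastD)
  next
    case (Inner_init \<kappa> q)
    then show ?thesis using q by (cases \<kappa>) (auto simp: path_def dest!: in_set_butlastD split: if_splits)
  next
    case (Pad m)
    then obtain ds0 n where "check_prefix m ds0" "ds = ds0 @ replicate n SPad" using q by auto
    then show ?thesis using check_prefix_set[of m ds0] by (auto dest!: in_set_butlastD)
  next
    case (Ready m q1 t)
    then obtain ds0 n where "check_prefix m ds0" "ds = ds0 @ replicate n SPad @ [STop]" using q by auto
    then show ?thesis using check_prefix_set[of m ds0] by (auto simp: butlast_append)
  qed (use q in auto)
qed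

lemma step_M_initial:
  assumes "initialises M q ds" "step M (q, ds, []) x c"
  obtains m q1 t ds0 n where "q = Ready m q1 t" "x = None" "c = (Reading m q1 t (m = None), ds, [SBot])"
    "check_prefix m ds0" "ds = ds0 @ replicate n SPad @ [STop]" "ok_state q"
    "set ds \<subseteq> Collect ok_sym"
proof -
  have q: "ok_state q" "init_inv q ds" "set ds \<subseteq> Collect ok_sym" using initialises_M_inv[OF assms(1)] by auto
  obtain m q' where tr: "tr q x None m q'" "(m = Keep \<and> c = (q', ds, [])) \<or> (\<exists>g. m = Push g \<and> c = (q', ds, [g]))"
    using assms(2) by (cases rule: step.cases) (auto simp: M_transition_iff)
  from tr(1) obtain mo q1 t where "q = Ready mo q1 t" "x = None" "m = Push SBot" "q' = Reading mo q1 t (mo = None)"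
    by (cases rule: tr.cases) auto
  then show ?thesis using that q tr(2) by auto
qed

lemma step_M_Ready:
  assumes "check_prefix m ds0" "ok_state (Ready m q t)" "ds = ds0 @ replicate n SPad @ [STop]"
  shows "step M (Ready m q t, ds, []) None (Reading m q t (m = None), ds, [SBot])"
  using assms(2,3) by (intro step.push) (auto simp: M_transition_iff tr.enter split: if_splits)

lemma entry_config_M_iff:
  "entry_config M c \<longleftrightarrow> (\<exists>m q t ds0 n. check_prefix m ds0 \<and> ok_state (Ready m q t) \<and>
     c = (Reading m q t (m = None), ds0 @ replicate n SPad @ [STop], [SBot]))"
proof
  assume "entry_config M c"
  then obtain q ds x where "initialises M q ds" "step M (q, ds, []) x c"
    by (auto simp: entry_config_def)
  then show "\<exists>m q t ds0 n. check_prefix m ds0 \<and> ok_state (Ready m q t) \<and>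
     c = (Reading m q t (m = None), ds0 @ replicate n SPad @ [STop], [SBot])"
    using step_M_initial[of q ds x c] by metis
next
  assume "\<exists>m q t ds0 n. check_prefix m ds0 \<and> ok_state (Ready m q t) \<and>
     c = (Reading m q t (m = None), ds0 @ replicate n SPad @ [STop], [SBot])"
  then show "entry_config M c"
    unfolding entry_config_def using initialises_Ready step_M_Ready by blast
qed

text \<open>A non-accepting reading state holds the identity with the flag for an empty stack, or an
  entry state of \<open>N\<close>; each of them needs an initialisation that reaches it. For a
  target, the entry state in it supplies a check stack of \<open>N\<close>, and any reduced word
  with the prescribed first letter serves, so words of length at most one are enough.\<close>

lemma entry_states_M: "accepting M = reading M - entry_states M"
proof -
  have prefix: "\<exists>ds0. check_prefix m ds0" if "ok_mode m" for m
  proof (cases m)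
    case None
    then show ?thesis by (simp add: check_prefix_def)
  next
    case (Some \<kappa>)
    obtain s0 t0 n0 where k: "\<kappa> = (s0, t0, n0)" by (cases \<kappa>) auto
    have "s0 \<in> entry_states N" using that Some k accepting_N by auto
    then obtain q ds x ps where q: "initialises N q ds" "step N (q, ds, []) x (s0, ps)"
      by (force simp: entry_states_def entry_config_def)
    then have "(s0, ps) = (s0, ds, [Bottom])"
      using discipline_N unfolding stack_discipline_def by (metis prod.inject)
    then have e: "entry_config N (s0, ds, [Bottom])" unfolding entry_config_def using q by metis
    show ?thesis
    proof (cases n0)
      case None
      then have "check_prefix m (SBot # path [] @ map Inner ds)"
        using e unfolding Some k check_prefix_def option.case prod.case
        by (intro exI[of _ "[]"] exI[of _ ds]) (simp add: first_def)
      then show ?thesis by blast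
    next
      case (Some y)
      then have "check_prefix m (SBot # path [y] @ map Inner ds)"
        using e that k unfolding \<open>m = Some \<kappa>\<close> k check_prefix_def option.case prod.case
        by (intro exI[of _ "[y]"] exI[of _ ds]) (auto simp: first_def reduced_Cons)
      then show ?thesis by blast
    qed
  qed
  have entry: "entry_states M = {Reading m q t (m = None) | m q t. ok_state (Ready m q t)}" (is "_ = ?R")
  proof
    show "entry_states M \<subseteq> ?R"
    proof
      fix r assume "r \<in> entry_states M"
      then obtain c where "r = state_of c" "entry_config M c" unfolding entry_states_def by blast
      then show "r \<in> ?R" unfolding entry_config_M_iff by (elim exE conjE) (simp only: fst_conv, blast)
    qed
    show "?R \<subseteq> entry_states M"
    proof
      fix r assume "r \<in> ?R"
      then obtain m q t where r: "r = Reading m q t (m = None)" "ok_state (Ready m q t)" by blast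
      then have "ok_mode m" by simp
      then obtain ds0 where "check_prefix m ds0" using prefix by blast
      then have "entry_config M (r, ds0 @ replicate 0 SPad @ [STop], [SBot])"
        unfolding entry_config_M_iff using r by blast
      then have "state_of (r, ds0 @ replicate 0 SPad @ [STop], [SBot]) \<in> entry_states M"
        unfolding entry_states_def by blast
      then show "r \<in> entry_states M" by simp
    qed
  qed
  have mem: "x \<in> accepting M \<longleftrightarrow> x \<in> reading M \<and> x \<notin> ?R" for x
  proof (cases "x \<in> reading M")
    case True
    then obtain m q t b where x: "x = Reading m q t b" by (auto simp: M_def)
    have "x \<in> ?R \<longleftrightarrow> b = (m = None) \<and> ok_state (Ready m q t)" unfolding x by blast
    then show ?thesis using True unfolding x accepting_M_iff reading_M_iff
      by (cases m) auto
  next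
    case False
    then show ?thesis using accepting_reading_M by blast
  qed
  show ?thesis unfolding entry
  proof (rule Set.set_eqI)
    fix x
    show "x \<in> accepting M \<longleftrightarrow> x \<in> reading M - ?R" unfolding Diff_iff by (rule mem)
  qed
qed

end

section \<open>Tracking the position in the top group\<close>

lemma step_popI:
  "(q, x, head_view ds ps, Pop, q') \<in> transitions M \<Longrightarrow> ps \<noteq> [] \<Longrightarrow> step M (q, ds, ps) x (q', ds, tl ps)"
  by (cases ps) (auto intro: step.pop)

context wreath_automaton
begin

text \<open>A suffix of a stack is an initial segment of the word. So \<open>P\<close> judges the
  segment that ends in the letter to be marked, and the mark depends only on this letter and those
  below it.\<close>

fun mark :: "(('k \<times> bool) list \<Rightarrow> bool) \<Rightarrow> ('k \<times> bool) list \<Rightarrow> ('h, 'k) wsym list" where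
  "mark P [] = []"
| "mark P (y # r) = (if P (y # r) then On y else Off y) # mark P r"

lemma length_mark [simp]: "length (mark P r) = length r"
  by (induction r) auto

lemma mark_eq_Nil_iff [simp]: "mark P r = [] \<longleftrightarrow> r = []"
  by (cases r) auto

lemma mark_ok: "set r \<subseteq> X \<times> UNIV \<Longrightarrow> set (mark P r) \<subseteq> Collect ok_sym"
  by (induction r) auto

lemma mark_suffix: "suffix r r0 \<Longrightarrow> mark (\<lambda>r. suffix r r0) r = map On r"
  by (induction r) (auto dest: suffix_ConsD)

lemma head_view_eq: "ps \<noteq> [] \<Longrightarrow> head_view ds ps = Some (hd ps, ds ! (length ps - 1))"
  by (cases ps) auto

definition full_check :: "('h, 'k) wsym list \<Rightarrow> bool" where
  "full_check ds \<longleftrightarrow> ds \<noteq> [] \<and> last ds = STop \<and> STop \<notin> set (butlast ds) \<and> set ds \<subseteq> Collect ok_sym"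

lemma full_check_nth:
  assumes "full_check ds" "ps \<noteq> []" "length ps \<le> length ds"
  shows "ds ! (length ps - 1) = STop \<longleftrightarrow> length ps = length ds"
    and "ok_sym (ds ! (length ps - 1))"
proof -
  have "length ps < length ds \<Longrightarrow> ds ! (length ps - 1) \<in> set (butlast ds)"
    using assms(2) by (metis One_nat_def diff_Suc_less diff_less_mono length_butlast
        length_greater_0_conv nth_butlast nth_mem Suc_leI)
  moreover have "length ps = length ds \<Longrightarrow> ds ! (length ps - 1) = STop"
    using assms last_conv_nth[of ds] by (simp add: full_check_def)
  ultimately show "ds ! (length ps - 1) = STop \<longleftrightarrow> length ps = length ds"
    using assms(1,3) unfolding full_check_def by (metis le_neq_implies_less)
  have "length ps - 1 < length ds" using assms by (cases ps) auto
  then show "ok_sym (ds ! (length ps - 1))"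
    using assms(1) nth_mem unfolding full_check_def by blast
qed

text \<open>The symbols that the automaton sees on the stack \<open>mark P r @ base\<close> determine \<open>P (y # r)\<close>.\<close>

definition tracks ::
  "'k target option \<Rightarrow> ('h, 'k) wsym list \<Rightarrow> (('k \<times> bool) list \<Rightarrow> bool) \<Rightarrow> ('h, 'k) wsym list \<Rightarrow> bool" where
  "tracks m ds P base \<longleftrightarrow> base \<noteq> [] \<and> hd base \<notin> range On \<union> range Off \<and> set base \<subseteq> Collect ok_sym \<and>
     (\<forall>r y. red r \<longrightarrow> length (mark P r @ base) \<le> length ds \<longrightarrow>
        on_path m (hd (mark P r @ base)) (ds ! (length (mark P r @ base) - 1)) y = P (y # r))"

text \<open>A cancellation lowers the stack and is possible at every height. A push is impossible
  only when the head sees \<open>STop\<close>, that is, when both stacks have equal height, and then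
  no rule applies.\<close>

lemma write_step:
  assumes tracks: "tracks m ds P base" and full: "full_check ds"
    and ok: "ok_state (Writing m q t (y # ys))" and red: "red r"
    and len: "length (mark P r @ base) \<le> length ds"
  shows "step M (Writing m q t (y # ys), ds, mark P r @ base) None
           (Writing m q t ys, ds, mark P (add_letter y r) @ base) \<and>
         length (mark P (add_letter y r) @ base) \<le> length ds \<or>
         length (mark P r @ base) = length ds \<and> halted M (Writing m q t (y # ys), ds, mark P r @ base)"
proof -
  let ?ps = "mark P r @ base"
  define g where "g = hd ?ps"
  define d where "d = ds ! (length ?ps - 1)"
  have ne: "?ps \<noteq> []" and base: "hd base \<notin> range On \<union> range Off" using tracks by (auto simp: tracks_def)
  have ps_ok: "set ?ps \<subseteq> Collect ok_sym"
    using mark_ok[of r P] red tracks by (simp add: red_def tracks_def)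
  have view: "head_view ds ?ps = Some (g, d)" using head_view_eq[OF ne] by (simp add: g_def d_def)
  have d: "d = STop \<longleftrightarrow> length ?ps = length ds" "ok_sym d"
    using full_check_nth[OF full ne len] by (simp_all add: d_def)
  have g: "ok_sym g" using ps_ok ne unfolding g_def by (meson hd_in_set mem_Collect_eq subsetD)
  have y: "y \<in> X \<times> UNIV" and ok': "ok_state (Writing m q t ys)" using ok by auto
  show ?thesis
  proof (cases "r \<noteq> [] \<and> hd r = letter_inv y")
    case True
    then obtain r' where r: "r = letter_inv y # r'" by (cases r) auto
    then have move: "letter_move m g d y = Pop" by (auto simp: letter_move_def g_def)
    then have "tr (Writing m q t (y # ys)) None (Some (g, d)) Pop (Writing m q t ys)"
      using tr.write_pop[of d m g y q t ys] tr.write_any[of d m q t y ys g] by (cases "d = STop") auto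
    then have "step M (Writing m q t (y # ys), ds, ?ps) None (Writing m q t ys, ds, tl ?ps)"
      using ne view d g ok ok' by (intro step_popI) (auto simp: M_transition_iff simp del: ok_state.simps)
    then show ?thesis using r len by (simp add: add_letter_def)
  next
    case False
    have add: "add_letter y r = y # r" using False by (auto simp: add_letter_def)
    have "g \<noteq> On (letter_inv y)" "g \<noteq> Off (letter_inv y)"
      using False base by (cases r; auto simp: g_def)+
    moreover have "on_path m g d y \<longleftrightarrow> P (y # r)"
      using tracks red len unfolding tracks_def g_def d_def by blast
    ultimately have move: "letter_move m g d y = Push (if P (y # r) then On y else Off y)"
      by (simp add: letter_move_def)
    show ?thesis
    proof (cases "length ?ps = length ds")
      case True
      then have "d = STop" using d by simp
      then have "\<not> tr (Writing m q t (y # ys)) None (Some (g, d)) mv q'" for mv q'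
        using move by (auto simp: tr_Writing_Cons)
      then have "halted M (Writing m q t (y # ys), ds, ?ps)"
        unfolding halted_def using view by (auto elim!: step.cases simp: M_transition_iff)
      then show ?thesis using True by blast
    next
      case False
      then have "d \<noteq> STop" using d by simp
      then have "tr (Writing m q t (y # ys)) None (Some (g, d)) (letter_move m g d y) (Writing m q t ys)"
        by (rule tr.write_any)
      then have "step M (Writing m q t (y # ys), ds, ?ps) None
          (Writing m q t ys, ds, (if P (y # r) then On y else Off y) # ?ps)"
        using view d g y ok ok' len False unfolding move
        by (intro step.push) (auto simp: M_transition_iff simp del: ok_state.simps)
      then show ?thesis using add len False by simp
    qed
  qed
qed

text \<open>Every letter raises the stack by at most one, so an overflow forces the initial height
  plus \<open>length ys\<close> beyond the check stack. This bound is what later allows padding to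
  exclude the overflow.\<close>

lemma write_run:
  assumes "tracks m ds P base" "full_check ds"
    and "ok_state (Writing m q t ys)" "red r" "length (mark P r @ base) \<le> length ds"
  shows "run M (Writing m q t ys, ds, mark P r @ base) []
           (Writing m q t [], ds, mark P (fold add_letter ys r) @ base) \<and>
         length (mark P (fold add_letter ys r) @ base) \<le> length ds \<or>
         length (mark P r @ base) + length ys > length ds \<and>
         (\<exists>c. run M (Writing m q t ys, ds, mark P r @ base) [] c \<and> halted M c)"
  using assms(3-5)
proof (induction ys arbitrary: r)
  case Nil
  then show ?case by (auto intro: run.refl)
next
  case (Cons y ys)
  have ok': "ok_state (Writing m q t ys)" and y: "y \<in> X \<times> UNIV" using Cons.prems(1) by auto
  have red': "red (add_letter y r)"
    using red_fold[OF Cons.prems(2), of "[y]"] y by simp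
  from write_step[OF assms(1,2) Cons.prems] show ?case
  proof (elim disjE conjE)
    assume s: "step M (Writing m q t (y # ys), ds, mark P r @ base) None
        (Writing m q t ys, ds, mark P (add_letter y r) @ base)"
      and l: "length (mark P (add_letter y r) @ base) \<le> length ds"
    have len: "length (mark P (add_letter y r) @ base) \<le> Suc (length (mark P r @ base))"
      using length_add_letter[of y r] by simp
    from Cons.IH[OF ok' red' l] show ?thesis
    proof (elim disjE conjE exE)
      assume "run M (Writing m q t ys, ds, mark P (add_letter y r) @ base) []
           (Writing m q t [], ds, mark P (fold add_letter ys (add_letter y r)) @ base)"
        "length (mark P (fold add_letter ys (add_letter y r)) @ base) \<le> length ds"
      then show ?thesis using run.silent[OF s] by simp
    next
      fix c assume l': "length ds < length (mark P (add_letter y r) @ base) + length ys"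
        and c: "run M (Writing m q t ys, ds, mark P (add_letter y r) @ base) [] c" "halted M c"
      have "run M (Writing m q t (y # ys), ds, mark P r @ base) [] c" using run.silent[OF s c(1)] .
      then show ?thesis using c(2) l' len by (intro disjI2 conjI) auto
    qed
  next
    assume "length (mark P r @ base) = length ds" "halted M (Writing m q t (y # ys), ds, mark P r @ base)"
    then show ?thesis by (intro disjI2) (auto intro: run.refl)
  qed
qed

lemma length_out: "t \<in> T \<Longrightarrow> s \<in> S \<Longrightarrow> length (out t s) \<le> max_out"
  unfolding max_out_def using finite_T finite_S by (intro Max_ge) force+

text \<open>One statement for every stack on which a generator of \<open>K\<close> acts: without a
  target, and with a target before and after the stack of \<open>N\<close> has been opened. Only
  \<open>P\<close> and \<open>base\<close> differ.\<close>

lemma top_letter_macro: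
  assumes tracks: "tracks m ds P base" and full: "full_check ds"
    and ok: "ok_state (Reading m q t b)" and red: "red r" and len: "length (mark P r @ base) \<le> length ds"
    and a: "a \<in> B" "decode a = Inr s" and live: "live m q (hd (mark P r @ base))"
  defines "ps' \<equiv> mark P (fold add_letter (out t s) r) @ base"
  shows "macro_step M (Reading m q t b, ds, mark P r @ base) a
           (Reading m q (next_rep t s) (m = None \<and> hd ps' = SBot), ds, ps') \<and> length ps' \<le> length ds \<or>
         length (mark P r @ base) + max_out > length ds \<and> dead M (Reading m q t b, ds, mark P r @ base) a"
proof -
  let ?ps = "mark P r @ base" and ?t = "next_rep t s" and ?r' = "fold add_letter (out t s) r"
  have ne: "?ps \<noteq> []" "ps' \<noteq> []" using tracks by (auto simp: tracks_def ps'_def)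
  have t: "t \<in> T" using ok by simp
  have s: "s \<in> S" using decode[OF a(1)] a(2) by auto
  have red': "red ?r'" using red_fold red out t s by blast
  have base_ok: "set base \<subseteq> Collect ok_sym" using tracks by (simp add: tracks_def)
  have hd_ok: "ok_sym (hd ?ps)" "ok_sym (hd ps')"
    using hd_in_set[OF ne(1)] hd_in_set[OF ne(2)] mark_ok[of r P] mark_ok[of ?r' P] red red' base_ok
    unfolding red_def ps'_def by auto
  have okW: "ok_state (Writing m q ?t (out t s))" "ok_state (Writing m q ?t [])"
    "ok_state (Reading m q ?t (m = None \<and> hd ps' = SBot))"
    using ok next_rep[OF t s] out[OF t s] length_out[OF t s] by (auto split: if_splits)
  have "tr (Reading m q t b) (Some a) (Some (hd ?ps, ds ! (length ?ps - 1))) Keep (Writing m q ?t (out t s))"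
    using a(2) live by (rule tr.top_letter)
  then have step: "step M (Reading m q t b, ds, ?ps) (Some a) (Writing m q ?t (out t s), ds, ?ps)"
    using head_view_eq[OF ne(1)] full_check_nth(2)[OF full ne(1) len] hd_ok(1) ok okW(1) a(1)
    by (intro step.keep) (auto simp: M_transition_iff simp del: ok_state.simps)
  from write_run[OF tracks full okW(1) red len] show ?thesis
  proof (elim disjE conjE exE)
    assume r: "run M (Writing m q ?t (out t s), ds, ?ps) [] (Writing m q ?t [], ds, mark P ?r' @ base)"
      and l: "length (mark P ?r' @ base) \<le> length ds"
    have "step M (Writing m q ?t [], ds, ps') None (Reading m q ?t (m = None \<and> hd ps' = SBot), ds, ps')"
      using head_view_eq[OF ne(2)] full_check_nth(2)[OF full ne(2)] l hd_ok(2) okW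
      by (intro step.keep) (auto simp: M_transition_iff ps'_def tr.written simp del: ok_state.simps)
    then have "first_reading M (Writing m q ?t [], ds, ps') (Reading m q ?t (m = None \<and> hd ps' = SBot), ds, ps')"
      using okW(3) by (intro first_reading.later[OF _ _ first_reading.here]) (auto simp del: ok_state.simps)
    then have "first_reading M (Writing m q ?t (out t s), ds, ?ps) (Reading m q ?t (m = None \<and> hd ps' = SBot), ds, ps')"
      using M.run_first_reading[OF r] by (simp add: ps'_def)
    then show ?thesis using step l unfolding macro_step_def ps'_def by blast
  next
    fix c assume "length ds < length ?ps + length (out t s)" "run M (Writing m q ?t (out t s), ds, ?ps) [] c" "halted M c"
    then show ?thesis using M.deadI[OF step] length_out[OF t s] by simp
  qed
qed

lemma skip_macro:
  assumes "full_check ds" "ok_state (Reading m q t b)" "ps \<noteq> []" "length ps \<le> length ds" "ok_sym (hd ps)"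
    and "a \<in> B" "decode a = Inl h" "live m q (hd ps)"
    and "\<And>\<kappa>. m = Some \<kappa> \<Longrightarrow> \<not> at_target \<kappa> t (hd ps) (ds ! (length ps - 1))"
  shows "macro_step M (Reading m q t b, ds, ps) a (Reading m q t b, ds, ps)"
proof -
  have "step M (Reading m q t b, ds, ps) (Some a) (Reading m q t b, ds, ps)"
    using tr.skip[OF assms(7,8,9), where b = b] assms(2,5,6) head_view_eq[OF assms(3)]
      full_check_nth(2)[OF assms(1,3,4)]
    by (intro step.keep) (auto simp: M_transition_iff simp del: ok_state.simps)
  moreover have "first_reading M (Reading m q t b, ds, ps) (Reading m q t b, ds, ps)"
    using assms(2) by (intro first_reading.here) (simp del: ok_state.simps)
  ultimately show ?thesis unfolding macro_step_def by blast
qed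

text \<open>The additional entries, whose state of \<open>N\<close> does not match the target, block
  on every letter. On nonempty input (P6) then holds by failure.\<close>

lemma not_live_dead:
  assumes "\<not> live m q (hd ps)" "ps \<noteq> []"
  shows "dead M (Reading m q t b, ds, ps) a"
proof -
  have "\<not> tr (Reading m q t b) (Some a) (Some (hd ps, d)) mv q'" for d mv q'
    using assms(1) by (auto simp: tr_Reading)
  then have "\<not> step M (Reading m q t b, ds, ps) (Some a) c" for c
    using head_view_eq[OF assms(2)] by (auto elim!: step.cases simp: M_transition_iff)
  then show ?thesis by (simp add: dead_def)
qed

end

section \<open>Simulating the automaton of the base group\<close>

text \<open>Everything on which a run with a target depends: the word \<open>w\<close> of the target
  in reading order, its representative, an entry configuration of \<open>N\<close>, and the amount
  \<open>n\<close> of padding.\<close>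

locale wreath_component = wreath_automaton K X T S out next_rep H A N B decode
  for K :: "('k, 'n) monoid_scheme" (structure) and X T S out next_rep
    and H :: "('h, 'm) monoid_scheme" and A N and B :: "'a set" and decode +
  fixes w :: "('k \<times> bool) list" and s0 :: nat and t0 :: 'k and ds' :: "'h stack_symbol list" and n :: nat
  assumes reduced_w: "reduced w" and set_w: "set w \<subseteq> X \<times> UNIV"
    and entry: "entry_config N (s0, ds', [Bottom])" and t0: "t0 \<in> T"
    and s0: "s0 \<in> reading N - accepting N"
begin

definition "mode = (s0, t0, first w)"
definition "check = (SBot # path w @ map Inner ds') @ replicate n SPad @ [STop]"
text \<open>The guessed element \<open>k\<close>.\<close>

definition "position = stack_value (rev w) \<otimes> t0"
definition "path_base = map On (rev w) @ [SBot :: ('h, 'k) wsym]"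
definition "inner_stack ps = map Inner ps @ path_base"

text \<open>The inner stack is only present while the configuration of \<open>N\<close> is not the entry configuration;
  this makes the configuration a function of the position and of the configuration of \<open>N\<close>.\<close>

definition pushdown :: "'k \<Rightarrow> nat \<Rightarrow> 'h stack_symbol list \<Rightarrow> ('h, 'k) wsym list" where
  "pushdown p q ps =
     (if q = s0 \<and> ps = [Bottom] then mark (\<lambda>r. suffix r (rev w)) (word_of p) @ [SBot]
      else mark (\<lambda>_. False) (word_of (inv (stack_value (rev w)) \<otimes> p)) @ inner_stack ps)"

definition config :: "'k \<Rightarrow> nat \<Rightarrow> 'h stack_symbol list \<Rightarrow> (('h, 'k) wstate, ('h, 'k) wsym) config" where
  "config p q ps = (Reading (Some mode) q (rep_of p) False, check, pushdown p q ps)"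

text \<open>As \<open>Bottom\<close> occurs only at the bottom, \<open>inner_done\<close> can
  recognise the stack of an entry configuration from its top symbol.\<close>

definition inner_ok :: "'h stack_symbol list \<Rightarrow> bool" where
  "inner_ok ps \<longleftrightarrow> set ps \<subseteq> pushdown_alphabet N \<and> length ps \<le> length ds' \<and>
     (\<exists>ps'. ps = ps' @ [Bottom] \<and> Bottom \<notin> set ps')"

lemma red_w: "red (rev w)"
  using reduced_w set_w by (simp add: red_def)

lemma mode_target: "mode \<in> targets"
proof -
  have "first w \<in> insert None (Some ` (X \<times> UNIV))"
    using set_w unfolding first_def by (cases w) auto
  then show ?thesis using s0 t0 by (simp add: mode_def)
qed

lemma inner_check: "ds' \<noteq> []" "last ds' = Top" "set ds' \<subseteq> check_alphabet N"
proof -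
  obtain q d x where q: "initialises N q d" "step N (q, d, []) x (s0, ds', [Bottom])"
    using entry unfolding entry_config_def by blast
  then have "d = ds'" using step_check_stack by fastforce
  with q show "ds' \<noteq> []" "last ds' = Top" "set ds' \<subseteq> check_alphabet N"
    using discipline_N initialises_alphabet unfolding stack_discipline_def by blast+
qed

lemma full_check: "full_check check"
proof -
  have "STop \<notin> set (SBot # path w @ map Inner ds')" by (auto simp: path_def)
  moreover have "set (SBot # path w @ map Inner ds') \<subseteq> Collect ok_sym"
    using set_w inner_check(3) by (cases w) (auto simp: path_def)
  ultimately show ?thesis unfolding full_check_def check_def by (auto simp: butlast_append)
qed

lemma length_check: "length check = length w + length ds' + n + 2"
  by (simp add: check_def)

lemma check_0: "check ! 0 = SBot"
  by (simp add: check_def)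

lemma check_path: "0 < i \<Longrightarrow> i \<le> length w \<Longrightarrow>
    check ! i = Next (if i < length w then Some (w ! i) else None)"
  by (cases i) (auto simp: check_def nth_append path_nth)

lemma check_inner: "i < length ds' \<Longrightarrow> check ! (Suc (length w) + i) = Inner (ds' ! i)"
  by (simp add: check_def nth_append)

lemma inner_ok_Bottom: "inner_ok [Bottom]"
  using inner_check(1) N_alphabets by (auto simp: inner_ok_def Suc_le_eq)

lemma inner_ok_ne: "inner_ok ps \<Longrightarrow> ps \<noteq> []"
  by (auto simp: inner_ok_def)

lemma inner_ok_hd: "inner_ok ps \<Longrightarrow> hd ps = Bottom \<longleftrightarrow> ps = [Bottom]"
  unfolding inner_ok_def by (elim conjE exE, rename_tac ps', case_tac ps') auto

lemma length_inner_stack: "length (inner_stack ps) = length ps + length w + 1"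
  by (simp add: inner_stack_def path_base_def)

lemma inner_stack_ok: "inner_ok ps \<Longrightarrow> set (inner_stack ps) \<subseteq> Collect ok_sym"
  using set_w by (auto simp: inner_stack_def path_base_def inner_ok_def)

text \<open>Both stacks of \<open>N\<close> are raised by the same \<open>length w + 1\<close>
  symbols, so the head meets the same pair as in \<open>N\<close>.\<close>

lemma inner_view:
  assumes "inner_ok ps"
  shows "head_view check (inner_stack ps) = Some (Inner (hd ps), Inner (ds' ! (length ps - 1)))"
    and "head_view ds' ps = Some (hd ps, ds' ! (length ps - 1))"
proof -
  have ne: "ps \<noteq> []" "inner_stack ps \<noteq> []" using inner_ok_ne[OF assms] by (auto simp: inner_stack_def)
  have "length ps - 1 < length ds'" using assms ne by (cases ps) (auto simp: inner_ok_def)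
  from check_inner[OF this] have "check ! (length (inner_stack ps) - 1) = Inner (ds' ! (length ps - 1))"
    using ne by (cases ps) (simp_all add: length_inner_stack add.commute)
  moreover have "hd (inner_stack ps) = Inner (hd ps)" using ne by (cases ps) (simp_all add: inner_stack_def)
  ultimately show "head_view check (inner_stack ps) = Some (Inner (hd ps), Inner (ds' ! (length ps - 1)))"
    using head_view_eq[OF ne(2)] by simp
  show "head_view ds' ps = Some (hd ps, ds' ! (length ps - 1))" using head_view_eq[OF ne(1)] .
qed

lemma inner_symbols_ok:
  assumes "inner_ok ps"
  shows "hd ps \<in> pushdown_alphabet N" "ds' ! (length ps - 1) \<in> check_alphabet N"
proof -
  have ne: "ps \<noteq> []" using inner_ok_ne[OF assms] .
  then show "hd ps \<in> pushdown_alphabet N" using assms hd_in_set unfolding inner_ok_def by blast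
  have "length ps - 1 < length ds'" using assms ne by (cases ps) (auto simp: inner_ok_def)
  then show "ds' ! (length ps - 1) \<in> check_alphabet N" using inner_check(3) nth_mem by blast
qed

text \<open>The states \<open>Q\<close> and \<open>Q'\<close> are left open because one argument
  about the stacks serves both a letter, processed from \<open>Feed\<close>, and a silent step, made
  in \<open>Inner_run\<close>.\<close>

lemma inner_step:
  assumes step: "step N (q, ds', ps) x c" and ok: "inner_ok ps"
  obtains q' ps' where "c = (q', ds', ps')" "inner_ok ps'" "q' \<in> states N"
    "\<And>Q Q'. (\<And>mv. (q, x, Some (hd ps, ds' ! (length ps - 1)), mv, q') \<in> transitions N \<Longrightarrow>
         tr Q None (Some (Inner (hd ps), Inner (ds' ! (length ps - 1)))) (map_stack_move Inner mv) Q') \<Longrightarrow>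
       ok_state Q \<Longrightarrow> ok_state Q' \<Longrightarrow>
       step M (Q, check, inner_stack ps) None (Q', check, inner_stack ps')"
proof -
  let ?g = "hd ps" and ?d = "ds' ! (length ps - 1)"
  have ne: "ps \<noteq> []" using inner_ok_ne[OF ok] .
  have sym: "ok_sym (Inner ?g)" "ok_sym (Inner ?d)" using inner_symbols_ok[OF ok] by auto
  obtain ps1 where ps1: "ps = ps1 @ [Bottom]" "Bottom \<notin> set ps1" using ok by (auto simp: inner_ok_def)
  from step show thesis
  proof (cases rule: step.cases)
    case (keep q')
    note tr = keep(2)[unfolded inner_view(2)[OF ok]]
    show thesis
    proof (rule that)
      show "c = (q', ds', ps)" using keep by simp
      show "inner_ok ps" by (rule ok)
      show "q' \<in> states N" using N_transition(2)[OF tr] .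
      fix Q Q' assume *: "\<And>mv. (q, x, Some (?g, ?d), mv, q') \<in> transitions N \<Longrightarrow>
         tr Q None (Some (Inner ?g, Inner ?d)) (map_stack_move Inner mv) Q'" "ok_state Q" "ok_state Q'"
      then show "step M (Q, check, inner_stack ps) None (Q', check, inner_stack ps)"
        using *(1)[OF tr] sym by (intro step.keep) (simp add: M_transition_iff inner_view(1)[OF ok])
    qed
  next
    case (push g q')
    note tr = push(2)[unfolded inner_view(2)[OF ok]]
    have g: "g \<in> pushdown_alphabet N" "g \<noteq> Bottom"
      using N_transition(5)[OF tr] N_move(1)[OF tr] by auto
    show thesis
    proof (rule that)
      show "c = (q', ds', g # ps)" using push by simp
      show "inner_ok (g # ps)" using ok push(3) g unfolding inner_ok_def
        by (auto intro: exI[of _ "g # ps1" for ps1])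
      show "q' \<in> states N" using N_transition(2)[OF tr] .
      fix Q Q' assume *: "\<And>mv. (q, x, Some (?g, ?d), mv, q') \<in> transitions N \<Longrightarrow>
         tr Q None (Some (Inner ?g, Inner ?d)) (map_stack_move Inner mv) Q'" "ok_state Q" "ok_state Q'"
      \<comment> \<open>The room in \<open>ds'\<close> carries over: both stacks are raised equally,
        and the padding and the top symbol lie higher still.\<close>
      have "length (inner_stack ps) < length check" using push(3) by (simp add: length_inner_stack length_check)
      then have "step M (Q, check, inner_stack ps) None (Q', check, Inner g # inner_stack ps)"
        using *(1)[OF tr] * sym g by (intro step.push) (simp_all add: M_transition_iff inner_view(1)[OF ok])
      then show "step M (Q, check, inner_stack ps) None (Q', check, inner_stack (g # ps))"
        by (simp add: inner_stack_def)
    qed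
  next
    case (pop g ps2 q')
    note tr = pop(3)[folded pop(1), unfolded inner_view(2)[OF ok]]
    have g: "g \<noteq> Bottom" using N_move(2)[OF tr] pop(1) by auto
    then obtain ps3 where ps3: "ps1 = g # ps3" using ps1 pop(1) by (cases ps1) auto
    show thesis
    proof (rule that)
      show "c = (q', ds', ps2)" using pop by simp
      show "inner_ok ps2" using ok ps1 ps3 pop(1) by (auto simp: inner_ok_def)
      show "q' \<in> states N" using N_transition(2)[OF tr] .
      fix Q Q' assume *: "\<And>mv. (q, x, Some (?g, ?d), mv, q') \<in> transitions N \<Longrightarrow>
         tr Q None (Some (Inner ?g, Inner ?d)) (map_stack_move Inner mv) Q'" "ok_state Q" "ok_state Q'"
      have "step M (Q, check, inner_stack ps) None (Q', check, tl (inner_stack ps))"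
        using *(1)[OF tr] * sym ne
        by (intro step_popI) (simp_all add: M_transition_iff inner_view(1)[OF ok], simp add: inner_stack_def)
      then show "step M (Q, check, inner_stack ps) None (Q', check, inner_stack ps2)"
        using pop(1) by (simp add: inner_stack_def)
    qed
  qed
qed

text \<open>An applicable transition could fail to be a step only by pushing beyond the check stack
  or popping an empty stack. The discipline of \<open>N\<close> forbids a push when
  \<open>Top\<close> is seen, and \<open>inner_ok\<close> keeps the stack nonempty. So halting of
  \<open>N\<close> can be read off its transitions, which are all that \<open>M\<close> has at its
  disposal.\<close>

lemma inner_step_exists:
  assumes tr: "(q, x, Some (hd ps, ds' ! (length ps - 1)), mv, q') \<in> transitions N" and ok: "inner_ok ps"
  shows "\<exists>c. step N (q, ds', ps) x c"
proof -
  have tr': "(q, x, head_view ds' ps, mv, q') \<in> transitions N"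
    using tr inner_view(2)[OF ok] by simp
  show ?thesis
  proof (cases mv)
    case Keep
    then show ?thesis using tr' step.keep by metis
  next
    case (Push g)
    have "length ps < length ds'"
    proof (rule ccontr)
      assume "\<not> length ps < length ds'"
      then have "length ps = length ds'" using ok by (simp add: inner_ok_def)
      then have "ds' ! (length ps - 1) = Top" using inner_check last_conv_nth[of ds'] by simp
      then show False using tr Push discipline_N unfolding stack_discipline_def by blast
    qed
    then show ?thesis using tr' Push step.push by metis
  next
    case Pop
    then show ?thesis using tr' inner_ok_ne[OF ok] step_popI by metis
  qed
qed

lemma inner_run_step:
  assumes "step N (q, ds', ps) None c" "inner_ok ps"
  obtains q' ps' where "c = (q', ds', ps')" "inner_ok ps'"
    "step M (Inner_run mode q, check, inner_stack ps) None (Inner_run mode q', check, inner_stack ps')"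
proof -
  have q: "q \<in> states N"
    using N.step_transition[OF assms(1)] N_transition(1) by (metis fst_conv)
  from inner_step[OF assms] obtain q' ps' where *: "c = (q', ds', ps')" "inner_ok ps'" "q' \<in> states N"
    and st: "\<And>Q Q'. (\<And>mv. (q, None, Some (hd ps, ds' ! (length ps - 1)), mv, q') \<in> transitions N \<Longrightarrow>
         tr Q None (Some (Inner (hd ps), Inner (ds' ! (length ps - 1)))) (map_stack_move Inner mv) Q') \<Longrightarrow>
       ok_state Q \<Longrightarrow> ok_state Q' \<Longrightarrow>
       step M (Q, check, inner_stack ps) None (Q', check, inner_stack ps')" by metis
  have "step M (Inner_run mode q, check, inner_stack ps) None (Inner_run mode q', check, inner_stack ps')"
    by (rule st) (use mode_target q *(3) tr.inner_silent in auto)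
  then show thesis using that * by blast
qed

lemma feed_step:
  assumes "step N (q, ds', ps) (Some h) c" "inner_ok ps"
  obtains q' ps' where "c = (q', ds', ps')" "inner_ok ps'"
    "step M (Feed mode q h, check, inner_stack ps) None (Inner_run mode q', check, inner_stack ps')"
proof -
  have q: "q \<in> reading N" using N.step_reading_iff[OF assms(1)] by simp
  obtain v mv q2 where "(q, Some h, v, mv, q2) \<in> transitions N"
    using N.step_transition[OF assms(1)] by (metis fst_conv)
  then have h: "h \<in> A" using N_transition(3) by fastforce
  from inner_step[OF assms] obtain q' ps' where *: "c = (q', ds', ps')" "inner_ok ps'" "q' \<in> states N"
    and st: "\<And>Q Q'. (\<And>mv. (q, Some h, Some (hd ps, ds' ! (length ps - 1)), mv, q') \<in> transitions N \<Longrightarrow>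
         tr Q None (Some (Inner (hd ps), Inner (ds' ! (length ps - 1)))) (map_stack_move Inner mv) Q') \<Longrightarrow>
       ok_state Q \<Longrightarrow> ok_state Q' \<Longrightarrow>
       step M (Q, check, inner_stack ps) None (Q', check, inner_stack ps')" by metis
  have "step M (Feed mode q h, check, inner_stack ps) None (Inner_run mode q', check, inner_stack ps')"
    by (rule st) (use mode_target q h *(3) tr.inner_letter in auto)
  then show thesis using that * by blast
qed

lemma inner_run_halted:
  assumes "halted N (q, ds', ps)" "inner_ok ps"
  shows "halted M (Inner_run mode q, check, inner_stack ps)"
proof -
  have q: "q \<notin> reading N" "\<nexists>c. step N (q, ds', ps) None c" using assms(1) by (auto simp: halted_def)
  have "\<not> tr (Inner_run mode q) None (Some (Inner (hd ps), Inner (ds' ! (length ps - 1)))) mv q'" for mv q'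
  proof -
    have "(q, None, Some (hd ps, ds' ! (length ps - 1)), mv, q') \<notin> transitions N" for mv q'
      using q(2) inner_step_exists[OF _ assms(2)] by blast
    then show ?thesis using q(1) by (auto simp: tr_Inner_run)
  qed
  then show ?thesis unfolding halted_def using inner_view(1)[OF assms(2)]
    by (auto elim!: step.cases simp: M_transition_iff)
qed

lemma feed_halted:
  assumes "\<nexists>c. step N (q, ds', ps) (Some h) c" "inner_ok ps"
  shows "halted M (Feed mode q h, check, inner_stack ps)"
proof -
  have "\<not> tr (Feed mode q h) None (Some (Inner (hd ps), Inner (ds' ! (length ps - 1)))) mv q'" for mv q'
  proof -
    have "(q, Some h, Some (hd ps, ds' ! (length ps - 1)), mv, q') \<notin> transitions N" for mv q'
      using assms(1) inner_step_exists[OF _ assms(2)] by blast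
    then show ?thesis by (auto simp: tr_Feed)
  qed
  then show ?thesis unfolding halted_def using inner_view(1)[OF assms(2)]
    by (auto elim!: step.cases simp: M_transition_iff)
qed

lemma inner_run:
  "run N (q, ds', ps) [] d \<Longrightarrow> inner_ok ps \<Longrightarrow>
     \<exists>q' ps'. d = (q', ds', ps') \<and> inner_ok ps' \<and>
       run M (Inner_run mode q, check, inner_stack ps) [] (Inner_run mode q', check, inner_stack ps')"
proof (induction "(q, ds', ps)" "[] :: 'h list" d arbitrary: q ps rule: run.induct)
  case refl
  then show ?case by (auto intro: run.refl)
next
  case (silent c' c'')
  from inner_run_step[OF silent.hyps(1) silent.prems] obtain q' ps' where *: "c' = (q', ds', ps')" "inner_ok ps'"
    "step M (Inner_run mode q, check, inner_stack ps) None (Inner_run mode q', check, inner_stack ps')" .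
  then show ?case using silent.hyps(3)[OF *(1,2)] run.silent[OF *(3)] by blast
qed

end

section \<open>The position reached by a word and its components\<close>

context wreath_automaton
begin

text \<open>Reading starts at position \<open>p\<close>. When \<open>p\<close> is the identity, the
  value of the resulting word is the component at \<open>k\<close> of the group element that the
  input represents.\<close>

fun component :: "'k \<Rightarrow> 'k \<Rightarrow> 'a list \<Rightarrow> 'h list" where
  "component k p [] = []"
| "component k p (a # u) = (case decode a of
     Inl h \<Rightarrow> (if p = k then [h] else []) @ component k p u
   | Inr s \<Rightarrow> component k (p \<otimes> s) u)"

fun top_position :: "'k \<Rightarrow> 'a list \<Rightarrow> 'k" where
  "top_position p [] = p"
| "top_position p (a # u) = (case decode a of Inl h \<Rightarrow> top_position p u | Inr s \<Rightarrow> top_position (p \<otimes> s) u)"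

definition trivial :: "'a list \<Rightarrow> bool" where
  "trivial u \<longleftrightarrow> top_position \<one> u = \<one> \<and> (\<forall>k \<in> carrier K. word_value H (component k \<one> u) = \<one>\<^bsub>H\<^esub>)"

lemma top_position_append: "top_position p (u @ v) = top_position (top_position p u) v"
  by (induction u arbitrary: p) (auto split: sum.splits)

lemma component_append: "component k p (u @ v) = component k p u @ component k (top_position p u) v"
  by (induction u arbitrary: p) (auto split: sum.splits)

lemma decode_Inl: "a \<in> B \<Longrightarrow> decode a = Inl h \<Longrightarrow> h \<in> A"
  using decode by fastforce

lemma decode_Inr: "a \<in> B \<Longrightarrow> decode a = Inr s \<Longrightarrow> s \<in> S"
  using decode by fastforce

lemma top_position_closed: "u \<in> lists B \<Longrightarrow> p \<in> carrier K \<Longrightarrow> top_position p u \<in> carrier K"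
  by (induction u arbitrary: p) (auto split: sum.splits dest: decode_Inr)

lemma component_lists: "u \<in> lists B \<Longrightarrow> component k p u \<in> lists A"
  by (induction u arbitrary: p) (auto split: sum.splits dest: decode_Inl)

lemma top_position_mult:
  "u \<in> lists B \<Longrightarrow> p \<in> carrier K \<Longrightarrow> q \<in> carrier K \<Longrightarrow>
     top_position (p \<otimes> q) u = p \<otimes> top_position q u"
proof (induction u arbitrary: q)
  case (Cons a u)
  then show ?case by (auto split: sum.splits dest: decode_Inr simp: m_assoc)
qed simp

text \<open>Left translation moves the start and the observed position alike. Thus the components
  seen from another start are those seen from the identity, with the index \<open>k\<close>
  relabelled; this makes triviality independent of the start.\<close>

lemma component_mult:
  "u \<in> lists B \<Longrightarrow> k \<in> carrier K \<Longrightarrow> p \<in> carrier K \<Longrightarrow> q \<in> carrier K \<Longrightarrow>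
     component k (p \<otimes> q) u = component (inv p \<otimes> k) q u"
proof (induction u arbitrary: q)
  case (Cons a u)
  have "p \<otimes> q = k \<longleftrightarrow> q = inv p \<otimes> k"
    using Cons.prems by (metis inv_solve_left)
  with Cons show ?case by (auto split: sum.splits dest: decode_Inr simp: m_assoc)
qed simp

lemma trivial_top_position:
  assumes "trivial u" "u \<in> lists B" "p \<in> carrier K"
  shows "top_position p u = p"
  using top_position_mult[OF assms(2,3), of \<one>] assms by (simp add: trivial_def)

lemma trivial_component:
  assumes "trivial u" "u \<in> lists B" "p \<in> carrier K" "k \<in> carrier K"
  shows "word_value H (component k p u) = \<one>\<^bsub>H\<^esub>"
  using component_mult[OF assms(2,4,3), of \<one>] assms by (simp add: trivial_def)

text \<open>Each input letter contributes at most one letter to the component, so every prefix of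
  the component arises from a prefix of the word. For (P6) this locates a failure of
  \<open>N\<close> within the input of \<open>M\<close>.\<close>

lemma component_prefix:
  "component k p u = x @ y \<Longrightarrow> \<exists>u1 u2. u = u1 @ u2 \<and> component k p u1 = x"
proof (induction u arbitrary: p x)
  case (Cons a u)
  show ?case
  proof (cases x)
    case Nil
    then show ?thesis by (intro exI[of _ "[]"] exI[of _ "a # u"]) auto
  next
    case (Cons h x')
    have *: "\<exists>u1 u2. a # u = u1 @ u2 \<and> component k p u1 = x"
      if "u = v1 @ v2" "component k p (a # v1) = x" for v1 v2
      using that by (intro exI[of _ "a # v1"] exI[of _ v2]) auto
    show ?thesis
    proof (cases "decode a")
      case (Inl h')
      show ?thesis
      proof (cases "p = k")
        case True
        then have "h = h'" "component k p u = x' @ y" using Cons.prems Inl \<open>x = h # x'\<close> by auto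
        then obtain v1 v2 where "u = v1 @ v2" "component k p v1 = x'" using Cons.IH by blast
        then show ?thesis using * Inl True \<open>x = h # x'\<close> \<open>h = h'\<close> by simp
      next
        case False
        then have "component k p u = x @ y" using Cons.prems Inl by auto
        then obtain v1 v2 where "u = v1 @ v2" "component k p v1 = x" using Cons.IH by blast
        then show ?thesis using * Inl False by simp
      qed
    next
      case (Inr s)
      then have "component k (p \<otimes> s) u = x @ y" using Cons.prems by auto
      then obtain v1 v2 where "u = v1 @ v2" "component k (p \<otimes> s) v1 = x" using Cons.IH by blast
      then show ?thesis using * Inr by simp
    qed
  qed
qed simp

end

section \<open>Following the position and the configuration of \<open>N\<close> together\<close>

context wreath_component
begin

abbreviation "start_N \<equiv> (s0, ds', [Bottom])"

definition fits :: "'k \<Rightarrow> nat \<Rightarrow> 'h stack_symbol list \<Rightarrow> bool" where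
  "fits p q ps \<longleftrightarrow> length (pushdown p q ps) \<le> length check"

text \<open>The stack carries either the word of \<open>p\<close> or the relative word above the
  stack of \<open>N\<close>. The sum covers both cases, and \<open>max_out\<close> covers the
  letters written within one macro step. Padding of at least this length prevents an overflow at
  \<open>p\<close>, whatever \<open>N\<close> does.\<close>

definition extent :: "'k \<Rightarrow> nat" where
  "extent p = length (word_of p) + length (word_of (inv (stack_value (rev w)) \<otimes> p)) + max_out"

lemma first_mode: "first_letter (Some mode) = first w" "fst mode = s0" "fst (snd mode) = t0" "snd (snd mode) = first w"
  by (simp_all add: first_letter_def mode_def)

lemma tracks_path: "tracks (Some mode) check (\<lambda>r. suffix r (rev w)) [SBot]"
  unfolding tracks_def
proof (intro conjI allI impI)
  fix r y assume "red r" "length (mark (\<lambda>r. suffix r (rev w)) r @ [SBot]) \<le> length check"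
  show "on_path (Some mode) (hd (mark (\<lambda>r. suffix r (rev w)) r @ [SBot]))
      (check ! (length (mark (\<lambda>r. suffix r (rev w)) r @ [SBot]) - 1)) y = suffix (y # r) (rev w)"
  proof (cases r)
    case Nil
    have "first w = Some y \<longleftrightarrow> suffix [y] (rev w)"
      by (cases w) (auto simp: first_def suffix_to_prefix)
    then show ?thesis using Nil by (auto simp: on_path_def first_mode)
  next
    case (Cons z r')
    show ?thesis
    proof (cases "suffix r (rev w)")
      case True
      \<comment> \<open>The stack \<open>r\<close> is matched so far, so the check symbol at height
        \<open>length r\<close> announces the letter of \<open>w\<close> that would extend the
        match.\<close>
      then obtain v where v: "w = rev r @ v" by (auto simp: suffix_to_prefix prefix_def)
      have c: "check ! length r = Next (if length r < length w then Some (w ! length r) else None)"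
        using Cons v by (intro check_path) auto
      have "suffix (y # r) (rev w) \<longleftrightarrow> (\<exists>v'. v = y # v')"
        using v by (auto simp: suffix_to_prefix prefix_def)
      also have "\<dots> \<longleftrightarrow> check ! length r = Next (Some y)"
        unfolding c using v by (cases v) (auto simp: nth_append)
      finally show ?thesis using True Cons by (auto simp: on_path_def)
    next
      case False
      then have "\<not> suffix (y # r) (rev w)" by (auto dest: suffix_ConsD)
      then show ?thesis using False Cons by (auto simp: on_path_def)
    qed
  qed
qed auto

text \<open>Above the stack of \<open>N\<close> only \<open>Off\<close> letters are written, and
  that stack itself shows an \<open>Inner\<close> symbol, so neither clause of
  \<open>on_path\<close> can apply.\<close>

lemma tracks_inner: "inner_ok ps \<Longrightarrow> tracks (Some mode) check (\<lambda>_. False) (inner_stack ps)"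
  unfolding tracks_def
proof (intro conjI allI impI)
  assume ok: "inner_ok ps"
  then show "set (inner_stack ps) \<subseteq> Collect ok_sym" by (rule inner_stack_ok)
  show "inner_stack ps \<noteq> []" "hd (inner_stack ps) \<notin> range On \<union> range Off"
    using inner_ok_ne[OF ok] by (cases ps; auto simp: inner_stack_def)+
  fix r y
  have "hd (mark (\<lambda>_. False) r @ inner_stack ps) \<notin> range On \<union> {SBot}"
    using inner_ok_ne[OF ok] by (cases r; cases ps) (auto simp: inner_stack_def)
  then show "on_path (Some mode) (hd (mark (\<lambda>_. False) r @ inner_stack ps))
      (check ! (length (mark (\<lambda>_. False) r @ inner_stack ps) - 1)) y = False"
    by (auto simp: on_path_def)
qed

lemma position_closed: "position \<in> carrier K"
  unfolding position_def using red_w t0 by simp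

lemma position_iff: "p \<in> carrier K \<Longrightarrow> p = position \<longleftrightarrow> word_of p = rev w \<and> rep_of p = t0"
  using normal_form_eqI[OF red_w t0] normal_form_eq unfolding position_def by metis

lemma relative_position:
  assumes "p \<in> carrier K"
  shows "inv (stack_value (rev w)) \<otimes> p \<in> carrier K" "rep_of (inv (stack_value (rev w)) \<otimes> p) = rep_of p"
    "word_of (inv (stack_value (rev w)) \<otimes> p) = [] \<longleftrightarrow> word_of p = rev w"
  using relative_normal_form[OF red_w assms] red_w assms by simp_all

lemma pushdown_ne: "pushdown p q ps \<noteq> []"
  by (simp add: pushdown_def inner_stack_def path_base_def)

lemma pushdown_hd:
  assumes "p \<in> carrier K" "inner_ok ps"
  shows "ok_sym (hd (pushdown p q ps))"
    and "live (Some mode) q (hd (pushdown p q ps))"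
proof -
  have "set (pushdown p q ps) \<subseteq> Collect ok_sym"
    using mark_ok red_word_of relative_position(1) assms inner_stack_ok[of ps]
    unfolding pushdown_def red_def by auto
  then show "ok_sym (hd (pushdown p q ps))" using hd_in_set[OF pushdown_ne] by blast
  have "hd (mark (\<lambda>_. False) r @ inner_stack ps) \<noteq> SBot" for r
    using inner_ok_ne[OF assms(2)] by (cases r; cases ps) (auto simp: inner_stack_def)
  then show "live (Some mode) q (hd (pushdown p q ps))"
    unfolding live_def mode_def pushdown_def by auto
qed

lemma pushdown_position:
  "inner_ok ps \<Longrightarrow> pushdown position q ps = (if q = s0 \<and> ps = [Bottom] then path_base else inner_stack ps)"
  using position_iff[OF position_closed] relative_position(3)[OF position_closed]
  by (auto simp: pushdown_def path_base_def mark_suffix)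

lemma fits_position: "inner_ok ps \<Longrightarrow> fits position q ps"
  by (simp add: fits_def pushdown_position length_inner_stack length_check inner_ok_def)
     (simp add: path_base_def)

text \<open>While the stack of \<open>N\<close> is closed, an \<open>On\<close> letter on top means
  that the stack is an initial segment of the word of the target, and \<open>Next None\<close>
  beside it that the segment is the whole word. While it is open, an \<open>Inner\<close> symbol on
  top means that the relative word is empty.\<close>

lemma at_target_iff:
  assumes "p \<in> carrier K" "inner_ok ps"
  shows "at_target mode (rep_of p) (hd (pushdown p q ps)) (check ! (length (pushdown p q ps) - 1)) \<longleftrightarrow> p = position"
proof (cases "q = s0 \<and> ps = [Bottom]")
  case True
  then have pd: "pushdown p q ps = mark (\<lambda>r. suffix r (rev w)) (word_of p) @ [SBot]" by (simp add: pushdown_def)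
  show ?thesis
  proof (cases "word_of p")
    case Nil
    then show ?thesis unfolding pd position_iff[OF assms(1)] at_target_def first_mode
      using check_0 by (auto simp: first_def)
  next
    case (Cons z r)
    show ?thesis
    proof (cases "suffix (word_of p) (rev w)")
      case True
      then have len: "length (word_of p) \<le> length w" using suffix_length_le by fastforce
      then have c: "check ! length (word_of p) = Next (if length (word_of p) < length w then Some (w ! length (word_of p)) else None)"
        using Cons by (intro check_path) auto
      obtain zs where zs: "rev w = zs @ word_of p" using True by (auto simp: suffix_def)
      have "length w = length zs + length (word_of p)" using arg_cong[OF zs, of length] by simp
      then have "word_of p = rev w \<longleftrightarrow> \<not> length (word_of p) < length w" using zs by auto
      then show ?thesis unfolding pd position_iff[OF assms(1)] at_target_def first_mode
        using True Cons c by auto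
    next
      case False
      then have "word_of p \<noteq> rev w" by auto
      then show ?thesis unfolding pd position_iff[OF assms(1)] at_target_def
        using False Cons by auto
    qed
  qed
next
  case False
  then have pd: "pushdown p q ps = mark (\<lambda>_. False) (word_of (inv (stack_value (rev w)) \<otimes> p)) @ inner_stack ps"
    by (auto simp: pushdown_def)
  obtain g ps' where ps: "ps = g # ps'" using inner_ok_ne[OF assms(2)] by (cases ps) auto
  show ?thesis
  proof (cases "word_of (inv (stack_value (rev w)) \<otimes> p)")
    case Nil
    then have "word_of p = rev w" using relative_position(3)[OF assms(1)] by simp
    then show ?thesis unfolding pd position_iff[OF assms(1)] at_target_def first_mode
      using Nil ps by (auto simp: inner_stack_def)
  next
    case (Cons z r)
    then have "word_of p \<noteq> rev w" using relative_position(3)[OF assms(1)] by simp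
    then show ?thesis unfolding pd position_iff[OF assms(1)] at_target_def
      using Cons by auto
  qed
qed

lemma config_ok: "p \<in> carrier K \<Longrightarrow> q \<in> reading N \<Longrightarrow> ok_state (Reading (Some mode) q (rep_of p) False)"
  using mode_target rep_of_T by simp

lemma length_pushdown: "inner_ok ps \<Longrightarrow> length (pushdown p q ps) + max_out + n \<le> length check + extent p"
  by (auto simp: pushdown_def extent_def length_inner_stack length_check inner_ok_def)

lemma config_top_letter:
  assumes p: "p \<in> carrier K" and q: "q \<in> reading N" and ok: "inner_ok ps" and fits: "fits p q ps"
    and a: "a \<in> B" "decode a = Inr s"
  shows "macro_step M (config p q ps) a (config (p \<otimes> s) q ps) \<and> fits (p \<otimes> s) q ps \<or>
    n < extent p \<and> dead M (config p q ps) a"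
proof -
  have s: "s \<in> S" using decode_Inr a by blast
  note nf = normal_form_mult[OF p s]
  note live = pushdown_hd(2)[OF p ok, of q]
  have "length (pushdown p q ps) + max_out > length check \<Longrightarrow> n < extent p"
    using length_pushdown[OF ok, of p q] by linarith
  moreover have "macro_step M (config p q ps) a (config (p \<otimes> s) q ps) \<and> fits (p \<otimes> s) q ps \<or>
    length (pushdown p q ps) + max_out > length check \<and> dead M (config p q ps) a"
  proof (cases "q = s0 \<and> ps = [Bottom]")
    case True
    then have pd: "pushdown p' q ps = mark (\<lambda>r. suffix r (rev w)) (word_of p') @ [SBot]" for p'
      by (simp add: pushdown_def)
    show ?thesis
      using top_letter_macro[OF tracks_path full_check config_ok[OF p q] red_word_of[OF p] _ a] fits live nf
      unfolding fits_def config_def pd by simp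
  next
    case False
    let ?p = "\<lambda>p. inv (stack_value (rev w)) \<otimes> p"
    have pd: "pushdown p' q ps = mark (\<lambda>_. False) (word_of (?p p')) @ inner_stack ps" for p'
      using False by (auto simp: pushdown_def)
    \<comment> \<open>Left and right multiplication commute, so the relative position moves by the
      same rule as \<open>p\<close>; its representative agrees with that of
      \<open>p\<close>.\<close>
    have "?p (p \<otimes> s) = ?p p \<otimes> s" using red_w p s by (simp add: m_assoc)
    then have nf': "word_of (?p (p \<otimes> s)) = fold add_letter (out (rep_of p) s) (word_of (?p p))"
      using normal_form_mult(1)[OF relative_position(1)[OF p] s] relative_position(2)[OF p] by simp
    show ?thesis
      using top_letter_macro[OF tracks_inner[OF ok] full_check config_ok[OF p q]
          red_word_of[OF relative_position(1)[OF p]] _ a] fits live nf(2) nf'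
      unfolding fits_def config_def pd by simp
  qed
  ultimately show ?thesis by blast
qed

lemma config_skip:
  assumes p: "p \<in> carrier K" and q: "q \<in> reading N" and ok: "inner_ok ps" and fits: "fits p q ps"
    and a: "a \<in> B" "decode a = Inl h" and ne: "p \<noteq> position"
  shows "macro_step M (config p q ps) a (config p q ps)"
  unfolding config_def
  using full_check config_ok[OF p q] pushdown_ne fits[unfolded fits_def] pushdown_hd(1)[OF p ok] a
    pushdown_hd(2)[OF p ok]
  by (rule skip_macro) (use at_target_iff[OF p ok] ne in auto)

text \<open>If \<open>N\<close> is in its entry configuration, its stack is closed and the reading
  step pushes \<open>Inner Bottom\<close>, which opens it; otherwise it is already on top. Both
  cases arrive at the same shape.\<close>

lemma feed_start:
  assumes q: "q \<in> reading N" and ok: "inner_ok ps" and a: "a \<in> B" "decode a = Inl h"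
  shows "step M (config position q ps) (Some a) (Feed mode q h, check, inner_stack ps)"
proof -
  let ?pd = "pushdown position q ps"
  let ?g = "hd ?pd" and ?d = "check ! (length ?pd - 1)"
  have t: "rep_of position = t0" using position_iff position_closed by blast
  have live: "live (Some mode) q ?g" using pushdown_hd(2)[OF position_closed ok] .
  have target: "at_target mode (rep_of position) ?g ?d" using at_target_iff[OF position_closed ok] by simp
  have view: "head_view check ?pd = Some (?g, ?d)" using head_view_eq[OF pushdown_ne] .
  have fits: "length ?pd \<le> length check" using fits_position[OF ok] by (simp add: fits_def)
  have sym: "ok_sym ?g" "ok_sym ?d"
    using pushdown_hd(1)[OF position_closed ok] full_check_nth(2)[OF full_check pushdown_ne fits] by auto
  have okF: "ok_state (Feed mode q h)" using mode_target q decode_Inl a by simp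
  note okR = config_ok[OF position_closed q]
  show ?thesis
  proof (cases "q = s0 \<and> ps = [Bottom]")
    case True
    then have pd: "?pd = path_base" using pushdown_position[OF ok] by simp
    have "?g \<notin> range Inner" unfolding pd path_base_def by (cases "rev w") auto
    with a(2) live target have "tr (Reading (Some mode) q (rep_of position) False) (Some a) (Some (?g, ?d))
        (Push (Inner Bottom)) (Feed mode q h)"
      by (rule tr.open_inner)
    moreover have "length ?pd < length check" unfolding pd by (simp add: path_base_def length_check)
    ultimately have "step M (config position q ps) (Some a) (Feed mode q h, check, Inner Bottom # ?pd)"
      unfolding config_def using view sym okF okR a(1) N_alphabets
      by (intro step.push) (auto simp: M_transition_iff simp del: ok_state.simps)
    then show ?thesis using pd True by (simp add: inner_stack_def)
  next
    case False
    then have pd: "?pd = inner_stack ps" using pushdown_position[OF ok] by auto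
    obtain g where g: "?g = Inner g" using inner_ok_ne[OF ok] unfolding pd inner_stack_def by (cases ps) auto
    have "tr (Reading (Some mode) q (rep_of position) False) (Some a) (Some (?g, ?d)) Keep (Feed mode q h)"
      using tr.feed[OF a(2)] live target unfolding g by blast
    then show ?thesis unfolding config_def using view sym okF okR a(1) pd
      by (auto intro!: step.keep simp: M_transition_iff simp del: ok_state.simps)
  qed
qed

lemma inner_done:
  assumes q: "q \<in> reading N" and ok: "inner_ok ps"
  shows "first_reading M (Inner_run mode q, check, inner_stack ps) (config position q ps)"
proof -
  have t: "rep_of position = t0" using position_iff position_closed by blast
  let ?d = "ds' ! (length ps - 1)"
  have sym: "ok_sym (Inner (hd ps))" "ok_sym (Inner ?d)" using inner_symbols_ok[OF ok] by auto
  have okI: "ok_state (Inner_run mode q)" using mode_target q reading_states_N by auto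
  have okR: "ok_state (Reading (Some mode) q t0 False)" using config_ok[OF position_closed q] t by simp
  have tr: "tr (Inner_run mode q) None (Some (Inner (hd ps), Inner ?d))
      (if q = s0 \<and> hd ps = Bottom then Pop else Keep) (Reading (Some mode) q t0 False)"
    using tr.inner_done[OF q, of mode "hd ps" "Inner ?d"] by (simp add: first_mode)
  have "step M (Inner_run mode q, check, inner_stack ps) None (config position q ps)"
  proof (cases "q = s0 \<and> ps = [Bottom]")
    case True
    then have "step M (Inner_run mode q, check, inner_stack ps) None (Reading (Some mode) q t0 False, check, tl (inner_stack ps))"
      using tr sym okI okR inner_view(1)[OF ok] N_alphabets
      by (intro step_popI) (auto simp: M_transition_iff inner_stack_def simp del: ok_state.simps)
    then show ?thesis using True t pushdown_position[OF ok] by (simp add: config_def inner_stack_def)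
  next
    case False
    then have "\<not> (q = s0 \<and> hd ps = Bottom)" using inner_ok_hd[OF ok] by auto
    then have "step M (Inner_run mode q, check, inner_stack ps) None (Reading (Some mode) q t0 False, check, inner_stack ps)"
      using tr sym okI okR inner_view(1)[OF ok]
      by (intro step.keep) (auto simp: M_transition_iff simp del: ok_state.simps)
    then show ?thesis using False t pushdown_position[OF ok] by (auto simp: config_def)
  qed
  moreover have "state_of (config position q ps) \<in> reading M"
    using okR t by (simp add: config_def del: ok_state.simps)
  ultimately show ?thesis by (intro first_reading.later[OF _ _ first_reading.here]) auto
qed

lemma config_inner_letter:
  assumes q: "q \<in> reading N" and ok: "inner_ok ps" and a: "a \<in> B" "decode a = Inl h"
    and N: "macro_step N (q, ds', ps) h c"
  obtains q' ps' where "c = (q', ds', ps')" "q' \<in> reading N" "inner_ok ps'"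
    "macro_step M (config position q ps) a (config position q' ps')"
proof -
  obtain c1 where c1: "step N (q, ds', ps) (Some h) c1" "first_reading N c1 c"
    using N by (auto simp: macro_step_def)
  obtain q1 ps1 where 1: "c1 = (q1, ds', ps1)" "inner_ok ps1"
    "step M (Feed mode q h, check, inner_stack ps) None (Inner_run mode q1, check, inner_stack ps1)"
    using feed_step[OF c1(1) ok] .
  obtain q' ps' where 2: "c = (q', ds', ps')" "inner_ok ps'"
    "run M (Inner_run mode q1, check, inner_stack ps1) [] (Inner_run mode q', check, inner_stack ps')"
    using inner_run[of q1 ps1 c] first_reading_run[OF c1(2)] 1(1,2) by blast
  have q': "q' \<in> reading N" using first_reading_reading[OF c1(2)] 2(1) by simp
  have "first_reading M (Feed mode q h, check, inner_stack ps) (config position q' ps')"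
    using M.run_first_reading[OF run.silent[OF 1(3) 2(3)] inner_done[OF q' 2(2)]] .
  then have "macro_step M (config position q ps) a (config position q' ps')"
    unfolding macro_step_def using feed_start[OF q ok a] by blast
  then show thesis using that 2 q' by blast
qed

lemma config_inner_dead:
  assumes q: "q \<in> reading N" and ok: "inner_ok ps" and a: "a \<in> B" "decode a = Inl h"
    and N: "dead N (q, ds', ps) h"
  shows "dead M (config position q ps) a"
proof (cases "\<exists>c. step N (q, ds', ps) (Some h) c")
  case True
  then obtain c where c: "step N (q, ds', ps) (Some h) c" by blast
  then obtain d where d: "run N c [] d" "halted N d" using N unfolding dead_def by blast
  obtain q1 ps1 where 1: "c = (q1, ds', ps1)" "inner_ok ps1"
    "step M (Feed mode q h, check, inner_stack ps) None (Inner_run mode q1, check, inner_stack ps1)"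
    using feed_step[OF c ok] .
  obtain q' ps' where 2: "d = (q', ds', ps')" "inner_ok ps'"
    "run M (Inner_run mode q1, check, inner_stack ps1) [] (Inner_run mode q', check, inner_stack ps')"
    using inner_run[of q1 ps1 d] d(1) 1(1,2) by blast
  show ?thesis
    using M.deadI[OF feed_start[OF q ok a] run.silent[OF 1(3) 2(3)]] inner_run_halted d(2) 2 by blast
next
  case False
  then show ?thesis
    using M.deadI[OF feed_start[OF q ok a] run.refl feed_halted[OF _ ok]] by blast
qed

lemma reachable_N:
  assumes "macro_steps N start_N x c"
  shows "second_stage_reachable N x c"
proof -
  obtain q d y where q: "initialises N q d" "step N (q, d, []) y start_N"
    using entry unfolding entry_config_def by blast
  then have "y = None" using discipline_N unfolding stack_discipline_def by blast
  then show ?thesis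
    using q run.silent[OF _ macro_steps_run[OF assms]] unfolding second_stage_reachable_def by blast
qed

text \<open>The simulation invariant. The first alternative describes both automata completely. The
  second names a letter on which \<open>M\<close> blocks and the cause, so that each cause can be
  refuted separately: sufficient padding excludes the overflow, and a complete run of
  \<open>N\<close> excludes that \<open>N\<close> blocks.\<close>

lemma track:
  assumes p0: "p0 \<in> carrier K" and fits0: "fits p0 s0 [Bottom]" and u: "u \<in> lists B"
  shows "(\<exists>q ps. macro_steps N start_N (component position p0 u) (q, ds', ps) \<and> q \<in> reading N \<and> inner_ok ps \<and>
            macro_steps M (config p0 s0 [Bottom]) u (config (top_position p0 u) q ps) \<and> fits (top_position p0 u) q ps) \<or>
         (\<exists>u1 a u2 c. u = u1 @ a # u2 \<and> macro_steps M (config p0 s0 [Bottom]) u1 c \<and> dead M c a \<and>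
            (n < extent (top_position p0 u1) \<or>
             (\<exists>x h y d. component position p0 u = x @ h # y \<and> macro_steps N start_N x d \<and> dead N d h)))"
  using u
proof (induction u rule: rev_induct)
  case Nil
  show ?case using s0 inner_ok_Bottom fits0
    by (intro disjI1 exI[of _ s0] exI[of _ "[Bottom]"]) (auto intro: macro_steps.refl)
next
  case (snoc a u)
  have uB: "u \<in> lists B" and a: "a \<in> B" using snoc.prems by auto
  let ?p = "top_position p0 u"
  have p: "?p \<in> carrier K" using top_position_closed[OF uB p0] .
  from snoc.IH[OF uB] show ?case
  proof (elim disjE exE conjE)
    fix q ps
    assume N: "macro_steps N start_N (component position p0 u) (q, ds', ps)" and q: "q \<in> reading N"
      and ok: "inner_ok ps" and M: "macro_steps M (config p0 s0 [Bottom]) u (config ?p q ps)"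
      and fits: "fits ?p q ps"
    show ?thesis
    proof (cases "decode a")
      case (Inr s)
      have c: "component position p0 (u @ [a]) = component position p0 u"
        "top_position p0 (u @ [a]) = ?p \<otimes> s"
        using Inr by (simp_all add: component_append top_position_append)
      from config_top_letter[OF p q ok fits a Inr] show ?thesis
      proof (elim disjE conjE)
        assume "macro_step M (config ?p q ps) a (config (?p \<otimes> s) q ps)" "fits (?p \<otimes> s) q ps"
        then show ?thesis unfolding c using N q ok M by (auto simp: macro_steps_snoc)
      next
        assume "n < extent ?p" "dead M (config ?p q ps) a"
        then show ?thesis using M by (intro disjI2 exI[of _ u] exI[of _ a] exI[of _ "[]"]) auto
      qed
    next
      case (Inl h)
      show ?thesis
      proof (cases "?p = position")
        case False
        then have c: "component position p0 (u @ [a]) = component position p0 u" "top_position p0 (u @ [a]) = ?p"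
          using Inl by (simp_all add: component_append top_position_append)
        show ?thesis unfolding c using config_skip[OF p q ok fits a Inl False] N q ok M fits
          by (auto simp: macro_steps_snoc)
      next
        case True
        then have c: "component position p0 (u @ [a]) = component position p0 u @ [h]" "top_position p0 (u @ [a]) = position"
          using Inl by (simp_all add: component_append top_position_append)
        \<comment> \<open>Condition (P4) of \<open>N\<close> enters here: it ensures that
          \<open>N\<close> either comes back to a reading state or halts.\<close>
        from N.macro_step_or_dead[OF no_infinite_N reachable_N[OF N], of h] show ?thesis
        proof
          assume "\<exists>d. macro_step N (q, ds', ps) h d"
          then obtain d where d: "macro_step N (q, ds', ps) h d" by blast
          obtain q' ps' where q': "d = (q', ds', ps')" "q' \<in> reading N" "inner_ok ps'"
            "macro_step M (config position q ps) a (config position q' ps')"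
            using config_inner_letter[OF q ok a Inl d] .
          then show ?thesis unfolding c using N M d fits_position[OF q'(3)] True
            by (intro disjI1 exI[of _ q'] exI[of _ ps']) (auto simp: macro_steps_snoc)
        next
          assume d: "dead N (q, ds', ps) h"
          then have "dead M (config ?p q ps) a" using config_inner_dead[OF q ok a Inl] True by simp
          then show ?thesis unfolding c using M N d
            by (intro disjI2 exI[of _ u] exI[of _ a] exI[of _ "[]"]) auto
        qed
      qed
    qed
  next
    fix u1 b u2 c
    assume "u = u1 @ b # u2" "macro_steps M (config p0 s0 [Bottom]) u1 c" "dead M c b"
      "n < extent (top_position p0 u1)"
    then show ?thesis by (intro disjI2 exI[of _ u1] exI[of _ b] exI[of _ "u2 @ [a]"]) auto
  next
    fix u1 b u2 c x h y d
    assume "u = u1 @ b # u2" "macro_steps M (config p0 s0 [Bottom]) u1 c" "dead M c b"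
      "component position p0 u = x @ h # y" "macro_steps N start_N x d" "dead N d h"
    moreover from this have "component position p0 (u @ [a]) = x @ h # (y @ component position ?p [a])"
      unfolding component_append[of _ _ u] by simp
    moreover have "u @ [a] = u1 @ b # (u2 @ [a])" using \<open>u = u1 @ b # u2\<close> by simp
    ultimately show ?thesis by blast
  qed
qed

end

section \<open>Language and stability\<close>

context wreath_automaton
begin

text \<open>Without a target there is nothing to match, so all letters are \<open>Off\<close> and
  the configuration is a function of the position alone.\<close>

definition top_config ::
  "('h, 'k) wsym list \<Rightarrow> 'k \<Rightarrow> (('h, 'k) wstate, ('h, 'k) wsym) config" where
  "top_config ds p = (Reading None 0 (rep_of p) (word_of p = []), ds, mark (\<lambda>_. False) (word_of p) @ [SBot])"

lemma tracks_top: "tracks None ds (\<lambda>_. False) [SBot]"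
  unfolding tracks_def
proof (intro conjI allI impI)
  fix r y
  have "hd (mark (\<lambda>_. False) r @ [SBot]) \<notin> range On" by (cases r) auto
  then show "on_path None (hd (mark (\<lambda>_. False) r @ [SBot]))
      (ds ! (length (mark (\<lambda>_. False) r @ [SBot]) - 1)) y = False"
    by (auto simp: on_path_def first_letter_def)
qed auto

lemma mark_hd: "hd (mark P r @ [SBot]) = SBot \<longleftrightarrow> r = []"
  by (cases r) auto

text \<open>The counterpart of \<open>track\<close> for the guess about the top component, with
  overflow as the only obstacle.\<close>

lemma track_top:
  assumes full: "full_check ds" and p0: "p0 \<in> carrier K" and len0: "length (word_of p0) < length ds"
    and u: "u \<in> lists B"
  shows "macro_steps M (top_config ds p0) u (top_config ds (top_position p0 u)) \<and>
           length (word_of (top_position p0 u)) < length ds \<or>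
         (\<exists>u1 a u2 c. u = u1 @ a # u2 \<and> macro_steps M (top_config ds p0) u1 c \<and> dead M c a \<and>
            length ds \<le> length (word_of (top_position p0 u1)) + max_out)"
  using u
proof (induction u rule: rev_induct)
  case Nil
  show ?case using len0 by (auto intro: macro_steps.refl)
next
  case (snoc a u)
  have uB: "u \<in> lists B" and a: "a \<in> B" using snoc.prems by auto
  let ?p = "top_position p0 u"
  have p: "?p \<in> carrier K" using top_position_closed[OF uB p0] .
  have okR: "ok_state (Reading None 0 (rep_of ?p) (word_of ?p = []))" using rep_of_T[OF p] by simp
  let ?ps = "mark (\<lambda>_. False) (word_of ?p) @ [SBot]"
  from snoc.IH[OF uB] show ?case
  proof (elim disjE exE conjE)
    assume M: "macro_steps M (top_config ds p0) u (top_config ds ?p)" and len: "length (word_of ?p) < length ds"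
    then have len': "length ?ps \<le> length ds" by simp
    have live: "live None 0 (hd ?ps)" by (simp add: live_def)
    show ?thesis
    proof (cases "decode a")
      case (Inl h)
      then have c: "top_position p0 (u @ [a]) = ?p" by (simp add: top_position_append)
      have "set ?ps \<subseteq> Collect ok_sym" using mark_ok red_word_of[OF p] unfolding red_def by auto
      then have "ok_sym (hd ?ps)" using hd_in_set[of ?ps] by auto
      then have "macro_step M (top_config ds ?p) a (top_config ds ?p)"
        unfolding top_config_def using skip_macro[OF full okR _ len' _ a Inl live] by simp
      then show ?thesis using M len unfolding c by (auto simp: macro_steps_snoc)
    next
      case (Inr s)
      then have c: "top_position p0 (u @ [a]) = ?p \<otimes> s" by (simp add: top_position_append)
      have s: "s \<in> S" using decode_Inr a Inr by blast
      show ?thesis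
        using top_letter_macro[OF tracks_top full okR red_word_of[OF p] len' a Inr live]
      proof (elim disjE conjE)
        assume st: "macro_step M (Reading None 0 (rep_of ?p) (word_of ?p = []), ds, ?ps) a
          (Reading None 0 (next_rep (rep_of ?p) s)
             (None = None \<and> hd (mark (\<lambda>_. False) (fold add_letter (out (rep_of ?p) s) (word_of ?p)) @ [SBot]) = SBot),
           ds, mark (\<lambda>_. False) (fold add_letter (out (rep_of ?p) s) (word_of ?p)) @ [SBot])"
          and l: "length (mark (\<lambda>_. False) (fold add_letter (out (rep_of ?p) s) (word_of ?p)) @ [SBot]) \<le> length ds"
        have "macro_step M (top_config ds ?p) a (top_config ds (?p \<otimes> s))"
          using st unfolding top_config_def normal_form_mult[OF p s] mark_hd by simp
        moreover have "length (word_of (?p \<otimes> s)) < length ds"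
          using l unfolding normal_form_mult[OF p s] by simp
        ultimately show ?thesis using M unfolding c by (auto simp: macro_steps_snoc)
      next
        assume "length ds < length ?ps + max_out" "dead M (Reading None 0 (rep_of ?p) (word_of ?p = []), ds, ?ps) a"
        then show ?thesis using M
          by (intro disjI2 exI[of _ u] exI[of _ a] exI[of _ "[]"] exI[of _ "top_config ds ?p"])
             (auto simp: top_config_def)
      qed
    qed
  next
    fix u1 b u2 c
    assume "u = u1 @ b # u2" "macro_steps M (top_config ds p0) u1 c" "dead M c b"
      "length ds \<le> length (word_of (top_position p0 u1)) + max_out"
    then show ?thesis by (intro disjI2 exI[of _ u1] exI[of _ b] exI[of _ "u2 @ [a]"] exI[of _ c]) auto
  qed
qed

text \<open>Condition (P7) is the reason for the generality: \<open>p0\<close> may be a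
  representative other than the identity, and the third case collects the entries whose state of
  \<open>N\<close> does not belong to the target.\<close>

lemma entry_config_cases:
  assumes "entry_config M C"
  obtains (top) ds where "C = top_config ds \<one>" "full_check ds"
  | (component) w s0 t0 ds' n p0 where
      "wreath_component K X T S out next_rep H A N B decode w s0 t0 ds'"
      "p0 \<in> carrier K" "wreath_component.fits K X T w s0 ds' n p0 s0 [Bottom]"
      "C = wreath_component.config K X T w s0 t0 ds' n p0 s0 [Bottom]"
  | (stuck) "\<And>a. dead M C a" "state_of C \<in> reading M - accepting M"
proof -
  obtain m q t ds0 n where *: "check_prefix m ds0" "ok_state (Ready m q t)"
    "C = (Reading m q t (m = None), ds0 @ replicate n SPad @ [STop], [SBot])"
    using assms unfolding entry_config_M_iff by blast
  show thesis
  proof (cases m)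
    case None
    have "rep_of \<one> = \<one>" "word_of \<one> = []" using rep_of_T_eq word_of_T one_T by auto
    then have "C = top_config (ds0 @ replicate n SPad @ [STop]) \<one>"
      using * None by (simp add: top_config_def)
    moreover have "full_check (ds0 @ replicate n SPad @ [STop])"
      using * None by (auto simp: full_check_def check_prefix_def butlast_append)
    ultimately show thesis by (rule top)
  next
    case (Some \<kappa>)
    obtain s0 t0 n0 where k: "\<kappa> = (s0, t0, n0)" by (cases \<kappa>) auto
    show thesis
    proof (cases "q = s0")
      case True
      obtain w ds' where w: "reduced w" "set w \<subseteq> X \<times> UNIV" "n0 = first w"
        "entry_config N (s0, ds', [Bottom])" "ds0 = SBot # path w @ map Inner ds'"
        using *(1) Some k unfolding check_prefix_def by auto
      interpret wreath_component K X T S out next_rep H A N B decode w s0 t0 ds' n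
        using w *(2) Some k by unfold_locales auto
      have t: "t \<in> T" using *(2) by simp
      have pd: "pushdown t s0 [Bottom] = [SBot]" using word_of_T[OF t] by (simp add: pushdown_def)
      have "C = config t s0 [Bottom]"
        using * Some k w True rep_of_T_eq[OF t] pd by (simp add: config_def mode_def check_def)
      moreover have "fits t s0 [Bottom]" by (simp add: fits_def pd length_check)
      ultimately show thesis
        using component[of w s0 t0 ds' t n] t wreath_component_axioms by simp
    next
      case False
      then have "\<not> live m q SBot" using Some k by (simp add: live_def)
      then have "dead M C a" for a using not_live_dead[of m q "[SBot]"] * by simp
      moreover have "state_of C \<in> reading M - accepting M"
        using * Some by (auto simp: accepting_M_iff)
      ultimately show thesis by (rule stuck)
    qed
  qed
qed

lemma entry_config_reading: "entry_config M C \<Longrightarrow> state_of C \<in> reading M"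
  unfolding entry_config_M_iff by (elim exE conjE) (auto split: if_splits)

abbreviation "blocked C u \<equiv> \<exists>u1 a u2 c. u = u1 @ a # u2 \<and> macro_steps M C u1 c \<and> dead M c a"

lemma entry_outcome:
  assumes "entry_config M C" "u \<in> lists B"
  shows "(\<exists>d. macro_steps M C u d) \<or> blocked C u"
  using assms(1)
proof (cases rule: entry_config_cases)
  case (top ds)
  have "length (word_of \<one>) < length ds" using top(2) word_of_T[OF one_T] by (auto simp: full_check_def)
  then show ?thesis using track_top[OF top(2) one_closed _ assms(2)] top(1) by blast
next
  case (component w s0 t0 ds' n p0)
  interpret wreath_component K X T S out next_rep H A N B decode w s0 t0 ds' n by (rule component(1))
  show ?thesis using track[OF component(2,3) assms(2)] component(4) by blast
next
  case stuck
  show ?thesis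
  proof (cases u)
    case Nil
    then show ?thesis by (auto intro: macro_steps.refl)
  next
    case (Cons a u')
    then show ?thesis using stuck(1) by (intro disjI2 exI[of _ "[]"]) (auto intro: macro_steps.refl)
  qed
qed

text \<open>\<open>entry_outcome\<close> is applied to the word extended by \<open>a\<close>. A
  block at an earlier letter would contradict that \<open>u\<close> has been processed, so the block
  is at \<open>a\<close> itself. Letters outside \<open>B\<close> have no transition.\<close>

lemma entry_progress:
  assumes "entry_config M C" "u \<in> lists B" "macro_steps M C u c"
  shows "(\<exists>d. macro_step M c a d) \<or> dead M c a"
proof (cases "a \<in> B")
  case True
  then have "u @ [a] \<in> lists B" using assms(2) by simp
  from entry_outcome[OF assms(1) this] show ?thesis
  proof (elim disjE exE conjE)
    fix d assume "macro_steps M C (u @ [a]) d"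
    then show ?thesis using M.macro_steps_unique[OF assms(3)] by (auto simp: macro_steps_snoc)
  next
    fix u1 b u2 c' assume *: "u @ [a] = u1 @ b # u2" "macro_steps M C u1 c'" "dead M c' b"
    show ?thesis
    proof (cases u2 rule: rev_cases)
      case Nil
      then show ?thesis using * M.macro_steps_unique[OF assms(3)] by auto
    next
      case (snoc u3 b')
      then have "u = u1 @ b # u3" using *(1) by simp
      then have "macro_steps M C (u1 @ b # u3) c" using assms(3) by simp
      then obtain d e where "macro_steps M C u1 d" "macro_step M d b e"
        by (auto simp: macro_steps_append macro_steps_Cons)
      then show ?thesis using M.macro_steps_unique[OF *(2)] M.dead_not_macro_step[OF *(3)] by blast
    qed
  qed
next
  case False
  then have "\<not> step M c (Some a) d" for d
    by (auto elim!: step.cases simp: M_transition_iff)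
  then show ?thesis by (simp add: dead_def)
qed

lemma initialises_M_nonreading: "initialises M q ds \<Longrightarrow> q \<notin> reading M"
  using initialises_M_inv[of q ds] by (cases q) auto

lemma entry_of_initialises:
  assumes "initialises M q ds" "first_reading M (q, ds, []) e"
  shows "entry_config M e"
  using assms(2)
proof (cases rule: first_reading.cases)
  case here
  then show ?thesis using initialises_M_nonreading[OF assms(1)] by simp
next
  case (later c')
  then have "entry_config M c'" using assms(1) unfolding entry_config_def by blast
  then show ?thesis using first_reading_of_reading[OF later(3) entry_config_reading] by simp
qed

lemma macro_step_letter: "macro_step M c a d \<Longrightarrow> a \<in> B"
  unfolding macro_step_def by (auto elim!: step.cases simp: M_transition_iff)

lemma no_infinite_silent_run_M: "no_infinite_silent_run M"
proof (rule M.no_infinite_silent_runI[where S = "{c. \<exists>C u. entry_config M C \<and> u \<in> lists B \<and> macro_steps M C u c}"])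
  fix c a assume "c \<in> {c. \<exists>C u. entry_config M C \<and> u \<in> lists B \<and> macro_steps M C u c}"
  then obtain C u where C: "entry_config M C" "u \<in> lists B" "macro_steps M C u c" by blast
  from entry_progress[OF C, of a]
  show "(\<exists>d\<in>{c. \<exists>C u. entry_config M C \<and> u \<in> lists B \<and> macro_steps M C u c}. macro_step M c a d) \<or> dead M c a"
  proof
    assume "\<exists>d. macro_step M c a d"
    then obtain d where d: "macro_step M c a d" by blast
    then have "u @ [a] \<in> lists B" "macro_steps M C (u @ [a]) d"
      using C macro_step_letter by (auto simp: macro_steps_snoc)
    then show ?thesis using C(1) d by blast
  qed simp
next
  fix q ds assume i: "initialises M q ds"
  show "(\<exists>d\<in>{c. \<exists>C u. entry_config M C \<and> u \<in> lists B \<and> macro_steps M C u c}. first_reading M (q, ds, []) d) \<or>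
      (\<exists>d. run M (q, ds, []) [] d \<and> halted M d)"
  proof (cases "\<exists>c. step M (q, ds, []) None c")
    case True
    then obtain c where c: "step M (q, ds, []) None c" by blast
    then have e: "entry_config M c" using i unfolding entry_config_def by blast
    have "first_reading M (q, ds, []) c"
      using initialises_M_nonreading[OF i] c entry_config_reading[OF e]
      by (intro first_reading.later[OF _ _ first_reading.here]) auto
    then show ?thesis using e by (auto intro: macro_steps.refl)
  next
    case False
    then have "halted M (q, ds, [])" using initialises_M_nonreading[OF i] by (simp add: halted_def)
    then show ?thesis by (auto intro: run.refl)
  qed
qed

lemma language_M_iff:
  "u \<in> language M \<longleftrightarrow>
     u \<in> lists B \<and> (\<exists>C c. entry_config M C \<and> macro_steps M C u c \<and> state_of c \<in> accepting M)"
proof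
  assume "u \<in> language M"
  then obtain q ds c where u: "u \<in> lists B" and q: "initialises M q ds" "run M (q, ds, []) u c"
    and c: "state_of c \<in> accepting M"
    by (auto simp: language_def second_stage_reachable_def)
  have "state_of c \<in> reading M" using c accepting_reading_M by blast
  then obtain e where e: "first_reading M (q, ds, []) e" "macro_steps M e u c"
    using M.run_to_reading[OF q(2)] by blast
  then show "u \<in> lists B \<and> (\<exists>C c. entry_config M C \<and> macro_steps M C u c \<and> state_of c \<in> accepting M)"
    using u c entry_of_initialises[OF q(1)] by blast
next
  assume "u \<in> lists B \<and> (\<exists>C c. entry_config M C \<and> macro_steps M C u c \<and> state_of c \<in> accepting M)"
  then obtain C c where *: "u \<in> lists B" "entry_config M C" "macro_steps M C u c" "state_of c \<in> accepting M"
    by blast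
  then obtain q ds x where q: "initialises M q ds" "step M (q, ds, []) x C"
    by (auto simp: entry_config_def)
  then have "x = None" by (elim step_M_initial)
  then have "run M (q, ds, []) u c" using q(2) run.silent macro_steps_run[OF *(3)] by metis
  then show "u \<in> language M"
    using * q(1) by (auto simp: language_def second_stage_reachable_def)
qed

lemma language_N_iff:
  "x \<in> language N \<longleftrightarrow> x \<in> lists A \<and> (\<exists>C c. entry_config N C \<and> macro_steps N C x c \<and> state_of c \<in> accepting N)"
proof
  assume x: "x \<in> language N"
  then obtain q ds c where xA: "x \<in> lists A" and q: "initialises N q ds" "run N (q, ds, []) x c"
    and c: "state_of c \<in> accepting N"
    by (auto simp: language_def second_stage_reachable_def input_N)
  have "state_of c \<in> reading N" using c accepting_reading_N by blast
  then obtain e where e: "first_reading N (q, ds, []) e" "macro_steps N e x c"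
    using N.run_to_reading[OF q(2)] by blast
  have disc: "y = None \<and> state_of d \<in> reading N" if "step N (q, ds, []) y d" for y d
    using discipline_N q(1) that unfolding stack_discipline_def by fastforce
  from e(1) have "entry_config N e"
  proof (cases rule: first_reading.cases)
    case here
    \<comment> \<open>The initial configuration could itself be in a reading state. As the empty
      word is not in \<open>coWP\<close>, a letter would be read next, whereas the first transition
      of the second stage reads nothing.\<close>
    have "x \<noteq> []" using x language_N by (auto simp: coWP_def word_value_def)
    then obtain a x' d where "macro_step N e a d" using e(2) by (cases x) (auto simp: macro_steps_Cons)
    then obtain d' where "step N (q, ds, []) (Some a) d'" using here by (auto simp: macro_step_def)
    then show ?thesis using disc by blast
  next
    case (later c')
    then have "entry_config N c'" using q(1) unfolding entry_config_def by blast
    moreover have "e = c'" using first_reading_of_reading[OF later(3)] disc later(2) by blast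
    ultimately show ?thesis by simp
  qed
  then show "x \<in> lists A \<and> (\<exists>C c. entry_config N C \<and> macro_steps N C x c \<and> state_of c \<in> accepting N)"
    using xA e(2) c by blast
next
  assume "x \<in> lists A \<and> (\<exists>C c. entry_config N C \<and> macro_steps N C x c \<and> state_of c \<in> accepting N)"
  then obtain C c where *: "x \<in> lists A" "entry_config N C" "macro_steps N C x c" "state_of c \<in> accepting N"
    by blast
  then obtain q ds y where q: "initialises N q ds" "step N (q, ds, []) y C"
    by (auto simp: entry_config_def)
  then have "y = None" using discipline_N unfolding stack_discipline_def by blast
  then have "run N (q, ds, []) x c" using q(2) run.silent macro_steps_run[OF *(3)] by metis
  then show "x \<in> language N"
    using * q(1) by (auto simp: language_def second_stage_reachable_def input_N)
qed

lemma accepting_config_iff: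
  assumes "wreath_component K X T S out next_rep H A N B decode w s0 t0 ds'"
    "p \<in> carrier K" "q \<in> reading N"
  shows "state_of (wreath_component.config K X T w s0 t0 ds' n p q ps) \<in> accepting M \<longleftrightarrow> q \<in> accepting N"
proof -
  interpret wreath_component K X T S out next_rep H A N B decode w s0 t0 ds' n by (rule assms(1))
  show ?thesis using config_ok[OF assms(2,3)]
    by (simp add: config_def accepting_M_iff del: ok_state.simps)
qed

lemma not_dead_prefix:
  assumes "macro_steps M C (u1 @ a # u2) c" "macro_steps M C u1 d"
  shows "\<not> dead M d a"
proof -
  obtain e f where "macro_steps M C u1 e" "macro_step M e a f"
    using assms(1) by (auto simp: macro_steps_append macro_steps_Cons)
  then show ?thesis using M.macro_steps_unique[OF assms(2)] M.dead_not_macro_step by blast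
qed

lemma macro_steps_lists: "macro_steps M C u c \<Longrightarrow> u \<in> lists B"
  by (induction rule: macro_steps.induct) (auto dest: macro_step_letter)

lemma language_M: "language M = {u \<in> lists B. \<not> trivial u}"
proof (intro equalityI subsetI)
  fix u assume "u \<in> language M"
  then obtain C c where u: "u \<in> lists B" and C: "entry_config M C" and c: "macro_steps M C u c" "state_of c \<in> accepting M"
    unfolding language_M_iff by blast
  have not_dead: "\<not> blocked C u"
    using not_dead_prefix c(1) by blast
  have "\<not> trivial u"
    using C
  proof (cases rule: entry_config_cases)
    case (top ds)
    have "length (word_of \<one>) < length ds" using top(2) word_of_T[OF one_T] by (auto simp: full_check_def)
    then have "macro_steps M C u (top_config ds (top_position \<one> u))"
      using track_top[OF top(2) one_closed _ u] top(1) not_dead by blast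
    then have "state_of (top_config ds (top_position \<one> u)) \<in> accepting M"
      using c M.macro_steps_unique by blast
    then have "top_position \<one> u \<noteq> \<one>"
      using rep_of_T_eq word_of_T one_T by (auto simp: top_config_def accepting_M_iff)
    then show ?thesis by (simp add: trivial_def)
  next
    case (component w s0 t0 ds' n p0)
    interpret wreath_component K X T S out next_rep H A N B decode w s0 t0 ds' n by (rule component(1))
    obtain q ps where q: "macro_steps N start_N (component position p0 u) (q, ds', ps)" "q \<in> reading N"
      "macro_steps M C u (config (top_position p0 u) q ps)"
      using track[OF component(2,3) u] component(4) not_dead by blast
    have "state_of (config (top_position p0 u) q ps) \<in> accepting M"
      using c q(3) M.macro_steps_unique by blast
    then have "q \<in> accepting N"
      using accepting_config_iff[OF wreath_component_axioms top_position_closed[OF u component(2)] q(2)] by simp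
    then have "component position p0 u \<in> language N"
      unfolding language_N_iff using q(1) entry component_lists[OF u] by fastforce
    then have "word_value H (component position p0 u) \<noteq> \<one>\<^bsub>H\<^esub>"
      unfolding language_N by (simp add: coWP_def)
    \<comment> \<open>The start \<open>p0\<close> may differ from the identity, but the components
      of a trivial word are trivial from every start.\<close>
    then show ?thesis using trivial_component[OF _ u component(2) position_closed] by blast
  next
    case stuck
    have "u = []"
    proof (rule ccontr)
      assume "u \<noteq> []"
      then obtain a u' where "u = [] @ a # u'" by (cases u) auto
      then show False using not_dead stuck(1) macro_steps.refl[of M C] by blast
    qed
    then show ?thesis using c stuck(2) by (simp add: macro_steps_Nil)
  qed
  then show "u \<in> {u \<in> lists B. \<not> trivial u}" using u by simp
next
  fix u assume "u \<in> {u \<in> lists B. \<not> trivial u}"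
  then have u: "u \<in> lists B" and nt: "\<not> trivial u" by auto
  consider (top) "top_position \<one> u \<noteq> \<one>"
    | (component) k where "k \<in> carrier K" "word_value H (component k \<one> u) \<noteq> \<one>\<^bsub>H\<^esub>"
    using nt unfolding trivial_def by blast
  then show "u \<in> language M"
  proof cases
    case top
    \<comment> \<open>Enough padding for all prefixes of \<open>u\<close> at once: the greatest
      length of a position word, plus \<open>max_out\<close> for the letters written in
      between.\<close>
    define n where "n = Max ((\<lambda>i. length (word_of (top_position \<one> (take i u)))) ` {..length u}) + max_out"
    define ds :: "('h, 'k) wsym list" where "ds = [SBot] @ replicate n SPad @ [STop]"
    have ds: "full_check ds" by (auto simp: ds_def full_check_def)
    have bound: "length (word_of (top_position \<one> u1)) + max_out < length ds" if "u = u1 @ u2" for u1 u2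
    proof -
      have "length (word_of (top_position \<one> (take (length u1) u))) \<le>
          Max ((\<lambda>i. length (word_of (top_position \<one> (take i u)))) ` {..length u})"
        using that by (intro Max_ge finite_imageI imageI) auto
      then show ?thesis using that by (simp add: ds_def n_def)
    qed
    have "macro_steps M (top_config ds \<one>) u (top_config ds (top_position \<one> u))"
      using track_top[OF ds one_closed _ u] bound[of "[]" u] bound by fastforce
    moreover have "entry_config M (top_config ds \<one>)"
    proof -
      have "check_prefix None [SBot]" "ok_state (Ready None 0 \<one>)" using one_T by (simp_all add: check_prefix_def)
      moreover have "top_config ds \<one> = (Reading None 0 \<one> (None = None), [SBot] @ replicate n SPad @ [STop], [SBot])"
        using rep_of_T_eq word_of_T one_T by (simp add: top_config_def ds_def)
      ultimately show ?thesis unfolding entry_config_M_iff by blast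
    qed
    moreover have "state_of (top_config ds (top_position \<one> u)) \<in> accepting M"
    proof -
      have p: "top_position \<one> u \<in> carrier K" using top_position_closed[OF u] by simp
      then show ?thesis
        using normal_form_inj[OF p one_closed] top rep_of_T[OF p] word_of_T rep_of_T_eq one_T
        by (auto simp: top_config_def accepting_M_iff)
    qed
    ultimately show ?thesis unfolding language_M_iff using u by blast
  next
    case component
    define w where "w = rev (word_of k)"
    define t0 where "t0 = rep_of k"
    have "component k \<one> u \<in> language N"
      unfolding language_N coWP_def using component component_lists[OF u] by simp
    then obtain C c where C: "entry_config N C" "macro_steps N C (component k \<one> u) c" "state_of c \<in> accepting N"
      unfolding language_N_iff by blast
    obtain q1 d x where q1: "initialises N q1 d" "step N (q1, d, []) x C"
      using C(1) unfolding entry_config_def by blast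
    then obtain s0 where st: "s0 \<in> reading N" "C = (s0, d, [Bottom])"
      using discipline_N unfolding stack_discipline_def by blast
    \<comment> \<open>Condition (P7) for \<open>N\<close>: an entry state does not accept, so
      \<open>s0\<close> may be part of a target.\<close>
    have acc: "s0 \<notin> accepting N"
      using C(1) st(2) unfolding accepting_N entry_states_def by force
    \<comment> \<open>\<open>extent\<close> does not depend on the padding, so the padding can be
      chosen from it without circularity.\<close>
    define n where "n = Max ((\<lambda>i. wreath_component.extent K X T S out w (top_position \<one> (take i u))) ` {..length u})"
    have red: "red (word_of k)" using red_word_of component(1) by blast
    interpret wreath_component K X T S out next_rep H A N B decode w s0 t0 d n
      using red rep_of_T component(1) st acc C(1)
      by unfold_locales (auto simp: w_def t0_def red_def)
    have pos: "position = k"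
      unfolding position_def unfolding w_def t0_def rev_rev_ident
      by (rule normal_form_eq[OF component(1), symmetric])
    have bound: "\<not> n < extent (top_position \<one> u1)" if "u = u1 @ u2" for u1 u2
    proof -
      have "extent (top_position \<one> (take (length u1) u)) \<le> n"
        unfolding n_def using that by (intro Max_ge finite_imageI imageI) auto
      then show ?thesis using that by simp
    qed
    have pd: "pushdown \<one> s0 [Bottom] = [SBot]" using word_of_T one_T by (simp add: pushdown_def)
    have fits: "fits \<one> s0 [Bottom]" by (simp add: fits_def pd length_check)
    have not_dead: "\<not> dead N e h"
      if xy: "component k \<one> u = x @ h # y" and e: "macro_steps N start_N x e" for x h y e
    proof -
      obtain f g where "macro_steps N start_N x f" "macro_step N f h g"
        using C(2) xy st(2) by (auto simp: macro_steps_append macro_steps_Cons)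
      then show ?thesis using N.macro_steps_unique[OF e] N.dead_not_macro_step by blast
    qed
    from track[OF one_closed fits u] obtain q ps where
      q: "macro_steps N start_N (component k \<one> u) (q, d, ps)" "q \<in> reading N"
        "macro_steps M (config \<one> s0 [Bottom]) u (config (top_position \<one> u) q ps)"
      unfolding pos using bound not_dead by blast
    have "macro_steps N start_N (component k \<one> u) c" using C(2) st(2) by simp
    then have "c = (q, d, ps)" by (rule N.macro_steps_unique[OF _ q(1)])
    then have "q \<in> accepting N" using C(3) by simp
    then have acc': "state_of (config (top_position \<one> u) q ps) \<in> accepting M"
      using accepting_config_iff[OF wreath_component_axioms top_position_closed[OF u one_closed] q(2)] by simp
    have "entry_config M (config \<one> s0 [Bottom])"
    proof -
      have "check_prefix (Some mode) (SBot # path w @ map Inner d)"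
        using reduced_w set_w entry by (auto simp: check_prefix_def mode_def)
      moreover have "ok_state (Ready (Some mode) s0 \<one>)" using mode_target st(1) acc one_T by simp
      moreover have "config \<one> s0 [Bottom] =
          (Reading (Some mode) s0 \<one> (Some mode = None), (SBot # path w @ map Inner d) @ replicate n SPad @ [STop], [SBot])"
        using rep_of_T_eq one_T by (simp add: config_def pd check_def)
      ultimately show ?thesis unfolding entry_config_M_iff by blast
    qed
    then show ?thesis unfolding language_M_iff using u q(3) acc' by blast
  qed
qed

text \<open>The configuration of \<open>M\<close> is determined by the position and the
  configuration of \<open>N\<close>. The trivial word \<open>v\<close> restores the position, and
  its component at the target is rejected by \<open>N\<close>, so (P6) for \<open>N\<close> either
  gives equal configurations or a failure of \<open>N\<close>. The latter has to be turned into a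
  failure of \<open>M\<close> or refuted.\<close>

lemma component_stable:
  assumes "wreath_component K X T S out next_rep H A N B decode w s0 t0 ds'"
    and p0: "p0 \<in> carrier K" and fits: "wreath_component.fits K X T w s0 ds' n p0 s0 [Bottom]"
    and C: "C = wreath_component.config K X T w s0 t0 ds' n p0 s0 [Bottom]"
    and u: "u \<in> lists B" and v: "v \<in> lists B" "trivial v"
    and nf: "\<not> config_after_fails M C (u @ v)"
  shows "\<exists>D. macro_steps M C (u @ v) D \<and> macro_steps M C u D"
proof -
  interpret wreath_component K X T S out next_rep H A N B decode w s0 t0 ds' n by (rule assms(1))
  have C_reading: "state_of C \<in> reading M"
    using config_ok[OF p0] s0 by (simp add: C config_def del: ok_state.simps)
  have explicit: "\<exists>q ps. macro_steps N start_N (component position p0 z) (q, ds', ps) \<and> q \<in> reading N \<and>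
      macro_steps M C z (config (top_position p0 z) q ps)"
    if "z \<in> lists B" "\<not> blocked C z" for z
    using track[OF p0 fits that(1)] that(2) unfolding C by blast
  have not_dead: "\<not> blocked C z"
    if "u @ v = z @ z'" for z z'
    using M.config_after_fails_if_dead[OF C_reading] nf that by fastforce
  have uv: "u @ v \<in> lists B" using u v by simp
  obtain q ps where q: "macro_steps N start_N (component position p0 u) (q, ds', ps)"
    "macro_steps M C u (config (top_position p0 u) q ps)"
    using explicit[OF u not_dead] by blast
  obtain q' ps' where q': "macro_steps N start_N (component position p0 (u @ v)) (q', ds', ps')"
    "macro_steps M C (u @ v) (config (top_position p0 (u @ v)) q' ps')"
    using explicit[OF uv not_dead[of "u @ v" "[]"]] by auto
  let ?p = "top_position p0 u"
  have p: "?p \<in> carrier K" using top_position_closed[OF u p0] .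
  have pos: "top_position p0 (u @ v) = ?p"
    using trivial_top_position[OF v(2,1) p] by (simp add: top_position_append)
  define x where "x = component position p0 u"
  define y where "y = component position ?p v"
  have xy: "component position p0 (u @ v) = x @ y" by (simp add: component_append x_def y_def)
  have start_reading: "state_of start_N \<in> reading N" using s0 by simp
  have "y \<notin> language N"
    using trivial_component[OF v(2,1) p position_closed] unfolding language_N coWP_def y_def by simp
  moreover have "x \<in> lists (input_alphabet N)" "y \<in> lists (input_alphabet N)"
    using component_lists u v unfolding input_N x_def y_def by blast+
  ultimately have "(\<exists>D. config_after N start_N (x @ y) D \<and> config_after N start_N x D) \<or>
      config_after_fails N start_N (x @ y)"
    using stable_N entry unfolding stable_under_rejected_def by blast
  then show ?thesis
  proof
    assume "\<exists>D. config_after N start_N (x @ y) D \<and> config_after N start_N x D"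
    then obtain D where "macro_steps N start_N (x @ y) D" "macro_steps N start_N x D"
      unfolding N.config_after_iff[OF start_reading] by blast
    then have "(q, ds', ps) = (q', ds', ps')"
      using N.macro_steps_unique q(1) q'(1) unfolding xy x_def[symmetric] by metis
    then show ?thesis using q(2) q'(2) pos by auto
  next
    assume "config_after_fails N start_N (x @ y)"
    then show ?thesis
      using start_reading
    proof (cases rule: N.config_after_failsE)
      case (failing x1 x2 c)
      \<comment> \<open>\<open>N\<close> fails after \<open>x1\<close>; accordingly \<open>M\<close>
        is examined after a prefix \<open>z\<close> of its own input whose component is
        \<open>x1\<close>.\<close>
      obtain z z' where z: "u @ v = z @ z'" "component position p0 z = x1"
        using component_prefix[of position p0 "u @ v" x1 x2] xy failing(1) by auto
      have zB: "z \<in> lists B" using uv z(1) by simp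
      obtain q1 ps1 where q1: "macro_steps N start_N x1 (q1, ds', ps1)" "q1 \<in> reading N"
        "macro_steps M C z (config (top_position p0 z) q1 ps1)"
        using explicit[OF zB not_dead[OF z(1)]] z(2) by blast
      have c: "c = (q1, ds', ps1)" using N.macro_steps_unique failing(2) q1(1) by blast
      have pz: "top_position p0 z \<in> carrier K" using top_position_closed[OF zB p0] .
      have "failing M (config (top_position p0 z) q1 ps1)"
        unfolding failing_def
      proof (intro conjI notI; (elim exE conjE)?)
        have "q1 \<notin> accepting N" using failing(3) c by (simp add: failing_def)
        then have "state_of (config (top_position p0 z) q1 ps1) \<notin> accepting M"
          using accepting_config_iff[OF wreath_component_axioms pz q1(2), of n ps1] by simp
        moreover have "state_of (config (top_position p0 z) q1 ps1) \<in> reading M"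
          using config_ok[OF pz q1(2)] by (simp add: config_def del: ok_state.simps)
        ultimately show "state_of (config (top_position p0 z) q1 ps1) \<in> reading M - accepting M"
          by blast
      next
        \<comment> \<open>An accepting continuation of \<open>M\<close> would project to an
          accepting continuation of \<open>N\<close> from the failing configuration
          \<open>c\<close>.\<close>
        fix z2 c' assume r: "run M (config (top_position p0 z) q1 ps1) z2 c'" "state_of c' \<in> accepting M"
        have "state_of c' \<in> reading M" using r(2) accepting_reading_M by blast
        moreover have "state_of (config (top_position p0 z) q1 ps1) \<in> reading M"
          using config_ok[OF pz q1(2)] by (simp add: config_def del: ok_state.simps)
        ultimately have "macro_steps M (config (top_position p0 z) q1 ps1) z2 c'"
          using r(1) M.run_reading_iff by blast
        then have ms: "macro_steps M C (z @ z2) c'" using q1(3) by (auto simp: macro_steps_append)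
        then have zz: "z @ z2 \<in> lists B" by (rule macro_steps_lists)
        have "\<not> (\<exists>u1 a u2 c. z @ z2 = u1 @ a # u2 \<and> macro_steps M C u1 c \<and> dead M c a)"
          using not_dead_prefix ms by metis
        then obtain q2 ps2 where q2: "macro_steps N start_N (component position p0 (z @ z2)) (q2, ds', ps2)"
          "q2 \<in> reading N" "macro_steps M C (z @ z2) (config (top_position p0 (z @ z2)) q2 ps2)"
          using explicit[OF zz] by blast
        have "c' = config (top_position p0 (z @ z2)) q2 ps2" using M.macro_steps_unique ms q2(3) by blast
        then have "q2 \<in> accepting N"
          using accepting_config_iff[OF wreath_component_axioms top_position_closed[OF zz p0] q2(2)] r(2) by simp
        moreover have "\<exists>y2. macro_steps N c y2 (q2, ds', ps2)"
          using q2(1) z(2) N.macro_steps_unique[OF failing(2)]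
          by (auto simp: component_append macro_steps_append)
        ultimately show False
          using failing(3) macro_steps_run unfolding failing_def by fastforce
      qed
      then have "config_after_fails M C (u @ v)"
        using M.config_after_fails_if_failing[OF q1(3)] z(1) by simp
      then show ?thesis using nf by simp
    next
      \<comment> \<open>\<open>M\<close> has processed all of \<open>u @ v\<close>, and with it
        \<open>N\<close> all of \<open>x @ y\<close>, so \<open>N\<close> cannot have blocked on the
        way.\<close>
      case (dead x1 h x2 c)
      obtain e f where "macro_steps N start_N x1 e" "macro_step N e h f"
        using q'(1) unfolding xy dead(1) by (auto simp: macro_steps_append macro_steps_Cons)
      then show ?thesis
        using N.macro_steps_unique[OF dead(2)] N.dead_not_macro_step[OF dead(3)] by blast
    qed
  qed
qed

lemma stable_under_rejected_M: "stable_under_rejected M"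
  unfolding stable_under_rejected_def M_sel
proof (intro allI ballI impI)
  fix C u v
  assume u: "u \<in> lists B" and v: "v \<in> lists B" and C: "entry_config M C" and rej: "v \<notin> language M"
  have C_reading: "state_of C \<in> reading M" using entry_config_reading[OF C] .
  have triv: "trivial v" using rej v language_M by blast
  show "(\<exists>D. config_after M C (u @ v) D \<and> config_after M C u D) \<or> config_after_fails M C (u @ v)"
    unfolding M.config_after_iff[OF C_reading]
  proof (rule disjCI)
    assume nf: "\<not> config_after_fails M C (u @ v)"
    have not_dead: "\<not> blocked C z"
      if "u @ v = z @ z'" for z z'
      using M.config_after_fails_if_dead[OF C_reading] nf that by fastforce
    show "\<exists>D. macro_steps M C (u @ v) D \<and> macro_steps M C u D"
      using C
    proof (cases rule: entry_config_cases)
      case (top ds)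
      have len: "length (word_of \<one>) < length ds" using top(2) word_of_T[OF one_T] by (auto simp: full_check_def)
      have explicit: "macro_steps M C z (top_config ds (top_position \<one> z))"
        if "z \<in> lists B" "u @ v = z @ z'" for z z'
        using track_top[OF top(2) one_closed len that(1)] not_dead[OF that(2)] top(1) by blast
      have "top_position \<one> (u @ v) = top_position \<one> u"
        using trivial_top_position[OF triv v top_position_closed[OF u one_closed]]
        by (simp add: top_position_append)
      then show ?thesis using explicit[of "u @ v" "[]"] explicit[of u v] u v by auto
    next
      case (component w s0 t0 ds' n p0)
      show ?thesis by (rule component_stable[OF component u v triv nf])
    next
      case stuck
      have "u @ v = []"
      proof (rule ccontr)
        assume "u @ v \<noteq> []"
        then obtain a z where "u @ v = [] @ a # z" by (cases "u @ v") auto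
        then show False using not_dead[OF append_Nil2[symmetric]] stuck(1) macro_steps.refl[of M C] by blast
      qed
      then show ?thesis by (auto intro: macro_steps.refl)
    qed
  qed
qed

end

section \<open>Renaming states and stack symbols\<close>

text \<open>Special co-ET0L groups are defined with fixed types of states and symbols, into which
  the automaton has to be transported. The set \<open>E\<close> adds symbols that the alphabets are
  required to contain.\<close>

definition map_cspda ::
  "('q \<Rightarrow> 'r) \<Rightarrow> ('s \<Rightarrow> 't) \<Rightarrow> 't set \<Rightarrow> ('q, 'a, 's) cspda \<Rightarrow> ('r, 'a, 't) cspda" where
  "map_cspda f g E M = \<lparr>states = f ` states M, initial = f (initial M), accepting = f ` accepting M,
     reading = f ` reading M, input_alphabet = input_alphabet M,
     check_alphabet = g ` check_alphabet M \<union> E, pushdown_alphabet = g ` pushdown_alphabet M \<union> E,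
     init_transitions = (\<lambda>(q, s, q'). (f q, g s, f q')) ` init_transitions M,
     transitions = (\<lambda>(q, x, v, m, q'). (f q, x, map_option (map_prod g g) v, map_stack_move g m, f q')) `
       transitions M\<rparr>"

locale cspda_renaming =
  fixes M :: "('q, 'a, 's) cspda" and f :: "'q \<Rightarrow> 'r" and g :: "'s \<Rightarrow> 't" and E :: "'t set"
  assumes cspda: "cspda M" and inj_f: "inj_on f (states M)"
    and inj_g: "inj_on g (check_alphabet M \<union> pushdown_alphabet M)" and finite_E: "finite E"
begin

abbreviation "M' \<equiv> map_cspda f g E M"

definition rename :: "('q, 's) config \<Rightarrow> ('r, 't) config" where
  "rename c = (case c of (q, ds, ps) \<Rightarrow> (f q, map g ds, map g ps))"

text \<open>The renamings are injective only on the states and alphabets, and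
  \<open>head_view\<close> indexes into the check stack. Within these bounds renaming commutes with
  what the head sees; all reachable configurations obey them.\<close>

definition wf :: "('q, 's) config \<Rightarrow> bool" where
  "wf c \<longleftrightarrow> (case c of (q, ds, ps) \<Rightarrow> q \<in> states M \<and> set ds \<subseteq> check_alphabet M \<and>
     set ps \<subseteq> pushdown_alphabet M \<and> length ps \<le> length ds)"

lemma transition_closed:
  assumes "(q, x, v, m, q') \<in> transitions M"
  shows "q \<in> states M" "q' \<in> states M" "set_option x \<subseteq> input_alphabet M"
    "set_option v \<subseteq> pushdown_alphabet M \<times> check_alphabet M" "set_stack_move m \<subseteq> pushdown_alphabet M"
proof -
  have "\<forall>(q, x, v, m, q') \<in> transitions M. q \<in> states M \<and> q' \<in> states M \<and> set_option x \<subseteq> input_alphabet M \<and>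
      set_option v \<subseteq> pushdown_alphabet M \<times> check_alphabet M \<and> set_stack_move m \<subseteq> pushdown_alphabet M"
    using cspda unfolding cspda_def by blast
  from bspec[OF this assms] show "q \<in> states M" "q' \<in> states M" "set_option x \<subseteq> input_alphabet M"
    "set_option v \<subseteq> pushdown_alphabet M \<times> check_alphabet M" "set_stack_move m \<subseteq> pushdown_alphabet M"
    by auto
qed

lemma init_closed:
  assumes "(q, s, q') \<in> init_transitions M"
  shows "q \<in> states M" "s \<in> check_alphabet M" "q' \<in> states M"
  using assms cspda unfolding cspda_def by blast+

lemma states_closed: "initial M \<in> states M" "reading M \<subseteq> states M" "accepting M \<subseteq> states M"
  using cspda by (auto simp: cspda_def)

lemma f_eq: "q \<in> states M \<Longrightarrow> q' \<in> states M \<Longrightarrow> f q = f q' \<longleftrightarrow> q = q'"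
  using inj_f by (auto dest: inj_onD)

lemma f_mem: "q \<in> states M \<Longrightarrow> Q \<subseteq> states M \<Longrightarrow> f q \<in> f ` Q \<longleftrightarrow> q \<in> Q"
  using inj_on_image_mem_iff[OF inj_f] .

lemma view_eq:
  assumes "set_option v \<subseteq> pushdown_alphabet M \<times> check_alphabet M"
    "set_option v' \<subseteq> pushdown_alphabet M \<times> check_alphabet M"
    "map_option (map_prod g g) v = map_option (map_prod g g) v'"
  shows "v = v'"
  using assms inj_g by (cases v; cases v') (auto dest: inj_onD)

lemma map_cspda_sel [simp]:
  "states M' = f ` states M" "initial M' = f (initial M)" "accepting M' = f ` accepting M"
  "reading M' = f ` reading M" "input_alphabet M' = input_alphabet M"
  "check_alphabet M' = g ` check_alphabet M \<union> E" "pushdown_alphabet M' = g ` pushdown_alphabet M \<union> E"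
  by (simp_all add: map_cspda_def)

lemma map_transition_iff: "(r, x, v', m', r') \<in> transitions M' \<longleftrightarrow>
    (\<exists>q v m q'. (q, x, v, m, q') \<in> transitions M \<and> r = f q \<and> v' = map_option (map_prod g g) v \<and>
       m' = map_stack_move g m \<and> r' = f q')"
  unfolding map_cspda_def by force

lemma map_init_iff: "(r, s', r') \<in> init_transitions M' \<longleftrightarrow>
    (\<exists>q s q'. (q, s, q') \<in> init_transitions M \<and> r = f q \<and> s' = g s \<and> r' = f q')"
  unfolding map_cspda_def by force

lemma initialises_closed: "initialises M q ds \<Longrightarrow> q \<in> states M \<and> set ds \<subseteq> check_alphabet M"
  by (induction rule: initialises.induct) (auto dest: init_closed simp: states_closed)

lemma initialises_wf: "initialises M q ds \<Longrightarrow> wf (q, ds, [])"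
  using initialises_closed by (simp add: wf_def)

lemma initialises_map: "initialises M q ds \<Longrightarrow> initialises M' (f q) (map g ds)"
proof (induction rule: initialises.induct)
  case start
  then show ?case using initialises.start[of M'] by simp
next
  case (push q ds s q')
  then show ?case using initialises.push[of M' "f q" "map g ds" "g s" "f q'"] by (auto simp: map_init_iff)
qed

lemma initialises_mapD:
  "initialises M' r es \<Longrightarrow> \<exists>q ds. r = f q \<and> es = map g ds \<and> initialises M q ds"
proof (induction rule: initialises.induct)
  case start
  then show ?case using initialises.start[of M] by (auto intro!: exI[of _ "initial M"])
next
  case (push r es s' r')
  then obtain q ds q1 s q' where *: "r = f q" "es = map g ds" "initialises M q ds"
    "(q1, s, q') \<in> init_transitions M" "r = f q1" "s' = g s" "r' = f q'"
    unfolding map_init_iff by blast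
  \<comment> \<open>The renamed transition might stem from another preimage of \<open>r\<close>;
    injectivity on the states excludes this.\<close>
  have "q1 = q" using * f_eq init_closed(1)[OF *(4)] initialises_closed[OF *(3)] by metis
  then have "initialises M q' (ds @ [s])" using initialises.push[OF *(3)] *(4) by simp
  moreover have "es @ [s'] = map g (ds @ [s])" using * by simp
  ultimately show ?case using *(7) by blast
qed

lemma head_view_map:
  "length ps \<le> length ds \<Longrightarrow> head_view (map g ds) (map g ps) = map_option (map_prod g g) (head_view ds ps)"
  by (cases ps) auto

lemma head_view_closed:
  "wf (q, ds, ps) \<Longrightarrow> set_option (head_view ds ps) \<subseteq> pushdown_alphabet M \<times> check_alphabet M"
proof (cases ps)
  case (Cons s ps')
  assume "wf (q, ds, ps)"
  then have "length ps' < length ds" "set ds \<subseteq> check_alphabet M" "s \<in> pushdown_alphabet M"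
    using Cons by (auto simp: wf_def)
  then show ?thesis using Cons nth_mem by auto
qed simp

lemma step_wf: "step M c x c' \<Longrightarrow> wf c \<Longrightarrow> wf c'"
  by (erule step.cases) (auto simp: wf_def dest: transition_closed(2,5))

lemma step_map:
  assumes "step M c x c'" "wf c"
  shows "step M' (rename c) x (rename c')"
  using assms(1)
proof (cases rule: step.cases)
  case (keep q ds ps q')
  then have "(f q, x, head_view (map g ds) (map g ps), Keep, f q') \<in> transitions M'"
    using assms(2) head_view_map[of ps ds] by (fastforce simp: wf_def map_transition_iff)
  then show ?thesis using keep step.keep[of "f q" x "map g ds" "map g ps" "f q'" M'] by (simp add: rename_def)
next
  case (push q ds ps s q')
  then have "(f q, x, head_view (map g ds) (map g ps), Push (g s), f q') \<in> transitions M'"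
    using assms(2) head_view_map[of ps ds] by (fastforce simp: wf_def map_transition_iff)
  then show ?thesis using push step.push[of "f q" x "map g ds" "map g ps" "g s" "f q'" M'] by (simp add: rename_def)
next
  case (pop q ds s ps q')
  then have "(f q, x, head_view (map g ds) (map g (s # ps)), Pop, f q') \<in> transitions M'"
    using assms(2) head_view_map[of "s # ps" ds] by (fastforce simp: wf_def map_transition_iff)
  then show ?thesis using pop step.pop[of "f q" x "map g ds" "g s" "map g ps" "f q'" M'] by (simp add: rename_def)
qed

lemma transition_mapD:
  assumes "(f q, x, head_view (map g ds) (map g ps), m', r') \<in> transitions M'" "wf (q, ds, ps)"
  obtains m q' where "(q, x, head_view ds ps, m, q') \<in> transitions M" "m' = map_stack_move g m" "r' = f q'"
proof -
  obtain q1 v m q' where *: "(q1, x, v, m, q') \<in> transitions M" "f q = f q1"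
    "map_option (map_prod g g) (head_view ds ps) = map_option (map_prod g g) v"
    "m' = map_stack_move g m" "r' = f q'"
    using assms head_view_map[of ps ds] by (auto simp: map_transition_iff wf_def)
  have "q1 = q" using *(2) f_eq transition_closed(1)[OF *(1)] assms(2) by (auto simp: wf_def)
  moreover have "v = head_view ds ps"
    using view_eq[OF transition_closed(4)[OF *(1)] head_view_closed[OF assms(2)]] *(3) by simp
  ultimately show thesis using that * by blast
qed

text \<open>Renaming creates no further steps. The conditions that deny something depend on this
  direction: being stuck, failing, and the absence of infinite silent runs.\<close>

lemma step_mapD:
  assumes "step M' (rename c) x d" "wf c"
  shows "\<exists>c'. d = rename c' \<and> step M c x c'"
proof -
  obtain q ds ps where c: "c = (q, ds, ps)" by (cases c) auto
  have r: "rename c = (f q, map g ds, map g ps)" by (simp add: c rename_def)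
  note wf = assms(2)[unfolded c]
  from assms(1)[unfolded r] show ?thesis
  proof (cases rule: step.cases)
    case (keep r')
    obtain m q' where m: "(q, x, head_view ds ps, m, q') \<in> transitions M" "Keep = map_stack_move g m" "r' = f q'"
      using transition_mapD[OF keep(2) wf] .
    then have "m = Keep" by (cases m) auto
    then show ?thesis using m keep step.keep[of q x ds ps q' M] unfolding c
      by (intro exI[of _ "(q', ds, ps)"]) (simp add: rename_def)
  next
    case (push s' r')
    obtain m q' where m: "(q, x, head_view ds ps, m, q') \<in> transitions M" "Push s' = map_stack_move g m" "r' = f q'"
      using transition_mapD[OF push(2) wf] .
    then obtain s where "m = Push s" "s' = g s" by (cases m) auto
    then show ?thesis using m push step.push[of q x ds ps s q' M] unfolding c
      by (intro exI[of _ "(q', ds, s # ps)"]) (simp add: rename_def)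
  next
    case (pop s' ps' r')
    have "(f q, x, head_view (map g ds) (map g ps), Pop, r') \<in> transitions M'"
      using pop(3) unfolding pop(1) .
    then obtain m q' where m: "(q, x, head_view ds ps, m, q') \<in> transitions M" "Pop = map_stack_move g m" "r' = f q'"
      using transition_mapD[OF _ wf] by blast
    then have "m = Pop" by (cases m) auto
    moreover have "ps \<noteq> []" using pop(1) by auto
    ultimately have "step M (q, ds, ps) x (q', ds, tl ps)" using m(1) step_popI by metis
    moreover have "d = rename (q', ds, tl ps)" using pop m(3) by (simp add: rename_def map_tl)
    ultimately show ?thesis unfolding c by blast
  qed
qed

lemma run_wf: "run M c w d \<Longrightarrow> wf c \<Longrightarrow> wf d"
  by (induction rule: run.induct) (auto intro: step_wf)

lemma run_map: "run M c w d \<Longrightarrow> wf c \<Longrightarrow> run M' (rename c) w (rename d)"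
proof (induction rule: run.induct)
  case (refl c)
  show ?case by (rule run.refl)
next
  case (silent c c' w c'')
  then show ?case using step_map step_wf run.silent by metis
next
  case (letter c a c' w c'')
  then show ?case using step_map step_wf run.letter by metis
qed

lemma run_mapD: "run M' r w e \<Longrightarrow> r = rename c \<Longrightarrow> wf c \<Longrightarrow> \<exists>d. e = rename d \<and> run M c w d"
proof (induction arbitrary: c rule: run.induct)
  case (refl r)
  then show ?case using run.refl by blast
next
  case (silent r r' w r'')
  then obtain c' where c': "r' = rename c'" "step M c None c'" using step_mapD by blast
  then obtain d where "r'' = rename d" "run M c' w d" using silent step_wf by blast
  then show ?case using run.silent[OF c'(2)] by blast
next
  case (letter r a r' w r'')
  then obtain c' where c': "r' = rename c'" "step M c (Some a) c'" using step_mapD by blast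
  then obtain d where "r'' = rename d" "run M c' w d" using letter step_wf by blast
  then show ?case using run.letter[OF c'(2)] by blast
qed

lemma state_of_rename: "state_of (rename c) = f (state_of c)"
  by (cases c) (simp add: rename_def)

lemma reading_rename: "wf c \<Longrightarrow> state_of (rename c) \<in> reading M' \<longleftrightarrow> state_of c \<in> reading M"
  and accepting_rename: "wf c \<Longrightarrow> state_of (rename c) \<in> accepting M' \<longleftrightarrow> state_of c \<in> accepting M"
  using f_mem states_closed by (auto simp: state_of_rename wf_def split: prod.splits)

lemma first_reading_map: "first_reading M c d \<Longrightarrow> wf c \<Longrightarrow> first_reading M' (rename c) (rename d)"
proof (induction rule: first_reading.induct)
  case (here c)
  then show ?case using reading_rename first_reading.here by metis
next
  case (later c c' c'')
  then show ?case using reading_rename step_map step_wf first_reading.later by metis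
qed

lemma can_step_rename: "wf c \<Longrightarrow> (\<exists>d. step M' (rename c) x d) \<longleftrightarrow> (\<exists>c'. step M c x c')"
  using step_map step_mapD by blast

lemma failing_rename: "wf c \<Longrightarrow> failing M c \<Longrightarrow> failing M' (rename c)"
  unfolding failing_def using reading_rename accepting_rename run_mapD run_wf by (metis Diff_iff)

lemma stuck_rename: "wf c \<Longrightarrow> stuck M c v \<Longrightarrow> stuck M' (rename c) v"
  unfolding stuck_def using can_step_rename by blast

lemma config_after_map:
  assumes "config_after M c w d" "wf c"
  shows "config_after M' (rename c) w (rename d)"
proof (cases "w = []")
  case True
  then show ?thesis using assms by (simp add: config_after_def)
next
  case False
  then obtain c1 c2 where *: "run M c (butlast w) c1" "step M c1 (Some (last w)) c2" "first_reading M c2 d"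
    using assms(1) by (auto simp: config_after_def)
  have wf1: "wf c1" using run_wf[OF *(1) assms(2)] .
  show ?thesis
    using False run_map[OF *(1) assms(2)] step_map[OF *(2) wf1] first_reading_map[OF *(3) step_wf[OF *(2) wf1]]
    unfolding config_after_def by auto
qed

lemma config_after_fails_map:
  assumes "config_after_fails M c w" "wf c"
  shows "config_after_fails M' (rename c) w"
proof -
  obtain u v d where *: "w = u @ v" "run M c u d"
    "failing M d \<or> stuck M d v \<and> \<not> (v = [] \<and> state_of d \<in> reading M)"
    using assms(1) unfolding config_after_fails_def by blast
  have "wf d" using run_wf[OF *(2) assms(2)] .
  then have "failing M' (rename d) \<or> stuck M' (rename d) v \<and> \<not> (v = [] \<and> state_of (rename d) \<in> reading M')"
    using *(3) failing_rename stuck_rename reading_rename by blast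
  then show ?thesis unfolding config_after_fails_def using *(1) run_map[OF *(2) assms(2)] by blast
qed

lemma entry_config_mapD:
  assumes "entry_config M' d"
  shows "\<exists>c. d = rename c \<and> entry_config M c \<and> wf c"
proof -
  obtain r es x where "initialises M' r es" "step M' (r, es, []) x d"
    using assms unfolding entry_config_def by blast
  then obtain q ds where q: "initialises M q ds" "step M' (rename (q, ds, [])) x d"
    using initialises_mapD[of r es] by (auto simp: rename_def)
  then obtain c where "d = rename c" "step M (q, ds, []) x c"
    using step_mapD initialises_wf by blast
  then show ?thesis using q(1) initialises_wf step_wf unfolding entry_config_def by blast
qed

lemma entry_config_map: "entry_config M c \<Longrightarrow> entry_config M' (rename c)"
proof -
  assume "entry_config M c"
  then obtain q ds x where q: "initialises M q ds" "step M (q, ds, []) x c" unfolding entry_config_def by blast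
  have "step M' (rename (q, ds, [])) x (rename c)" using step_map[OF q(2) initialises_wf[OF q(1)]] .
  then show ?thesis using initialises_map[OF q(1)] unfolding entry_config_def rename_def by auto
qed

lemma entry_states_map: "entry_states M' = f ` entry_states M"
proof
  show "entry_states M' \<subseteq> f ` entry_states M"
  proof
    fix r assume "r \<in> entry_states M'"
    then obtain d where "r = state_of d" "entry_config M' d" unfolding entry_states_def by blast
    then show "r \<in> f ` entry_states M" using entry_config_mapD state_of_rename unfolding entry_states_def by blast
  qed
  show "f ` entry_states M \<subseteq> entry_states M'"
  proof
    fix r assume "r \<in> f ` entry_states M"
    then obtain c where c: "r = f (state_of c)" "entry_config M c"
      unfolding entry_states_def by blast
    then have "r = state_of (rename c)" by (simp add: state_of_rename)
    with c show "r \<in> entry_states M'" using entry_config_map unfolding entry_states_def by blast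
  qed
qed

lemma second_stage_reachable_mapD:
  assumes "second_stage_reachable M' w d"
  shows "\<exists>c. d = rename c \<and> second_stage_reachable M w c \<and> wf c"
proof -
  obtain r es where "initialises M' r es" "run M' (r, es, []) w d"
    using assms unfolding second_stage_reachable_def by blast
  then obtain q ds where q: "initialises M q ds" "run M' (rename (q, ds, [])) w d"
    using initialises_mapD[of r es] by (auto simp: rename_def)
  then obtain c where "d = rename c" "run M (q, ds, []) w c"
    using run_mapD initialises_wf by blast
  then show ?thesis using q(1) initialises_wf run_wf unfolding second_stage_reachable_def by blast
qed

lemma second_stage_reachable_map:
  "second_stage_reachable M w c \<Longrightarrow> second_stage_reachable M' w (rename c) \<and> wf c"
proof -
  assume "second_stage_reachable M w c"
  then obtain q ds where q: "initialises M q ds" "run M (q, ds, []) w c" unfolding second_stage_reachable_def by blast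
  have "run M' (rename (q, ds, [])) w (rename c)" using run_map[OF q(2) initialises_wf[OF q(1)]] .
  then show ?thesis using initialises_map[OF q(1)] run_wf[OF q(2) initialises_wf[OF q(1)]]
    unfolding second_stage_reachable_def rename_def by auto
qed

lemma language_map: "language M' = language M"
proof (rule Set.set_eqI)
  fix w
  have "(\<exists>d. second_stage_reachable M' w d \<and> state_of d \<in> accepting M') \<longleftrightarrow>
      (\<exists>c. second_stage_reachable M w c \<and> state_of c \<in> accepting M)"
    using second_stage_reachable_mapD second_stage_reachable_map accepting_rename by metis
  then show "w \<in> language M' \<longleftrightarrow> w \<in> language M" by (simp add: language_def)
qed

lemma cspda_map: "cspda M'"
proof -
  have init: "q \<in> f ` states M \<and> s \<in> g ` check_alphabet M \<union> E \<and> q' \<in> f ` states M" if "(q, s, q') \<in> init_transitions M'" for q s q'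
    using that init_closed unfolding map_init_iff by blast
  have trans: "r \<in> f ` states M \<and> r' \<in> f ` states M \<and> set_option x \<subseteq> input_alphabet M \<and>
      set_option v' \<subseteq> (g ` pushdown_alphabet M \<union> E) \<times> (g ` check_alphabet M \<union> E) \<and>
      set_stack_move m' \<subseteq> g ` pushdown_alphabet M \<union> E" if tr: "(r, x, v', m', r') \<in> transitions M'" for r x v' m' r'
  proof -
    obtain q v m q' where *: "(q, x, v, m, q') \<in> transitions M" "r = f q" "v' = map_option (map_prod g g) v"
      "m' = map_stack_move g m" "r' = f q'" using tr unfolding map_transition_iff by blast
    show ?thesis using transition_closed[OF *(1)] *(2-5)
      by (cases v; cases m) auto
  qed
  have "init_transitions M' \<subseteq> f ` states M \<times> (g ` check_alphabet M \<union> E) \<times> f ` states M"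
    using init by auto
  moreover have "\<forall>(r, x, v', m', r') \<in> transitions M'. r \<in> f ` states M \<and> r' \<in> f ` states M \<and>
      set_option x \<subseteq> input_alphabet M \<and>
      set_option v' \<subseteq> (g ` pushdown_alphabet M \<union> E) \<times> (g ` check_alphabet M \<union> E) \<and>
      set_stack_move m' \<subseteq> g ` pushdown_alphabet M \<union> E"
    using trans by blast
  moreover have "finite (states M)" "finite (input_alphabet M)" "finite (check_alphabet M)" "finite (pushdown_alphabet M)"
    using cspda by (auto simp: cspda_def)
  ultimately show ?thesis
    unfolding cspda_def map_cspda_sel
    by (intro conjI finite_UnI finite_imageI image_mono imageI finite_E states_closed)
qed

lemma reading_dichotomy_map:
  assumes "reading_dichotomy M"
  shows "reading_dichotomy M'"
proof -
  have "r \<notin> f ` reading M" if tr: "(r, s, r') \<in> init_transitions M'" for r s r'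
  proof -
    obtain q s1 q' where *: "(q, s1, q') \<in> init_transitions M" "r = f q" using tr unfolding map_init_iff by blast
    then have "q \<notin> reading M" using assms unfolding reading_dichotomy_def by blast
    then show ?thesis using f_mem[OF init_closed(1)[OF *(1)] states_closed(2)] *(2) by simp
  qed
  moreover have "r \<in> f ` reading M \<longleftrightarrow> x \<noteq> None" if tr: "(r, x, v', m', r') \<in> transitions M'" for r x v' m' r'
  proof -
    obtain q v m q' where *: "(q, x, v, m, q') \<in> transitions M" "r = f q" using tr unfolding map_transition_iff by blast
    then have "q \<in> reading M \<longleftrightarrow> x \<noteq> None" using assms unfolding reading_dichotomy_def by blast
    then show ?thesis using f_mem[OF transition_closed(1)[OF *(1)] states_closed(2)] *(2) by simp
  qed
  ultimately show ?thesis unfolding reading_dichotomy_def map_cspda_sel by blast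
qed

lemma deterministic_map:
  assumes "deterministic M"
  shows "deterministic M'"
  unfolding deterministic_def
proof (intro allI impI)
  fix r v' m1 p1 x x' m2 p2
  assume "(r, x, v', m1, p1) \<in> transitions M'" "(r, x', v', m2, p2) \<in> transitions M'"
    and x: "x = x' \<or> x = None \<or> x' = None"
  then obtain q v m q' q2 v2 mm q2' where
    *: "(q, x, v, m, q') \<in> transitions M" "r = f q" "v' = map_option (map_prod g g) v" "m1 = map_stack_move g m" "p1 = f q'"
    "(q2, x', v2, mm, q2') \<in> transitions M" "r = f q2" "v' = map_option (map_prod g g) v2" "m2 = map_stack_move g mm" "p2 = f q2'"
    unfolding map_transition_iff by blast
  have "q2 = q" using f_eq transition_closed(1) * by metis
  moreover have "v2 = v" using view_eq transition_closed(4) * by metis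
  ultimately have "(x, m, q') = (x', mm, q2')"
    using assms *(1,6) x unfolding deterministic_def by blast
  then show "(x, m1, p1) = (x', m2, p2)" using * by simp
qed

lemma no_infinite_silent_run_map:
  assumes "no_infinite_silent_run M"
  shows "no_infinite_silent_run M'"
  unfolding no_infinite_silent_run_def
proof (intro notI, elim exE conjE)
  fix w and h :: "nat \<Rightarrow> _"
  assume r: "second_stage_reachable M' w (h 0)" and s: "\<forall>i. step M' (h i) None (h (Suc i))"
  obtain c0 where c0: "h 0 = rename c0" "second_stage_reachable M w c0" "wf c0"
    using second_stage_reachable_mapD[OF r] by blast
  \<comment> \<open>The silent sequence of \<open>M'\<close> is lifted one step at a time, since
    each lifted configuration is found by \<open>step_mapD\<close> from the previous one.\<close>
  have "\<exists>k. \<forall>i::nat. (wf (k i) \<and> h i = rename (k i) \<and> (i = 0 \<longrightarrow> k i = c0)) \<and> step M (k i) None (k (Suc i))"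
  proof (rule dependent_nat_choice[where P = "\<lambda>i c. wf c \<and> h i = rename c \<and> (i = 0 \<longrightarrow> c = c0)"
        and Q = "\<lambda>i c c'. step M c None c'"])
    show "\<exists>c. wf c \<and> h 0 = rename c \<and> (0 = 0 \<longrightarrow> c = c0)" using c0 by blast
  next
    fix c n assume c: "wf c \<and> h n = rename c \<and> (n = 0 \<longrightarrow> c = c0)"
    have "step M' (rename c) None (h (Suc n))" using s c by metis
    then obtain c' where "h (Suc n) = rename c'" "step M c None c'" using step_mapD c by blast
    then show "\<exists>c'. (wf c' \<and> h (Suc n) = rename c' \<and> (Suc n = 0 \<longrightarrow> c' = c0)) \<and> step M c None c'"
      using c step_wf by blast
  qed
  then obtain k where k: "k (0::nat) = c0" "\<And>i. step M (k i) None (k (Suc i))" by blast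
  then show False using assms c0(2) unfolding no_infinite_silent_run_def by metis
qed

lemma stable_under_rejected_map:
  assumes "stable_under_rejected M"
  shows "stable_under_rejected M'"
  unfolding stable_under_rejected_def
proof (intro allI ballI impI)
  fix C u v assume "u \<in> lists (input_alphabet M')" "v \<in> lists (input_alphabet M')" "entry_config M' C" "v \<notin> language M'"
  then have *: "u \<in> lists (input_alphabet M)" "v \<in> lists (input_alphabet M)" "v \<notin> language M"
    by (simp_all add: language_map)
  obtain c where c: "C = rename c" "entry_config M c" "wf c" using entry_config_mapD \<open>entry_config M' C\<close> by blast
  have "(\<exists>d. config_after M c (u @ v) d \<and> config_after M c u d) \<or> config_after_fails M c (u @ v)"
    using assms * c(2) unfolding stable_under_rejected_def by blast
  then show "(\<exists>D. config_after M' C (u @ v) D \<and> config_after M' C u D) \<or> config_after_fails M' C (u @ v)"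
    using config_after_map config_after_fails_map c(1,3) by blast
qed

end

text \<open>The stack discipline is the condition that names particular symbols. It is therefore
  assumed for the preimages \<open>b\<close> and \<open>t\<close> of \<open>Bottom\<close> and
  \<open>Top\<close>, whereas the other conditions are simply transported.\<close>

lemma special_map_cspda:
  fixes M :: "('q, 'a, 's) cspda" and g :: "'s \<Rightarrow> 'a stack_symbol"
  assumes "cspda_renaming M f g E" and E: "{Bottom, Padding, Top} \<subseteq> E"
    and special: "reading_dichotomy M" "deterministic M" "no_infinite_silent_run M" "accepting M \<subseteq> reading M"
      "stable_under_rejected M" "accepting M = reading M - entry_states M"
    and g: "\<And>s. g s = Bottom \<longleftrightarrow> s = b" "\<And>s. g s = Top \<longleftrightarrow> s = t"
    and init: "\<And>q ds. initialises M q ds \<Longrightarrow> b \<notin> set (tl ds) \<and> t \<notin> set (butlast ds)"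
    and first_step: "\<And>q ds x c. initialises M q ds \<Longrightarrow> step M (q, ds, []) x c \<Longrightarrow>
        ds \<noteq> [] \<and> hd ds = b \<and> last ds = t \<and> x = None \<and> (\<exists>q' \<in> reading M. c = (q', ds, [b]))"
    and moves: "\<And>q x s d m q'. (q, x, Some (s, d), m, q') \<in> transitions M \<Longrightarrow>
        m \<noteq> Push b \<and> m \<noteq> Push t \<and> (s = b \<longrightarrow> m \<noteq> Pop) \<and> (d = t \<longrightarrow> (\<forall>s. m \<noteq> Push s))"
  shows "special_cspda (map_cspda f g E M)"
proof -
  interpret cspda_renaming M f g E by (rule assms(1))
  have discipline: "stack_discipline M'"
    unfolding stack_discipline_def
  proof (intro conjI allI impI)
    show "{Bottom, Padding, Top} \<subseteq> check_alphabet M'" "{Bottom, Padding} \<subseteq> pushdown_alphabet M'"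
      using E by auto
  next
    fix r es assume "initialises M' r es"
    then obtain q ds where q: "es = map g ds" "initialises M q ds" using initialises_mapD by blast
    have "map g (tl ds) = tl es" "map g (butlast ds) = butlast es" using q(1) by (simp_all add: map_tl map_butlast)
    then have "set (tl es) = g ` set (tl ds)" "set (butlast es) = g ` set (butlast ds)" by (metis set_map)+
    then show "Bottom \<notin> set (tl es)" "Top \<notin> set (butlast es)"
      using init[OF q(2)] g by (metis imageE)+
  next
    fix r es x d assume i: "initialises M' r es" and s: "step M' (r, es, []) x d"
    then obtain q ds where q: "r = f q" "es = map g ds" "initialises M q ds" using initialises_mapD by blast
    then have "step M' (rename (q, ds, [])) x d" using s by (simp add: rename_def)
    then obtain c where c: "d = rename c" "step M (q, ds, []) x c"
      using step_mapD initialises_wf[OF q(3)] by blast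
    note fs = first_step[OF q(3) c(2)]
    obtain q' where q': "q' \<in> reading M" "c = (q', ds, [b])" using fs by blast
    show "es \<noteq> []" "x = None" using fs q(2) by auto
    show "hd es = Bottom" "last es = Top" using fs g by (auto simp: q(2) hd_map last_map)
    show "\<exists>q'\<in>reading M'. d = (q', es, [Bottom])"
      using c(1) q' q(2) g(1) by (auto simp: rename_def)
  next
    fix r x s' d' m' r'
    assume "(r, x, Some (s', d'), m', r') \<in> transitions M'"
    then obtain q v m q' where *: "(q, x, v, m, q') \<in> transitions M" "Some (s', d') = map_option (map_prod g g) v"
      "m' = map_stack_move g m" unfolding map_transition_iff by blast
    then obtain s d where v: "v = Some (s, d)" "s' = g s" "d' = g d" by (cases v) auto
    note mv = moves[OF *(1)[unfolded v]]
    show "m' \<noteq> Push Bottom" "m' \<noteq> Push Top" using mv *(3) g by (cases m; force)+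
    show "m' \<noteq> Pop" if "s' = Bottom"
    proof -
      have "s = b" using that v(2) g(1) by simp
      then show ?thesis using mv *(3) by (cases m) auto
    qed
    show "m' \<noteq> Push s2" if "d' = Top" for s2
    proof -
      have "d = t" using that v(3) g(2) by simp
      then show ?thesis using mv *(3) by (cases m) auto
    qed
  qed
  \<comment> \<open>The image of a difference is the difference of the images only where
    \<open>f\<close> is injective, so the entry states must be seen to lie in
    \<open>states M\<close>.\<close>
  have "f ` accepting M = f ` reading M - f ` entry_states M"
  proof -
    have "entry_states M \<subseteq> states M"
    proof
      fix q assume "q \<in> entry_states M"
      then obtain p ds x c where "initialises M p ds" "step M (p, ds, []) x c" "q = state_of c"
        unfolding entry_states_def entry_config_def by blast
      then have "wf c" "q = state_of c" using step_wf initialises_wf by blast+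
      then show "q \<in> states M" by (cases c) (simp add: wf_def)
    qed
    then show ?thesis using special(6) inj_on_image_set_diff[OF inj_f] states_closed(2) by blast
  qed
  then show ?thesis
    unfolding special_cspda_def
    using cspda_map reading_dichotomy_map deterministic_map discipline no_infinite_silent_run_map
      stable_under_rejected_map special by (simp add: entry_states_map image_mono)
qed

section \<open>Groups\<close>

lemma (in group) stack_value_mem_subgroup:
  assumes "subgroup F G" "X \<subseteq> F" "set r \<subseteq> X \<times> UNIV"
  shows "stack_value r \<in> F"
  using assms(3)
proof (induction r)
  case Nil
  then show ?case using subgroup.one_closed[OF assms(1)] by simp
next
  case (Cons y r)
  then have "letter_value y \<in> F"
    using assms(2) subgroup.m_inv_closed[OF assms(1)] by (auto simp: letter_value_def)
  then show ?case using Cons subgroup.m_closed[OF assms(1)] by simp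
qed

lemma (in group) generate_stack_value:
  assumes "subgroup F G" "X \<subseteq> F" "f \<in> generate (G\<lparr>carrier := F\<rparr>) X"
  shows "\<exists>r. set r \<subseteq> X \<times> UNIV \<and> f = stack_value r"
  using assms(3)
proof (induction rule: generate.induct)
  case one
  then show ?case by (intro exI[of _ "[]"]) simp
next
  case (incl h)
  then have "h \<in> carrier G" using assms subgroup.subset by blast
  then show ?case using incl by (intro exI[of _ "[(h, True)]"]) (simp add: letter_value_def)
next
  case (inv h)
  then have "h \<in> F" "h \<in> carrier G" using assms subgroup.subset by blast+
  then show ?case using inv assms(1)
    by (intro exI[of _ "[(h, False)]"]) (simp add: letter_value_def)
next
  case (eng h1 h2)
  then obtain r1 r2 where r: "set r1 \<subseteq> X \<times> UNIV" "h1 = stack_value r1" "set r2 \<subseteq> X \<times> UNIV" "h2 = stack_value r2"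
    by blast
  moreover have "X \<times> (UNIV :: bool set) \<subseteq> carrier G \<times> UNIV" using assms subgroup.subset by blast
  \<comment> \<open>The order is reversed because the word of the first factor lies at the bottom of
    the stack.\<close>
  ultimately have "stack_value (r2 @ r1) = h1 \<otimes> h2" by (subst stack_value_append) auto
  then show ?case using r by (intro exI[of _ "r2 @ r1"]) auto
qed

text \<open>The finitely many letters that occur in the rewriting rules suffice, so no finite generating set
  of the free subgroup is needed.\<close>

lemma virtually_free_exists:
  fixes K :: "('k, 'n) monoid_scheme" (structure)
  assumes "finitely_generated_group K" "virtually_free_group K"
  shows "\<exists>X T S out next_rep. virtually_free K X T S out next_rep \<and> \<one> \<notin> S"
proof -
  interpret group K using assms(2) by (simp add: virtually_free_group_def)
  obtain S0 where S0: "S0 \<subseteq> carrier K" "finite S0" "generate K S0 = carrier K"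
    using assms(1) by (auto simp: finitely_generated_group_def)
  \<comment> \<open>The identity is removed so that, in the wreath product, a generator from
    \<open>K\<close> can be told from one of \<open>H\<close> by its nontrivial top
    component.\<close>
  define S where "S = (S0 \<union> m_inv K ` S0) - {\<one>}"
  have S_closed: "S \<subseteq> carrier K" using S0(1) by (auto simp: S_def)
  have S_gen: "generate K S = carrier K"
  proof
    show "generate K S \<subseteq> carrier K" using generate_incl[OF S_closed] .
    have "S0 \<subseteq> generate K S"
    proof
      fix s assume "s \<in> S0"
      then show "s \<in> generate K S"
        by (cases "s = \<one>") (auto simp: S_def intro: generate.one generate.incl)
    qed
    then show "carrier K \<subseteq> generate K S"
      using generate_subgroup_incl[OF _ generate_is_subgroup[OF S_closed]] S0(3) by blast
  qed
  obtain F X0 where F: "subgroup F K" "finite (rcosets F)" and X0: "X0 \<subseteq> F"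
    "generate (K\<lparr>carrier := F\<rparr>) X0 = F"
    and free: "\<And>w. w \<in> lists (X0 \<times> UNIV) \<Longrightarrow> w \<noteq> [] \<Longrightarrow> reduced w \<Longrightarrow>
        signed_word_value (K\<lparr>carrier := F\<rparr>) w \<noteq> \<one>"
    using assms(2) by (auto simp: virtually_free_group_def free_group_def)
  have F_carrier: "F \<subseteq> carrier K" using subgroup.subset[OF F(1)] .
  have X0_carrier: "X0 \<subseteq> carrier K" using X0(1) F_carrier by blast
  have free': "stack_value r \<noteq> \<one>" if r: "set r \<subseteq> X0 \<times> UNIV" "r \<noteq> []" "reduced r" for r
  proof -
    have "map (\<lambda>(x, s). if s then x else inv\<^bsub>K\<lparr>carrier := F\<rparr>\<^esub> x) (rev r) =
        map (\<lambda>(x, s). if s then x else inv x) (rev r)"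
      using r(1) X0(1) F(1) by (intro map_cong) auto
    moreover have "(\<otimes>\<^bsub>K\<lparr>carrier := F\<rparr>\<^esub>) = (\<otimes>)" "\<one>\<^bsub>K\<lparr>carrier := F\<rparr>\<^esub> = \<one>" by simp_all
    ultimately have "signed_word_value (K\<lparr>carrier := F\<rparr>) (rev r) = signed_word_value K (rev r)"
      by (simp only: signed_word_value_def word_value_def)
    also have "\<dots> = stack_value r" using signed_word_value_eq[of "rev r"] r(1) X0_carrier by auto
    finally have "signed_word_value (K\<lparr>carrier := F\<rparr>) (rev r) = stack_value r" .
    moreover have "rev r \<in> lists (X0 \<times> UNIV)" using r(1) by (simp add: lists_eq_set)
    ultimately show ?thesis using free[of "rev r"] r(2,3) by simp
  qed
  \<comment> \<open>The coset \<open>F\<close> itself must be represented by the identity, so that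
    the identity belongs to \<open>T\<close> and has the empty word.\<close>
  define rep where "rep C = (if \<one> \<in> C then \<one> else SOME x. x \<in> C)" for C
  define T where "T = rep ` (rcosets F)"
  have rep_mem: "rep C \<in> C" if "C \<in> rcosets F" for C
    using subgroup.rcosets_non_empty[OF F(1) that] some_in_eq[of C] by (simp add: rep_def)
  have coset_mem: "F #> x \<in> rcosets F" if "x \<in> carrier K" for x
    using that by (auto simp: RCOSETS_def)
  have T_carrier: "T \<subseteq> carrier K"
    unfolding T_def using rep_mem rcosets_part_G[OF F(1)] by blast
  have rep_T: "rep (F #> t) = t" if t: "t \<in> T" for t
  proof -
    obtain x where x: "x \<in> carrier K" "t = rep (F #> x)" using t by (auto simp: T_def RCOSETS_def)
    then have "F #> x = F #> t" using repr_independence[OF _ x(1) F(1)] rep_mem coset_mem by blast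
    then show ?thesis using x(2) by simp
  qed
  have coset_F: "F #> (f \<otimes> x) = F #> x" if "f \<in> F" "x \<in> carrier K" for f x
  proof -
    have "f \<in> carrier K" using that(1) F_carrier by blast
    then show ?thesis
      using coset_mult_assoc[OF F_carrier _ that(2), of f] coset_join2[OF _ F(1) that(1)] by simp
  qed
  define next_rep where "next_rep t s = rep (F #> (t \<otimes> s))" for t s
  \<comment> \<open>The representative of the coset of \<open>t \<otimes> s\<close> differs from
    this element by a left factor in \<open>F\<close>, whose inverse is a word over the free
    generators.\<close>
  have out_exists: "\<exists>ys. set ys \<subseteq> X0 \<times> UNIV \<and> t \<otimes> s = stack_value (rev ys) \<otimes> next_rep t s"
    if "t \<in> T" "s \<in> S" for t s
  proof -
    have x: "t \<otimes> s \<in> carrier K" using that T_carrier S_closed by auto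
    let ?x = "t \<otimes> s"
    have "next_rep t s \<in> F #> ?x" unfolding next_rep_def using rep_mem coset_mem[OF x] by blast
    then obtain f where f: "f \<in> F" "next_rep t s = f \<otimes> ?x" unfolding r_coset_def by blast
    then have "inv f \<in> F" using subgroup.m_inv_closed[OF F(1)] by blast
    then obtain r where r: "set r \<subseteq> X0 \<times> UNIV" "inv f = stack_value r"
      using generate_stack_value[OF F(1) X0(1)] X0(2) by blast
    have "?x = inv f \<otimes> next_rep t s"
      using f x F_carrier by (simp add: m_assoc[symmetric] subsetD)
    then show ?thesis using r by (intro exI[of _ "rev r"]) simp
  qed
  define out where "out t s = (SOME ys. set ys \<subseteq> X0 \<times> UNIV \<and>
      t \<otimes> s = stack_value (rev ys) \<otimes> next_rep t s)" for t s
  have out: "set (out t s) \<subseteq> X0 \<times> UNIV \<and> t \<otimes> s = stack_value (rev (out t s)) \<otimes> next_rep t s"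
    if "t \<in> T" "s \<in> S" for t s
    unfolding out_def by (rule someI_ex[OF out_exists[OF that]])
  define X where "X = fst ` (\<Union>t \<in> T. \<Union>s \<in> S. set (out t s))"
  have fin: "finite S" "finite T" using S0(2) F(2) by (auto simp: S_def T_def)
  have X_X0: "X \<subseteq> X0" using out by (fastforce simp: X_def)
  have "virtually_free K X T S out next_rep"
  proof
    show "finite X" unfolding X_def using fin by blast
    show "X \<subseteq> carrier K" using X_X0 X0_carrier by blast
    show "stack_value r \<noteq> \<one>" if "set r \<subseteq> X \<times> UNIV" "r \<noteq> []" "reduced r" for r
      using free' that X_X0 by blast
    show "finite T" "finite S" "T \<subseteq> carrier K" "S \<subseteq> carrier K" "generate K S = carrier K"
      by (rule fin T_carrier S_closed S_gen)+
    show "\<one> \<in> T"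
    proof -
      have "\<one> \<in> F #> \<one>" using F(1) F_carrier subgroup.one_closed by (simp add: coset_mult_one)
      then have "rep (F #> \<one>) = \<one>" by (simp add: rep_def)
      then show ?thesis unfolding T_def using coset_mem[OF one_closed] by force
    qed
    show "t = t'" if "set r \<subseteq> X \<times> UNIV" "set r' \<subseteq> X \<times> UNIV" "t \<in> T" "t' \<in> T"
      "stack_value r \<otimes> t = stack_value r' \<otimes> t'" for r r' t t'
    proof -
      have mem: "stack_value r \<in> F" "stack_value r' \<in> F"
        using stack_value_mem_subgroup[OF F(1) X0(1)] that(1,2) X_X0 by blast+
      have "F #> t = F #> (stack_value r \<otimes> t)" using coset_F[OF mem(1)] that(3) T_carrier by blast
      also have "\<dots> = F #> t'" unfolding that(5) using coset_F[OF mem(2)] that(4) T_carrier by blast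
      finally have "rep (F #> t) = rep (F #> t')" by (rule arg_cong)
      then show ?thesis unfolding rep_T[OF that(3)] rep_T[OF that(4)] .
    qed
    show "inv s \<in> S" if "s \<in> S" for s
      using that S0(1) by (auto simp: S_def inv_eq_1_iff)
    show "set (out t s) \<subseteq> X \<times> UNIV" if "t \<in> T" "s \<in> S" for t s
    proof
      fix y assume "y \<in> set (out t s)"
      then have "fst y \<in> X" unfolding X_def using that by blast
      then show "y \<in> X \<times> UNIV" by (cases y) simp
    qed
    show "next_rep t s \<in> T" if "t \<in> T" "s \<in> S" for t s
      unfolding T_def next_rep_def using that T_carrier S_closed by (intro imageI coset_mem) auto
    show "t \<otimes> s = stack_value (rev (out t s)) \<otimes> next_rep t s" if "t \<in> T" "s \<in> S" for t s
      using out that by blast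
  qed
  moreover have "\<one> \<notin> S" by (simp add: S_def)
  ultimately show ?thesis by blast
qed

section \<open>The restricted wreath product as a group, and its generators\<close>

locale wreath = H: group H + K: group K
  for H :: "('h, 'm) monoid_scheme" and K :: "('k, 'n) monoid_scheme" (structure)
begin

abbreviation "W \<equiv> wreath_product H K"

definition base :: "('k \<Rightarrow> 'h) set" where
  "base = {f \<in> carrier K \<rightarrow>\<^sub>E carrier H. finite {x \<in> carrier K. f x \<noteq> \<one>\<^bsub>H\<^esub>}}"

lemma carrier_W: "carrier W = base \<times> carrier K"
  by (simp add: wreath_product_def Let_def carrier_sum_group base_def)

lemma one_W: "\<one>\<^bsub>W\<^esub> = (\<lambda>x \<in> carrier K. \<one>\<^bsub>H\<^esub>, \<one>)"
  by (simp add: wreath_product_def Let_def)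

lemma mult_W: "(f, k) \<otimes>\<^bsub>W\<^esub> (g, l) =
    (\<lambda>x \<in> carrier K. f x \<otimes>\<^bsub>H\<^esub> g (inv k \<otimes> x), k \<otimes> l)"
  by (auto simp: wreath_product_def Let_def fun_eq_iff)

lemma base_mem: "f \<in> base \<Longrightarrow> x \<in> carrier K \<Longrightarrow> f x \<in> carrier H"
  by (auto simp: base_def)

lemma base_undefined: "f \<in> base \<Longrightarrow> x \<notin> carrier K \<Longrightarrow> f x = undefined"
  using PiE_arb[of f "carrier K" "\<lambda>_. carrier H" x] by (simp add: base_def)

lemma base_eqI: "f \<in> base \<Longrightarrow> g \<in> base \<Longrightarrow> (\<And>x. x \<in> carrier K \<Longrightarrow> f x = g x) \<Longrightarrow> f = g"
  unfolding base_def by (auto intro: PiE_ext)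

lemma base_restrict:
  "(\<And>x. x \<in> carrier K \<Longrightarrow> f x \<in> carrier H) \<Longrightarrow> finite {x \<in> carrier K. f x \<noteq> \<one>\<^bsub>H\<^esub>} \<Longrightarrow>
     (\<lambda>x \<in> carrier K. f x) \<in> base"
  by (auto simp: base_def cong: conj_cong)

lemma finite_translate:
  assumes "f \<in> base" "k \<in> carrier K"
  shows "finite {x \<in> carrier K. f (k \<otimes> x) \<noteq> \<one>\<^bsub>H\<^esub>}"
proof (rule finite_subset)
  show "{x \<in> carrier K. f (k \<otimes> x) \<noteq> \<one>\<^bsub>H\<^esub>} \<subseteq>
      (\<lambda>y. inv k \<otimes> y) ` {y \<in> carrier K. f y \<noteq> \<one>\<^bsub>H\<^esub>}"
  proof
    fix x assume "x \<in> {x \<in> carrier K. f (k \<otimes> x) \<noteq> \<one>\<^bsub>H\<^esub>}"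
    then have "x = inv k \<otimes> (k \<otimes> x)" "k \<otimes> x \<in> {y \<in> carrier K. f y \<noteq> \<one>\<^bsub>H\<^esub>}"
      using assms(2) by (simp_all add: K.m_assoc[symmetric])
    then show "x \<in> (\<lambda>y. inv k \<otimes> y) ` {y \<in> carrier K. f y \<noteq> \<one>\<^bsub>H\<^esub>}" by blast
  qed
  show "finite ((\<lambda>y. inv k \<otimes> y) ` {y \<in> carrier K. f y \<noteq> \<one>\<^bsub>H\<^esub>})"
    using assms(1) by (simp add: base_def)
qed

lemma mult_base:
  assumes "f \<in> base" "g \<in> base" "k \<in> carrier K"
  shows "(\<lambda>x \<in> carrier K. f x \<otimes>\<^bsub>H\<^esub> g (inv k \<otimes> x)) \<in> base"
proof (rule base_restrict)
  show "f x \<otimes>\<^bsub>H\<^esub> g (inv k \<otimes> x) \<in> carrier H" if "x \<in> carrier K" for x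
    using assms that by (simp add: base_mem)
  have "finite ({x \<in> carrier K. f x \<noteq> \<one>\<^bsub>H\<^esub>} \<union> {x \<in> carrier K. g (inv k \<otimes> x) \<noteq> \<one>\<^bsub>H\<^esub>})"
    using finite_translate[OF assms(2)] assms(1,3) by (simp add: base_def)
  then show "finite {x \<in> carrier K. f x \<otimes>\<^bsub>H\<^esub> g (inv k \<otimes> x) \<noteq> \<one>\<^bsub>H\<^esub>}"
    by (rule rev_finite_subset) auto
qed

lemma one_base: "(\<lambda>x \<in> carrier K. \<one>\<^bsub>H\<^esub>) \<in> base"
  by (rule base_restrict) auto

lemma inv_base:
  assumes "f \<in> base" "k \<in> carrier K"
  shows "(\<lambda>x \<in> carrier K. inv\<^bsub>H\<^esub> (f (k \<otimes> x))) \<in> base"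
proof (rule base_restrict)
  show "inv\<^bsub>H\<^esub> (f (k \<otimes> x)) \<in> carrier H" if "x \<in> carrier K" for x
    using assms that by (simp add: base_mem)
  show "finite {x \<in> carrier K. inv\<^bsub>H\<^esub> (f (k \<otimes> x)) \<noteq> \<one>\<^bsub>H\<^esub>}"
    using finite_translate[OF assms] by (rule rev_finite_subset) auto
qed

lemma l_inv_W:
  assumes "f \<in> base" "k \<in> carrier K"
  shows "(\<lambda>x \<in> carrier K. inv\<^bsub>H\<^esub> (f (k \<otimes> x)), inv k) \<otimes>\<^bsub>W\<^esub> (f, k) = \<one>\<^bsub>W\<^esub>"
  using assms by (auto simp: mult_W one_W fun_eq_iff base_mem)

lemma group_W: "group W"
proof (rule groupI)
  show "a \<otimes>\<^bsub>W\<^esub> b \<in> carrier W" if "a \<in> carrier W" "b \<in> carrier W" for a b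
    using that mult_base by (cases a; cases b) (auto simp: carrier_W mult_W)
  show "\<one>\<^bsub>W\<^esub> \<in> carrier W" using one_base by (simp add: carrier_W one_W)
  show "a \<otimes>\<^bsub>W\<^esub> b \<otimes>\<^bsub>W\<^esub> c = a \<otimes>\<^bsub>W\<^esub> (b \<otimes>\<^bsub>W\<^esub> c)"
    if "a \<in> carrier W" "b \<in> carrier W" "c \<in> carrier W" for a b c
    using that by (cases a; cases b; cases c)
      (auto simp: carrier_W mult_W fun_eq_iff base_mem H.m_assoc K.m_assoc K.inv_mult_group)
  show "\<one>\<^bsub>W\<^esub> \<otimes>\<^bsub>W\<^esub> a = a" if "a \<in> carrier W" for a
  proof -
    obtain f k where a: "a = (f, k)" "f \<in> base" "k \<in> carrier K" using \<open>a \<in> carrier W\<close> by (auto simp: carrier_W)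
    have "(\<lambda>x \<in> carrier K. f x) = f" using a(2) by (auto simp: base_def)
    then show ?thesis using a by (auto simp: one_W mult_W base_mem cong: restrict_cong)
  qed
  show "\<exists>b \<in> carrier W. b \<otimes>\<^bsub>W\<^esub> a = \<one>\<^bsub>W\<^esub>" if "a \<in> carrier W" for a
    using that l_inv_W inv_base by (cases a) (fastforce simp: carrier_W)
qed

sublocale W: group W
  by (rule group_W)

definition embed_H :: "'h \<Rightarrow> ('k \<Rightarrow> 'h) \<times> 'k" where
  "embed_H h = (\<lambda>x \<in> carrier K. if x = \<one> then h else \<one>\<^bsub>H\<^esub>, \<one>)"

definition embed_K :: "'k \<Rightarrow> ('k \<Rightarrow> 'h) \<times> 'k" where
  "embed_K k = (\<lambda>x \<in> carrier K. \<one>\<^bsub>H\<^esub>, k)"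

lemma embed_H_closed: "h \<in> carrier H \<Longrightarrow> embed_H h \<in> carrier W"
  by (auto simp: embed_H_def carrier_W intro!: base_restrict finite_subset[of _ "{\<one>}"] split: if_splits)

lemma embed_K_closed: "k \<in> carrier K \<Longrightarrow> embed_K k \<in> carrier W"
  by (simp add: embed_K_def carrier_W one_base)

lemma embed_H_mult:
  "h \<in> carrier H \<Longrightarrow> h' \<in> carrier H \<Longrightarrow> embed_H h \<otimes>\<^bsub>W\<^esub> embed_H h' = embed_H (h \<otimes>\<^bsub>H\<^esub> h')"
  by (auto simp: embed_H_def mult_W fun_eq_iff)

lemma embed_K_mult:
  "k \<in> carrier K \<Longrightarrow> k' \<in> carrier K \<Longrightarrow> embed_K k \<otimes>\<^bsub>W\<^esub> embed_K k' = embed_K (k \<otimes> k')"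
  by (auto simp: embed_K_def mult_W fun_eq_iff)

lemma embed_one: "embed_H \<one>\<^bsub>H\<^esub> = \<one>\<^bsub>W\<^esub>" "embed_K \<one> = \<one>\<^bsub>W\<^esub>"
  by (auto simp: embed_H_def embed_K_def one_W)

lemma embed_H_inv: "h \<in> carrier H \<Longrightarrow> inv\<^bsub>W\<^esub> (embed_H h) = embed_H (inv\<^bsub>H\<^esub> h)"
  by (intro W.inv_equality) (simp_all add: embed_H_mult embed_one embed_H_closed)

lemma embed_K_inv: "k \<in> carrier K \<Longrightarrow> inv\<^bsub>W\<^esub> (embed_K k) = embed_K (inv k)"
  by (intro W.inv_equality) (simp_all add: embed_K_mult embed_one embed_K_closed)

text \<open>Conjugating \<open>embed_H h\<close> by \<open>embed_K x\<close> moves its support from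
  the identity to \<open>x\<close>. A base element has finite support and is therefore a finite
  product of such conjugates; one factor \<open>embed_K k\<close> supplies the top
  component.\<close>

lemma generate_W:
  assumes A: "A \<subseteq> carrier H" "generate H A = carrier H" and S: "S \<subseteq> carrier K" "generate K S = carrier K"
  shows "generate W (embed_H ` A \<union> embed_K ` S) = carrier W"
proof
  let ?B = "embed_H ` A \<union> embed_K ` S"
  let ?G = "generate W ?B"
  have B: "?B \<subseteq> carrier W" using A(1) S(1) embed_H_closed embed_K_closed by blast
  show "?G \<subseteq> carrier W" using W.generate_incl[OF B] .
  have gen_H: "embed_H h \<in> ?G" if "h \<in> generate H A" for h
    using that
  proof (induction rule: generate.induct)
    case one
    then show ?case unfolding embed_one by (rule generate.one)
  next
    case (incl h)
    then show ?case by (intro generate.incl) blast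
  next
    case (inv h)
    then have "inv\<^bsub>W\<^esub> (embed_H h) \<in> ?G" by (intro generate.inv) blast
    then show ?case using inv A(1) embed_H_inv by (metis subsetD)
  next
    case (eng h1 h2)
    then have "embed_H h1 \<otimes>\<^bsub>W\<^esub> embed_H h2 \<in> ?G" by (intro generate.eng)
    then show ?case using eng.hyps A(2) embed_H_mult by simp
  qed
  have gen_K: "embed_K k \<in> ?G" if "k \<in> generate K S" for k
    using that
  proof (induction rule: generate.induct)
    case one
    then show ?case unfolding embed_one by (rule generate.one)
  next
    case (incl k)
    then show ?case by (intro generate.incl) blast
  next
    case (inv k)
    then have "inv\<^bsub>W\<^esub> (embed_K k) \<in> ?G" by (intro generate.inv) blast
    then show ?case using inv S(1) embed_K_inv by (metis subsetD)
  next
    case (eng k1 k2)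
    then have "embed_K k1 \<otimes>\<^bsub>W\<^esub> embed_K k2 \<in> ?G" by (intro generate.eng)
    then show ?case using eng.hyps S(2) embed_K_mult by simp
  qed
  have single: "(\<lambda>y \<in> carrier K. if y = x then h else \<one>\<^bsub>H\<^esub>, \<one>) \<in> ?G"
    if x: "x \<in> carrier K" and h: "h \<in> carrier H" for x h
  proof -
    have "inv x \<otimes> y = \<one> \<longleftrightarrow> y = x" if "y \<in> carrier K" for y
      using that x K.inv_solve_left[of "\<one>" x y] by auto
    then have "embed_K x \<otimes>\<^bsub>W\<^esub> embed_H h \<otimes>\<^bsub>W\<^esub> embed_K (inv x) =
        (\<lambda>y \<in> carrier K. if y = x then h else \<one>\<^bsub>H\<^esub>, \<one>)"
      using x h by (auto simp: embed_K_def embed_H_def mult_W fun_eq_iff)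
    moreover have "embed_K x \<otimes>\<^bsub>W\<^esub> embed_H h \<otimes>\<^bsub>W\<^esub> embed_K (inv x) \<in> ?G"
      using gen_K gen_H x h A(2) S(2) by (intro generate.eng) auto
    ultimately show ?thesis by simp
  qed
  \<comment> \<open>The induction runs over a finite set that contains the support, so a point of
    this set at which \<open>f\<close> is already trivial needs no separate treatment.\<close>
  have base: "f \<in> base \<Longrightarrow> {x \<in> carrier K. f x \<noteq> \<one>\<^bsub>H\<^esub>} \<subseteq> F \<Longrightarrow> (f, \<one>) \<in> ?G"
    if "finite F" for F f
    using that
  proof (induction F arbitrary: f rule: finite_induct)
    case empty
    then have f: "f = (\<lambda>x \<in> carrier K. \<one>\<^bsub>H\<^esub>)" by (intro base_eqI one_base) auto
    show ?case using generate.one[of W ?B] by (simp only: one_W f)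
  next
    case (insert x F)
    show ?case
    proof (cases "x \<in> carrier K")
      case False
      then show ?thesis using insert by blast
    next
      case True
      \<comment> \<open>The value at \<open>x\<close> is split off as a function concentrated in
        \<open>x\<close>; the remaining function \<open>?g\<close> falls under the induction
        hypothesis.\<close>
      let ?g = "\<lambda>y \<in> carrier K. if y = x then \<one>\<^bsub>H\<^esub> else f y"
      have "finite {x \<in> carrier K. f x \<noteq> \<one>\<^bsub>H\<^esub>}" using insert.prems by (simp add: base_def)
      then have g: "?g \<in> base"
        using insert.prems(1) base_mem by (intro base_restrict) (auto elim: rev_finite_subset)
      have "(?g, \<one>) \<in> ?G" using insert.prems(2) by (intro insert.IH g) auto
      moreover have "(\<lambda>y \<in> carrier K. if y = x then f x else \<one>\<^bsub>H\<^esub>, \<one>) \<in> ?G"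
        using single True base_mem insert.prems(1) by blast
      ultimately have "(\<lambda>y \<in> carrier K. if y = x then f x else \<one>\<^bsub>H\<^esub>, \<one>) \<otimes>\<^bsub>W\<^esub> (?g, \<one>) \<in> ?G"
        by (intro generate.eng)
      moreover have "(\<lambda>y \<in> carrier K. if y = x then f x else \<one>\<^bsub>H\<^esub>, \<one>) \<otimes>\<^bsub>W\<^esub> (?g, \<one>) = (f, \<one>)"
        using insert.prems(1) True by (auto simp: mult_W fun_eq_iff base_mem base_undefined)
      ultimately show ?thesis by simp
    qed
  qed
  show "carrier W \<subseteq> ?G"
  proof
    fix a assume "a \<in> carrier W"
    then obtain f k where a: "a = (f, k)" "f \<in> base" "k \<in> carrier K" by (auto simp: carrier_W)
    have "(f, \<one>) \<in> ?G" using a(2) by (intro base[of "{x \<in> carrier K. f x \<noteq> \<one>\<^bsub>H\<^esub>}"]) (auto simp: base_def)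
    then have "(f, \<one>) \<otimes>\<^bsub>W\<^esub> embed_K k \<in> ?G" using gen_K a(3) S(2) by (intro generate.eng) auto
    moreover have "(f, \<one>) \<otimes>\<^bsub>W\<^esub> embed_K k = a"
      using a by (auto simp: mult_W embed_K_def fun_eq_iff base_mem base_undefined)
    ultimately show "a \<in> ?G" by simp
  qed
qed

end

section \<open>Words over the generators of the wreath product\<close>

lemma (in wreath) word_value_closed_H: "set x \<subseteq> carrier H \<Longrightarrow> word_value H x \<in> carrier H"
  by (induction x) (auto simp: word_value_def)

text \<open>A generator with trivial top component comes from \<open>H\<close> and is determined by
  its value at the identity. For generators from \<open>K\<close> the decoding is correct if the
  identity is not among them, hence the assumption of \<open>wreath_words\<close>.\<close>

definition wreath_decode :: "('h, 'm) monoid_scheme \<Rightarrow> ('k, 'n) monoid_scheme \<Rightarrow> ('k \<Rightarrow> 'h) \<times> 'k \<Rightarrow> 'h + 'k" where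
  "wreath_decode H K a = (if snd a = \<one>\<^bsub>K\<^esub> then Inl (fst a \<one>\<^bsub>K\<^esub>) else Inr (snd a))"

locale wreath_words = wreath H K +
  wreath_automaton K X T S out next_rep H A N "wreath.embed_H H K ` A \<union> wreath.embed_K H K ` S" "wreath_decode H K"
  for H :: "('h, 'm) monoid_scheme" and K :: "('k, 'n) monoid_scheme" and X T S out next_rep A N +
  assumes one_notin_S: "\<one>\<^bsub>K\<^esub> \<notin> S"
begin

lemma decode_embed_H: "wreath_decode H K (embed_H h) = Inl h"
  by (simp add: wreath_decode_def embed_H_def)

lemma decode_embed_K: "s \<in> S \<Longrightarrow> wreath_decode H K (embed_K s) = Inr s"
  using one_notin_S by (auto simp: wreath_decode_def embed_K_def)

text \<open>The first letter acts on the value of the rest. A generator from \<open>K\<close> in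
  front translates all components and multiplies the position from the left, which are
  \<open>component_mult\<close> and \<open>top_position_mult\<close>; one from \<open>H\<close>
  contributes at the identity only.\<close>

lemma word_value_W:
  assumes "u \<in> lists (embed_H ` A \<union> embed_K ` S)"
  shows "word_value W u \<in> carrier W \<and> snd (word_value W u) = top_position \<one>\<^bsub>K\<^esub> u \<and>
    (\<forall>k \<in> carrier K. fst (word_value W u) k = word_value H (component k \<one>\<^bsub>K\<^esub> u))"
  using assms
proof (induction u rule: list.induct)
  case Nil
  then show ?case by (simp add: word_value_def one_W carrier_W one_base)
next
  case (Cons a u)
  have uB: "u \<in> lists (embed_H ` A \<union> embed_K ` S)" and a: "a \<in> embed_H ` A \<union> embed_K ` S"
    using Cons.prems by (simp_all only: Cons_in_lists_iff)
  obtain f l where fl: "word_value W u = (f, l)" by (cases "word_value W u")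
  have IH: "f \<in> base" "l \<in> carrier K" "l = top_position \<one>\<^bsub>K\<^esub> u"
    "\<And>k. k \<in> carrier K \<Longrightarrow> f k = word_value H (component k \<one>\<^bsub>K\<^esub> u)"
    using Cons.IH[OF uB] unfolding fl carrier_W by auto
  have "(f, l) \<in> carrier W" using IH(1,2) by (simp add: carrier_W)
  then have closed: "word_value W (a # u) \<in> carrier W" if "a \<in> carrier W"
    using that fl by (simp add: word_value_def)
  have wv: "word_value W (a # u) = a \<otimes>\<^bsub>W\<^esub> (f, l)" using fl by (simp add: word_value_def)
  consider (H) h where "h \<in> A" "a = embed_H h" | (K) s where "s \<in> S" "a = embed_K s" using a by blast
  then show ?case
  proof cases
    case H
    have h: "h \<in> carrier H" using H(1) A_closed by blast
    have "a \<in> carrier W" using H(2) embed_H_closed[OF h] by simp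
    then have "word_value W (a # u) \<in> carrier W" by (rule closed)
    moreover have "snd (word_value W (a # u)) = top_position \<one>\<^bsub>K\<^esub> (a # u)"
      using IH(2,3) unfolding wv by (simp add: H(2) decode_embed_H) (simp add: embed_H_def mult_W)
    moreover have "fst (word_value W (a # u)) k = word_value H (component k \<one>\<^bsub>K\<^esub> (a # u))" if k: "k \<in> carrier K" for k
    proof -
      have "set (component k \<one>\<^bsub>K\<^esub> u) \<subseteq> carrier H"
        using component_lists[OF uB, of k "\<one>\<^bsub>K\<^esub>"] A_closed unfolding lists_eq_set by blast
      then have c: "word_value H (component k \<one>\<^bsub>K\<^esub> (a # u)) =
          (if k = \<one>\<^bsub>K\<^esub> then h else \<one>\<^bsub>H\<^esub>) \<otimes>\<^bsub>H\<^esub> word_value H (component k \<one>\<^bsub>K\<^esub> u)"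
        using h word_value_closed_H[of "component k \<one>\<^bsub>K\<^esub> u"]
        by (auto simp: H(2) decode_embed_H word_value_def)
      show ?thesis unfolding c unfolding wv unfolding H(2) using k IH(4)[OF k] by (simp add: embed_H_def mult_W)
    qed
    ultimately show ?thesis by blast
  next
    case K
    have s: "s \<in> carrier K" using K(1) S_closed by blast
    have "a \<in> carrier W" using K(2) embed_K_closed[OF s] by simp
    then have "word_value W (a # u) \<in> carrier W" by (rule closed)
    moreover have "snd (word_value W (a # u)) = top_position \<one>\<^bsub>K\<^esub> (a # u)"
      using top_position_mult[OF uB s K.one_closed] s IH(3)
      unfolding wv by (simp add: K(2) decode_embed_K[OF K(1)]) (simp add: embed_K_def mult_W)
    moreover have "fst (word_value W (a # u)) k = word_value H (component k \<one>\<^bsub>K\<^esub> (a # u))" if k: "k \<in> carrier K" for k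
    proof -
      have c: "component k \<one>\<^bsub>K\<^esub> (a # u) = component (inv\<^bsub>K\<^esub> s \<otimes>\<^bsub>K\<^esub> k) \<one>\<^bsub>K\<^esub> u"
        using component_mult[OF uB k s K.one_closed] s by (simp add: K(2) decode_embed_K[OF K(1)])
      have "f (inv\<^bsub>K\<^esub> s \<otimes>\<^bsub>K\<^esub> k) \<in> carrier H" using IH(1) base_mem s k by simp
      then have "fst (word_value W (a # u)) k = f (inv\<^bsub>K\<^esub> s \<otimes>\<^bsub>K\<^esub> k)"
        unfolding wv unfolding K(2) using k s by (simp add: embed_K_def mult_W)
      then show ?thesis unfolding c using IH(4) s k by simp
    qed
    ultimately show ?thesis by blast
  qed
qed

lemma trivial_iff:
  assumes "u \<in> lists (embed_H ` A \<union> embed_K ` S)"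
  shows "trivial u \<longleftrightarrow> word_value W u = \<one>\<^bsub>W\<^esub>"
proof
  note wv = word_value_W[OF assms]
  assume "trivial u"
  then have "fst (word_value W u) = (\<lambda>x \<in> carrier K. \<one>\<^bsub>H\<^esub>)"
    using wv by (intro base_eqI one_base) (auto simp: trivial_def carrier_W)
  moreover have "snd (word_value W u) = \<one>\<^bsub>K\<^esub>" using wv \<open>trivial u\<close> by (simp add: trivial_def)
  ultimately show "word_value W u = \<one>\<^bsub>W\<^esub>" by (simp add: one_W prod_eq_iff)
next
  assume one: "word_value W u = \<one>\<^bsub>W\<^esub>"
  then show "trivial u" using word_value_W[OF assms] by (simp add: trivial_def one_W)
qed

lemma language_M_eq: "language M = coWP W (embed_H ` A \<union> embed_K ` S)"
  using trivial_iff by (auto simp: language_M coWP_def)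

end

section \<open>Encoding with the prescribed states and symbols\<close>

context wreath_automaton
begin

text \<open>The three distinguished symbols go to their namesakes, on which the stack discipline
  depends. For the others any injection of the finite alphabet into the remaining symbols will
  do.\<close>

definition encode_sym :: "('h, 'k) wsym \<Rightarrow> 'a stack_symbol" where
  "encode_sym s = (case s of SBot \<Rightarrow> Bottom | SPad \<Rightarrow> Padding | STop \<Rightarrow> Top
     | _ \<Rightarrow> Aux (to_nat_on (Collect ok_sym) s))"

lemma encode_sym_iff: "encode_sym s = Bottom \<longleftrightarrow> s = SBot" "encode_sym s = Top \<longleftrightarrow> s = STop"
  by (cases s; simp add: encode_sym_def)+

lemma inj_encode_sym: "inj_on encode_sym (Collect ok_sym)"
proof (rule inj_onI)
  fix s s' assume *: "s \<in> Collect ok_sym" "s' \<in> Collect ok_sym" "encode_sym s = encode_sym s'"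
  have inj: "s = s'" if "to_nat_on (Collect ok_sym) s = to_nat_on (Collect ok_sym) s'"
    using that * inj_on_to_nat_on[OF countable_finite[OF finite_ok_sym]] by (auto dest: inj_onD)
  then show "s = s'"
    using *(3) by (cases s; cases s') (auto simp: encode_sym_def)
qed

lemma step_M_initial_discipline:
  assumes "initialises M q ds" "step M (q, ds, []) x c"
  shows "ds \<noteq> [] \<and> hd ds = SBot \<and> last ds = STop \<and> x = None \<and> (\<exists>q' \<in> reading M. c = (q', ds, [SBot]))"
proof -
  obtain m q1 t ds0 n where *: "q = Ready m q1 t" "x = None" "c = (Reading m q1 t (m = None), ds, [SBot])"
    "check_prefix m ds0" "ds = ds0 @ replicate n SPad @ [STop]" "ok_state q"
    using step_M_initial[OF assms] by metis
  have "entry_config M c" using assms unfolding entry_config_def by blast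
  then have "Reading m q1 t (m = None) \<in> reading M" using entry_config_reading *(3) by fastforce
  then show ?thesis using * check_prefix_set[OF *(4)] by (auto simp: hd_append)
qed

lemma moves_M:
  assumes "(q, x, Some (s, d), m, q') \<in> transitions M"
  shows "m \<noteq> Push SBot \<and> m \<noteq> Push STop \<and> (s = SBot \<longrightarrow> m \<noteq> Pop) \<and> (d = STop \<longrightarrow> (\<forall>s. m \<noteq> Push s))"
proof -
  have "tr q x (Some (s, d)) m q'" using assms by (simp add: M_transition_iff)
  then show ?thesis
  proof (cases rule: tr.cases)
    case (open_inner a h \<kappa> q t b)
    then show ?thesis by (auto simp: at_target_def)
  next
    case (inner_letter q h g d mv q' \<kappa>)
    then show ?thesis by (cases mv) auto
  next
    case (inner_silent q g d mv q' \<kappa>)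
    then show ?thesis by (cases mv) auto
  next
    case (write_any mo y q t ys)
    then show ?thesis by (auto simp: letter_move_def)
  next
    case (write_pop mo y q t ys)
    then show ?thesis by (auto simp: letter_move_def split: if_splits)
  qed auto
qed

lemma special_exists:
  "\<exists>M' :: (nat, 'a, 'a stack_symbol) cspda. special_cspda M' \<and> input_alphabet M' = B \<and>
     Letter ` B \<subseteq> check_alphabet M' \<and> Letter ` B \<subseteq> pushdown_alphabet M' \<and> language M' = language M"
proof -
  let ?f = "to_nat_on (Collect ok_state)"
  let ?E = "{Bottom, Padding, Top} \<union> Letter ` B"
  have ren: "cspda_renaming M ?f encode_sym ?E"
    using cspda_M inj_on_to_nat_on[OF countable_finite[OF finite_ok_state]] inj_encode_sym finite_B
    by unfold_locales simp_all
  interpret cspda_renaming M ?f encode_sym ?E by (rule ren)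
  have "special_cspda M'"
    by (rule special_map_cspda[OF ren _ reading_dichotomy_M deterministic_M no_infinite_silent_run_M
          accepting_reading_M stable_under_rejected_M entry_states_M encode_sym_iff
          initialises_M_symbols step_M_initial_discipline moves_M]) auto
  then show ?thesis using language_map by (intro exI[of _ M']) (auto simp: map_cspda_def)
qed

end

theorem theorem6p2:
  fixes H :: "('h, 'm) monoid_scheme" and K :: "('k, 'n) monoid_scheme"
  assumes "special_co_ET0L_group H"
    and "finitely_generated_group K"
    and "virtually_free_group K"
  shows "special_co_ET0L_group (wreath_product H K)"
proof -
  obtain A N where H: "group H" and A: "A \<subseteq> carrier H" "finite A" "\<forall>a \<in> A. inv\<^bsub>H\<^esub> a \<in> A"
      "generate H A = carrier H"
    and N: "special_cspda (N :: (nat, 'h, 'h stack_symbol) cspda)" "input_alphabet N = A" "language N = coWP H A"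
    using assms(1) unfolding special_co_ET0L_group_def by (elim conjE exE) (rule that; assumption)
  obtain X T S out next_rep where K: "virtually_free K X T S out next_rep" and one_S: "\<one>\<^bsub>K\<^esub> \<notin> S"
    using virtually_free_exists[OF assms(2,3)] by blast
  interpret virtually_free K X T S out next_rep by (rule K)
  interpret group_H: group H by (rule H)
  interpret wreath H K ..
  interpret wreath_words H K X T S out next_rep A N
  proof
    show "finite (embed_H ` A \<union> embed_K ` S)" using A(2) finite_S by simp
    show "wreath_decode H K a \<in> A <+> S" if "a \<in> embed_H ` A \<union> embed_K ` S" for a
      using that one_S by (auto simp: wreath_decode_def embed_H_def embed_K_def)
  qed (use A N one_S in auto)
  let ?B = "embed_H ` A \<union> embed_K ` S"
  have "?B \<subseteq> carrier W" using A(1) S_closed embed_H_closed embed_K_closed by blast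
  moreover have "\<forall>a \<in> ?B. inv\<^bsub>W\<^esub> a \<in> ?B"
    using A(1,3) S_closed S_inv embed_H_inv embed_K_inv by (auto simp: subset_iff)
  moreover have "generate W ?B = carrier W" using generate_W A(1,4) S_closed S_generates by blast
  moreover have "\<exists>M' :: (nat, _, _ stack_symbol) cspda. special_cspda M' \<and> input_alphabet M' = ?B \<and>
      Letter ` ?B \<subseteq> check_alphabet M' \<and> Letter ` ?B \<subseteq> pushdown_alphabet M' \<and> language M' = coWP W ?B"
    using special_exists unfolding language_M_eq .
  ultimately show ?thesis
    unfolding special_co_ET0L_group_def
    by (intro conjI exI[of _ ?B] group_W finite_B)
qed

end
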